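(* (i) Let $(U,E)$ and $(U',E')$ be pairs, each formed of a quaternionic vector space and a real vector subspace. Suppose that at least one of $(U,E)$, $(U',E')$ is torsion free. Then the product pair $(U\times U',E\times E')$ does not depend (up to isomorphism of pairs) on the particular orientation preserving isometry used to define the product quaternionic structure of $E\times E'$. (ii) Any pair $(U,E)$ formed of a quaternionic vector space and a real vector subspace decomposes uniquely (up to isomorphism of the factors) as the product of a torsion pair $(U_t,E_t)$, the pair $(U_-,E_-)$ given by a CR quaternionic vector space, and the pair given by a co-CR quaternionic vector space. Moreover, the filtration $$(0,0)\subseteq(U_-,E_-)\subseteq(U_-,E_-)\times(U_t,E_t)\subseteq(U,E)$$ is canonical, that is, as a filtration of $(U,E)$ by subpairs it depends only on $(U,E)$ and not on the choice of such a decomposition.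
   Context: All vector spaces are finite-dimensional. $\mathbb{H}$ denotes the quaternions and $S^2$ the set of unit imaginary quaternions. Quaternionic vector spaces. A linear hypercomplex structure on a real vector space $E$ is a morphism of unital associative algebras $\rho:\mathbb{H}\to\mathrm{End}(E)$. The group $\mathrm{SO}(3,\mathbb{R})=\mathrm{Aut}(\mathbb{H})$ acts on the set of these by precomposition; a linear quaternionic structure on $E$ is a (nonempty) orbit of this action, and a quaternionic vector space is a real vector space endowed with a linear quaternionic structure. If $\rho$ represents the structure, $Z=\rho(S^2)$ is the space of admissible linear complex structures on $E$; it depends only on the quaternionic structure, and carries the metric and orientation transported from $S^2$ by $\rho$. A linear quaternionic map $t:E\to E'$ between quaternionic vector spaces (with spaces of admissible structures $Z,Z'$) is a real linear map for which there is a function $T:Z\to Z'$ with $t\circ J=T(J)\circ t$ for all $J\in Z$. Pairs. A pair $(U,E)$ consists of a quaternionic vector space $E$ and a real vector subspace $U\subseteq E$. A morphism $(U,E)\to(U',E')$ is a linear quaternionic map $t:E\to E'$ with $t(U)\subseteq U'$; an isomorphism is an invertible morphism. Products. Let $E,E'$ be quaternionic vector spaces, $T:Z\to Z'$ an orientation preserving isometry, and $\rho$ a representative of the structure of $E$. Then $T$ is the restriction of a unique linear map $\widetilde{T}:\rho(\mathbb{H})\to\mathrm{End}(E')$ such that $\widetilde{T}\circ\rho$ represents the structure of $E'$; the product quaternionic structure on $E\times E'$ with respect to $T$ is represented by $q\mapsto(\rho(q),\widetilde{T}(\rho(q)))$. The product of pairs is $(U,E)\times(U',E')=(U\times U',E\times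 E')$, with respect to such a $T$; products of several pairs are defined likewise. A decomposition of $(U,E)$ as a product means an isomorphism of $(U,E)$ with a product of pairs formed with respect to some choice of such isometries. CR and co-CR quaternionic vector spaces. A CR quaternionic vector space is a vector space $U$ with an injective linear map $\iota:U\to E$ into a quaternionic vector space such that $\mathrm{im}\,\iota+J(\mathrm{im}\,\iota)=E$ for every admissible $J\in Z$; the pair it gives is $(\mathrm{im}\,\iota,E)$. Dually, a co-CR quaternionic vector space is a vector space $U$ with a surjective linear map $r:E\to U$ from a quaternionic vector space such that $\ker r\cap J(\ker r)=0$ for every $J\in Z$; the pair it gives is $(\ker r,E)$. The sheaf of a pair. For a quaternionic vector space $E$ and $J\in Z$, let $E^J\subseteq E^{\mathbb{C}}$ be the $-\mathrm{i}$ eigenspace of (the complexification of) $J$. Then $E^{0,1}=\bigcup_{J\in Z}\{J\}\times E^J$ is a holomorphic vector subbundle of $Z\times E^{\mathbb{C}}$ over $Z\cong\mathbb{C}P^1$. For a real subspace $U\subseteq E$, the projection $E\to E/U$ induces a morphism of holomorphic vector bundles $E^{0,1}\to Z\times(E/U)^{\mathbb{C}}$; let $\mathcal{U}_-$ and $\mathcal{U}_+$ be its kernel and cokernel (as coherent analytic sheaves). The sheaf of $(U,E)$ is $\mathcal{U}=\mathcal{U}_-\oplus\mathcal{U}_+$. The pair $(U,E)$ is a torsion pair if $\mathcal{U}$ is a torsion sheaf, and is torsion free if $\mathcal{U}$ is torsion free (equivalently, a holomorphic vector bundle). *)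

theory Defs
  imports "HOL-Analysis.Analysis"
begin

section \<open>Quaternions\<close>

text \<open>The pair \<open>(a, v)\<close> stands for the quaternion with real part \<open>a\<close> and imaginary part \<open>v\<close>.\<close>

type_synonym quat = "real \<times> (real^3)"

definition qone :: quat where
  "qone = (1, 0)"

definition qmult :: "quat \<Rightarrow> quat \<Rightarrow> quat" where
  "qmult p q = (fst p * fst q - snd p \<bullet> snd q,
                fst p *\<^sub>R snd q + fst q *\<^sub>R snd p + cross3 (snd p) (snd q))"

definition S2 :: "(real^3) set" where
  "S2 = sphere 0 1"

text \<open>Tangent vectors of \<open>S2\<close> at \<open>u\<close> are the \<open>v\<close> orthogonal to \<open>u\<close>; a tangent frame \<open>(v, w)\<close> is
  positive if \<open>(u, v, w)\<close> is a positive frame of the space of imaginary quaternions.  For maps of the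
  whole sphere, preserving the chordal distance (used here) and the geodesic distance are the same.\<close>

definition op_isometry :: "(real^3 \<Rightarrow> real^3) \<Rightarrow> bool" where
  "op_isometry T \<longleftrightarrow>
     bij_betw T S2 S2 \<and>
     (\<forall>u\<in>S2. \<forall>v\<in>S2. dist (T u) (T v) = dist u v) \<and>
     (\<forall>u\<in>S2. \<exists>D. (T has_derivative D) (at u within S2) \<and>
        (\<forall>v w. v \<bullet> u = 0 \<and> w \<bullet> u = 0 \<and> u \<bullet> cross3 v w > 0 \<longrightarrow> T u \<bullet> cross3 (D v) (D w) > 0))"


section \<open>Quaternionic vector spaces and pairs\<close>

text \<open>A finite-dimensional real vector space is a subspace of some Euclidean space; the inner product
  of the ambient space plays no role.  A linear map between such subspaces is given by a linear map of
  the ambient spaces, of which only the restriction matters (every linear map of a subspace extends).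
  In this way factors of dimension zero are included.

  A quaternionic structure, i.e. an orbit of hypercomplex structures under rotations of the imaginary
  quaternions, is recorded by a representative \<open>Rep\<close>.  Morphisms only see the orbit, as they are
  defined through the set of admissible complex structures.\<close>

record 'a qspace =
  Car :: "'a set"
  Rep :: "quat \<Rightarrow> 'a \<Rightarrow> 'a"

record 'a qpair = "'a qspace" +
  Sub :: "'a set"

definition hypercomplex :: "'a::euclidean_space set \<Rightarrow> (quat \<Rightarrow> 'a \<Rightarrow> 'a) \<Rightarrow> bool" where
  "hypercomplex E \<rho> \<longleftrightarrow>
     (\<forall>q. linear (\<rho> q) \<and> \<rho> q ` E \<subseteq> E) \<and>
     (\<forall>x\<in>E. linear (\<lambda>q. \<rho> q x)) \<and>
     (\<forall>x\<in>E. \<rho> qone x = x) \<and>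
     (\<forall>p q. \<forall>x\<in>E. \<rho> (qmult p q) x = \<rho> p (\<rho> q x))"

definition is_qspace :: "('a::euclidean_space, 'm) qspace_scheme \<Rightarrow> bool" where
  "is_qspace E \<longleftrightarrow> subspace (Car E) \<and> hypercomplex (Car E) (Rep E)"

definition is_pair :: "'a::euclidean_space qpair \<Rightarrow> bool" where
  "is_pair P \<longleftrightarrow> is_qspace P \<and> subspace (Sub P) \<and> Sub P \<subseteq> Car P"

definition admissible :: "('a, 'm) qspace_scheme \<Rightarrow> ('a \<Rightarrow> 'a) set" where
  "admissible E = (\<lambda>u. Rep E (0, u)) ` S2"

definition quaternionic_linear ::
  "('a::euclidean_space, 'm) qspace_scheme \<Rightarrow> ('b::euclidean_space, 'n) qspace_scheme \<Rightarrow> ('a \<Rightarrow> 'b) \<Rightarrow> bool"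
where
  "quaternionic_linear E E' t \<longleftrightarrow>
     linear t \<and> t ` Car E \<subseteq> Car E' \<and>
     (\<exists>T. \<forall>J\<in>admissible E. T J \<in> admissible E' \<and> (\<forall>x\<in>Car E. t (J x) = T J (t x)))"

definition pair_morphism ::
  "'a::euclidean_space qpair \<Rightarrow> 'b::euclidean_space qpair \<Rightarrow> ('a \<Rightarrow> 'b) \<Rightarrow> bool" where
  "pair_morphism P P' t \<longleftrightarrow> quaternionic_linear P P' t \<and> t ` Sub P \<subseteq> Sub P'"

definition pair_isomorphism ::
  "'a::euclidean_space qpair \<Rightarrow> 'b::euclidean_space qpair \<Rightarrow> ('a \<Rightarrow> 'b) \<Rightarrow> bool" where
  "pair_isomorphism P P' t \<longleftrightarrow>
     pair_morphism P P' t \<and>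
     (\<exists>s. pair_morphism P' P s \<and> (\<forall>x\<in>Car P. s (t x) = x) \<and> (\<forall>y\<in>Car P'. t (s y) = y))"

definition isomorphic_pairs :: "'a::euclidean_space qpair \<Rightarrow> 'b::euclidean_space qpair \<Rightarrow> bool" where
  "isomorphic_pairs P P' \<longleftrightarrow> (\<exists>t. pair_isomorphism P P' t)"


section \<open>Products\<close>

text \<open>The metric and orientation of the space \<open>Z\<close> of admissible structures are transported from \<open>S2\<close>
  by the representative \<open>\<rho>\<close>.  So an orientation preserving isometry \<open>Z \<rightarrow> Z'\<close> is recorded by its
  expression \<open>T\<close> with respect to \<open>\<rho>\<close> and \<open>\<rho>'\<close>, namely the orientation preserving isometry of \<open>S2\<close>
  such that \<open>\<rho> u\<close> is sent to \<open>\<rho>' (T u)\<close>.  This also covers zero spaces, for which \<open>Z\<close> degenerates to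
  a point.  The unital linear extension to the quaternions then yields the representative
  \<open>q \<mapsto> \<rho>' (lin_ext T q)\<close> of the second structure.\<close>

definition lin_ext :: "(real^3 \<Rightarrow> real^3) \<Rightarrow> quat \<Rightarrow> quat" where
  "lin_ext T = (THE L. linear L \<and> L qone = qone \<and> (\<forall>u\<in>S2. L (0, u) = (0, T u)))"

definition prod_pair ::
  "(real^3 \<Rightarrow> real^3) \<Rightarrow> 'a::euclidean_space qpair \<Rightarrow> 'b::euclidean_space qpair \<Rightarrow> ('a \<times> 'b) qpair" where
  "prod_pair T P P' =
     \<lparr>Car = Car P \<times> Car P',
      Rep = (\<lambda>q. map_prod (Rep P q) (Rep P' (lin_ext T q))),
      Sub = Sub P \<times> Sub P'\<rparr>"


section \<open>CR and co-CR quaternionic vector spaces\<close>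

definition CR_quaternionic ::
  "'v::euclidean_space set \<Rightarrow> ('v \<Rightarrow> 'a::euclidean_space) \<Rightarrow> ('a, 'm) qspace_scheme \<Rightarrow> bool" where
  "CR_quaternionic V \<iota> E \<longleftrightarrow>
     subspace V \<and> is_qspace E \<and> linear \<iota> \<and> \<iota> ` V \<subseteq> Car E \<and> inj_on \<iota> V \<and>
     (\<forall>J\<in>admissible E. {x + J y |x y. x \<in> \<iota> ` V \<and> y \<in> \<iota> ` V} = Car E)"

definition co_CR_quaternionic ::
  "'v::euclidean_space set \<Rightarrow> ('a::euclidean_space \<Rightarrow> 'v) \<Rightarrow> ('a, 'm) qspace_scheme \<Rightarrow> bool" where
  "co_CR_quaternionic V r E \<longleftrightarrow>
     subspace V \<and> is_qspace E \<and> linear r \<and> r ` Car E = V \<and>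
     (\<forall>J\<in>admissible E. {x\<in>Car E. r x = 0} \<inter> J ` {x\<in>Car E. r x = 0} = {0})"

text \<open>As \<open>V\<close> has dimension at most that of \<open>E\<close>, it may be taken inside the same ambient space.\<close>

definition CR_pair :: "'a::euclidean_space qpair \<Rightarrow> bool" where
  "CR_pair P \<longleftrightarrow> (\<exists>(V :: 'a set) \<iota>. CR_quaternionic V \<iota> P \<and> Sub P = \<iota> ` V)"

definition co_CR_pair :: "'a::euclidean_space qpair \<Rightarrow> bool" where
  "co_CR_pair P \<longleftrightarrow> (\<exists>(V :: 'a set) r. co_CR_quaternionic V r P \<and> Sub P = {x\<in>Car P. r x = 0})"


section \<open>The sheaf of a pair\<close>

text \<open>The complexification of \<open>V\<close> is \<open>V \<times> V\<close>, with \<open>(x, y)\<close> standing for \<open>x + i y\<close>.\<close>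

definition cscale :: "complex \<Rightarrow> 'a::real_vector \<times> 'a \<Rightarrow> 'a \<times> 'a" where
  "cscale c z = (Re c *\<^sub>R fst z - Im c *\<^sub>R snd z, Re c *\<^sub>R snd z + Im c *\<^sub>R fst z)"

text \<open>\<open>near u P\<close>: the property \<open>P\<close> holds on a neighbourhood of \<open>u\<close> in the sphere.\<close>

definition near :: "real^3 \<Rightarrow> (real^3 \<Rightarrow> bool) \<Rightarrow> bool" where
  "near u P \<longleftrightarrow> (\<exists>W. openin (top_of_set S2) W \<and> u \<in> W \<and> (\<forall>v\<in>W. P v))"

text \<open>Functions on \<open>Z\<close> are written as functions on \<open>S2\<close>, through \<open>\<rho>\<close>.  The complex structure of \<open>Z\<close> is
  \<open>A \<mapsto> J A\<close> on the tangent space at \<open>J\<close>, which corresponds to \<open>t \<mapsto> cross3 u t\<close> on the tangent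
  space of \<open>S2\<close> at \<open>u\<close>.  It is the one for which the \<open>- i\<close> eigenspaces form a holomorphic
  subbundle.  The argument \<open>I\<close> is multiplication by \<open>i\<close> in the complex vector space of values.  Holomorphy
  near \<open>u\<close> means complex differentiability at all points of a neighbourhood.\<close>

definition holomorphic_near ::
  "('b::real_normed_vector \<Rightarrow> 'b) \<Rightarrow> real^3 \<Rightarrow> (real^3 \<Rightarrow> 'b) \<Rightarrow> bool" where
  "holomorphic_near I u f \<longleftrightarrow>
     near u (\<lambda>v. \<exists>D. (f has_derivative D) (at v within S2) \<and>
                     (\<forall>t. t \<bullet> v = 0 \<longrightarrow> D (cross3 v t) = I (D t)))"

text \<open>The quotient \<open>E / U\<close> is realised as the orthogonal complement of \<open>U\<close> in \<open>E\<close>.\<close>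

definition quot_space :: "'a::euclidean_space qpair \<Rightarrow> 'a set" where
  "quot_space P = Car P \<inter> (Sub P)\<^sup>\<bottom>"

definition quot_map :: "'a::euclidean_space qpair \<Rightarrow> 'a \<Rightarrow> 'a" where
  "quot_map P x = (THE y. y \<in> (Sub P)\<^sup>\<bottom> \<and> x - y \<in> Sub P)"

definition quot_map_C :: "'a::euclidean_space qpair \<Rightarrow> 'a \<times> 'a \<Rightarrow> 'a \<times> 'a" where
  "quot_map_C P = map_prod (quot_map P) (quot_map P)"

definition E01_fibre :: "('a::euclidean_space, 'm) qspace_scheme \<Rightarrow> real^3 \<Rightarrow> ('a \<times> 'a) set" where
  "E01_fibre E u =
     {z \<in> Car E \<times> Car E. map_prod (Rep E (0, u)) (Rep E (0, u)) z = cscale (- \<i>) z}"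

definition E01_sections ::
  "('a::euclidean_space, 'm) qspace_scheme \<Rightarrow> real^3 \<Rightarrow> (real^3 \<Rightarrow> 'a \<times> 'a) set" where
  "E01_sections E u = {s. holomorphic_near (cscale \<i>) u s \<and> near u (\<lambda>v. s v \<in> E01_fibre E v)}"

text \<open>Elements of stalks are given by functions holomorphic near the point, and a stalk by the set of
  its representatives and the set of those representing zero.  The stalk of the cokernel
  sheaf is the cokernel of the map of stalks.\<close>

definition kernel_stalk :: "'a::euclidean_space qpair \<Rightarrow> real^3 \<Rightarrow> (real^3 \<Rightarrow> 'a \<times> 'a) set" where
  "kernel_stalk P u = {s \<in> E01_sections P u. near u (\<lambda>v. quot_map_C P (s v) = 0)}"

definition kernel_zero :: "'a::euclidean_space qpair \<Rightarrow> real^3 \<Rightarrow> (real^3 \<Rightarrow> 'a \<times> 'a) set" where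
  "kernel_zero P u = {s. near u (\<lambda>v. s v = 0)}"

definition cokernel_stalk :: "'a::euclidean_space qpair \<Rightarrow> real^3 \<Rightarrow> (real^3 \<Rightarrow> 'a \<times> 'a) set" where
  "cokernel_stalk P u =
     {w. holomorphic_near (cscale \<i>) u w \<and> near u (\<lambda>v. w v \<in> quot_space P \<times> quot_space P)}"

definition cokernel_zero :: "'a::euclidean_space qpair \<Rightarrow> real^3 \<Rightarrow> (real^3 \<Rightarrow> 'a \<times> 'a) set" where
  "cokernel_zero P u = {w. \<exists>s\<in>E01_sections P u. near u (\<lambda>v. w v = quot_map_C P (s v))}"

text \<open>The direct sum of the kernel and the cokernel, as a sheaf of modules over the sheaf of
  holomorphic functions.\<close>

type_synonym 'a sheaf_germ = "(real^3 \<Rightarrow> 'a \<times> 'a) \<times> (real^3 \<Rightarrow> 'a \<times> 'a)"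

definition sheaf_stalk :: "'a::euclidean_space qpair \<Rightarrow> real^3 \<Rightarrow> 'a sheaf_germ set" where
  "sheaf_stalk P u = kernel_stalk P u \<times> cokernel_stalk P u"

definition sheaf_zero :: "'a::euclidean_space qpair \<Rightarrow> real^3 \<Rightarrow> 'a sheaf_germ set" where
  "sheaf_zero P u = kernel_zero P u \<times> cokernel_zero P u"

definition germ_smult :: "(real^3 \<Rightarrow> complex) \<Rightarrow> 'a::euclidean_space sheaf_germ \<Rightarrow> 'a sheaf_germ" where
  "germ_smult f m = (\<lambda>v. cscale (f v) (fst m v), \<lambda>v. cscale (f v) (snd m v))"

definition nonzero_germs :: "real^3 \<Rightarrow> (real^3 \<Rightarrow> complex) set" where
  "nonzero_germs u = {f. holomorphic_near ((*) \<i>) u f \<and> \<not> near u (\<lambda>v. f v = 0)}"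

definition torsion_pair :: "'a::euclidean_space qpair \<Rightarrow> bool" where
  "torsion_pair P \<longleftrightarrow>
     (\<forall>u\<in>S2. \<forall>m\<in>sheaf_stalk P u. \<exists>f\<in>nonzero_germs u. germ_smult f m \<in> sheaf_zero P u)"

definition torsion_free_pair :: "'a::euclidean_space qpair \<Rightarrow> bool" where
  "torsion_free_pair P \<longleftrightarrow>
     (\<forall>u\<in>S2. \<forall>m\<in>sheaf_stalk P u. \<forall>f\<in>nonzero_germs u.
        germ_smult f m \<in> sheaf_zero P u \<longrightarrow> m \<in> sheaf_zero P u)"


section \<open>Decompositions\<close>

text \<open>\<open>M\<close>, \<open>N\<close> and \<open>C\<close> are the CR, torsion and co-CR factors; \<open>\<phi>\<close> identifies their product, formed with
  respect to some isometries, with \<open>P\<close>.\<close>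

definition decomposition ::
  "'p::euclidean_space qpair \<Rightarrow> 'a::euclidean_space qpair \<Rightarrow> 'b::euclidean_space qpair \<Rightarrow>
   'c::euclidean_space qpair \<Rightarrow> (('a \<times> 'b) \<times> 'c \<Rightarrow> 'p) \<Rightarrow> bool" where
  "decomposition P M N C \<phi> \<longleftrightarrow>
     is_pair M \<and> CR_pair M \<and> is_pair N \<and> torsion_pair N \<and> is_pair C \<and> co_CR_pair C \<and>
     (\<exists>T T'. op_isometry T \<and> op_isometry T' \<and>
        pair_isomorphism (prod_pair T' (prod_pair T M N) C) P \<phi>)"

text \<open>The subpairs of the filtration, each listed as (real subspace, quaternionic subspace).  The
  quaternionic structure of a subpair of \<open>P\<close> is the one induced from \<open>P\<close>.\<close>

definition filtration ::
  "'p::euclidean_space qpair \<Rightarrow> 'a::euclidean_space qpair \<Rightarrow> 'b::euclidean_space qpair \<Rightarrow>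
   (('a \<times> 'b) \<times> 'c::euclidean_space \<Rightarrow> 'p) \<Rightarrow> ('p set \<times> 'p set) list" where
  "filtration P M N \<phi> =
     [({0}, {0}),
      (\<phi> ` ((Sub M \<times> {0}) \<times> {0}), \<phi> ` ((Car M \<times> {0}) \<times> {0})),
      (\<phi> ` ((Sub M \<times> Sub N) \<times> {0}), \<phi> ` ((Car M \<times> Car N) \<times> {0})),
      (Sub P, Car P)]"

end

theory Submission
  imports Defs "HOL-Computational_Algebra.Fundamental_Theorem_Algebra"
begin

text \<open>
Write \<open>R v\<close> for the action of an imaginary quaternion \<open>v\<close> on \<open>E\<close>.  The fibre of \<open>E01\<close> at a point \<open>v\<close>
of the sphere consists of the vectors \<open>(x, R v x)\<close>, so the map to the complexified quotient by \<open>U\<close> is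
injective at \<open>v\<close> exactly if \<open>U\<close> contains no nonzero \<open>x\<close> together with \<open>R v x\<close> (\<open>v\<close> is not in
\<open>complex_points U\<close>), and it is surjective exactly if \<open>U + R v U = E\<close> (\<open>spans_at U E v\<close>).  Hence a pair is CR
if it is spanned at all points, and co-CR if there are no complex points.  It is a torsion pair if and
only if the map is bijective at some point, and then at all but finitely many points (\<open>torsion_pairI\<close>,
\<open>torsion_pairD\<close>).  In a stereographic
coordinate the map is a linear pencil \<open>L0 + c L1\<close>; since an operator over the complex numbers has an
eigenvalue, and only finitely many, a subspace that is half of \<open>E\<close> and has a point that is not complex has finitely
many complex points but, unless \<open>E = 0\<close>, at least one.

The last remark is the source of all rigidity.  It shows that quaternionic morphisms from CR to torsion
pairs, from CR to co-CR pairs, and from torsion to co-CR pairs vanish (\<open>incompatible_zero\<close>), which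
makes the filtration canonical and the factors unique.

For existence one takes for the first two factors together the largest submodule that is generically
spanned, and inside it the smallest submodule whose quotient generically has no complex points.  By
maximality and minimality no nonzero morphism goes from these submodules to the quotients by them, and
this suffices for splitting: an obstruction to an equivariant splitting is, by linear duality, an operator
\<open>h\<close> in the opposite direction that kills the real subspace, takes values in the real subspace, and whose
quaternionic average is zero; then \<open>h R w + R w h\<close> is quaternionic linear and hence a morphism of pairs
(\<open>duality\<close>, \<open>anticommutator_quaternionic\<close>, \<open>splitting\<close>).

The same duality proves independence of the isometry.  It has to be shown that every rotation of the
sphere lifts to an automorphism of a torsion free pair.  Infinitesimally one needs a quaternionic linear
\<open>b\<close> such that \<open>R u + b\<close> preserves \<open>U\<close>.  An obstruction \<open>h\<close> gives the morphism
\<open>h R u + R u h\<close>, and \<open>h R u\<close> has nonzero trace; so the morphism is not nilpotent, and on its stable image the real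
subspace is half of the module, without being complex at \<open>u\<close>.  By the remark it has complex points, but
finitely many: the rank of the map to the quotient jumps there, which produces torsion
(\<open>torsion_free_no_jump\<close>, \<open>infinitesimal_lift\<close>).  Exponentiating \<open>R u + b\<close> lifts the half-turns, and
half-turns generate the rotations.
\<close>

section \<open>Complex structures on real subspaces\<close>

text \<open>Scalar multiplication by \<open>c\<close> for a complex structure \<open>j\<close>.  The structure \<open>j\<close> is an operator on the
ambient space whose square is \<open>- 1\<close> only on the subspace under consideration.\<close>

definition csc :: "('a::real_vector \<Rightarrow> 'a) \<Rightarrow> complex \<Rightarrow> 'a \<Rightarrow> 'a" where
  "csc j c x = Re c *\<^sub>R x + Im c *\<^sub>R j x"

definition shift_prod :: "('a::real_vector \<Rightarrow> 'a) \<Rightarrow> ('a \<Rightarrow> 'a) \<Rightarrow> complex list \<Rightarrow> 'a \<Rightarrow> 'a" where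
  "shift_prod j N ls = fold (\<lambda>l x. N x - csc j l x) ls"

lemma cscale_eq_csc: "cscale c = csc (cscale \<i>) c"
  by (auto simp: fun_eq_iff cscale_def csc_def prod_eq_iff)

lemma shift_prod_Nil [simp]: "shift_prod j N [] x = x"
  and shift_prod_Cons [simp]: "shift_prod j N (l # ls) x = shift_prod j N ls (N x - csc j l x)"
  and shift_prod_append: "shift_prod j N (ls @ ls') x = shift_prod j N ls' (shift_prod j N ls x)"
  by (simp_all add: shift_prod_def)

locale complex_structure =
  fixes S :: "'a::euclidean_space set" and j :: "'a \<Rightarrow> 'a"
  assumes S: "subspace S" and lin_j: "linear j"
    and j_in: "x \<in> S \<Longrightarrow> j x \<in> S" and j_j: "x \<in> S \<Longrightarrow> j (j x) = - x"
begin

lemma csc_in: "x \<in> S \<Longrightarrow> csc j c x \<in> S"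
  unfolding csc_def by (intro subspace_add subspace_mul S j_in)

lemma linear_csc: "linear (csc j c)"
  unfolding csc_def
  by (intro linear_compose_add linear_compose_scale_right lin_j linear_ident)

lemma csc_simps [simp]: "csc j 0 x = 0" "csc j 1 x = x" "csc j c 0 = 0"
  by (simp_all add: csc_def linear_0[OF lin_j])

lemma csc_add: "csc j (a + b) x = csc j a x + csc j b x"
  and csc_diff: "csc j (a - b) x = csc j a x - csc j b x"
  and csc_minus: "csc j (- a) x = - csc j a x"
  and csc_of_real: "csc j (of_real r) x = r *\<^sub>R x"
  by (simp_all add: csc_def algebra_simps)

lemma csc_add_right: "csc j c (x + y) = csc j c x + csc j c y"
  and csc_diff_right: "csc j c (x - y) = csc j c x - csc j c y"
  and csc_minus_right: "csc j c (- x) = - csc j c x"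
  using linear_add[OF linear_csc] linear_diff[OF linear_csc] linear_neg[OF linear_csc] by auto

lemma csc_mult: "x \<in> S \<Longrightarrow> csc j (a * b) x = csc j a (csc j b x)"
  by (simp add: csc_def linear_add[OF lin_j] linear_scale[OF lin_j] j_j algebra_simps)

lemma csc_eq_0: assumes "x \<in> S" "csc j c x = 0" shows "c = 0 \<or> x = 0"
proof (rule ccontr)
  assume a: "\<not> (c = 0 \<or> x = 0)"
  then have "x = csc j (inverse c * c) x" by simp
  also have "\<dots> = csc j (inverse c) 0" using assms csc_mult by metis
  finally show False using a by simp
qed

end

locale complex_endo = complex_structure S j for S :: "'a::euclidean_space set" and j +
  fixes N :: "'a \<Rightarrow> 'a"
  assumes lin_N: "linear N" and N_in: "x \<in> S \<Longrightarrow> N x \<in> S" and N_j: "x \<in> S \<Longrightarrow> N (j x) = j (N x)"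
begin

lemma N_csc: "x \<in> S \<Longrightarrow> N (csc j c x) = csc j c (N x)"
  by (simp add: csc_def linear_add[OF lin_N] linear_scale[OF lin_N] N_j)

lemma shift_prod_in: "x \<in> S \<Longrightarrow> shift_prod j N ls x \<in> S"
  by (induction ls arbitrary: x) (auto intro!: subspace_diff S N_in csc_in)

lemma linear_shift_prod: "linear (shift_prod j N ls)"
proof (induction ls)
  case Nil
  then show ?case by (simp add: shift_prod_def linear_ident)
next
  case (Cons l ls)
  have "linear (shift_prod j N ls \<circ> (\<lambda>x. N x - csc j l x))"
    by (intro linear_compose[OF _ Cons.IH] linear_compose_sub lin_N linear_csc)
  then show ?case by (simp add: o_def)
qed

lemma shift_prod_eigen:
  "x \<in> S \<Longrightarrow> N x = csc j k x \<Longrightarrow> shift_prod j N ls x = csc j (\<Prod>l\<leftarrow>ls. k - l) x"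
proof (induction ls arbitrary: x)
  case (Cons l ls)
  have "N (csc j (k - l) x) = csc j k (csc j (k - l) x)"
    using Cons.prems by (simp add: N_csc flip: csc_mult) (simp add: mult.commute)
  then have "shift_prod j N ls (csc j (k - l) x) = csc j (\<Prod>l\<leftarrow>ls. k - l) (csc j (k - l) x)"
    using Cons.prems csc_in by (intro Cons.IH) auto
  then show ?case using Cons.prems
    by (simp add: csc_diff flip: csc_mult) (simp add: mult.commute flip: csc_diff csc_mult)
qed simp

text \<open>The value of a polynomial at \<open>N\<close>, applied to \<open>x\<close>, by the Horner scheme.\<close>

definition ev :: "complex poly \<Rightarrow> 'a \<Rightarrow> 'a" where
  "ev p x = fold_coeffs (\<lambda>a y. csc j a x + N y) p 0"

lemma ev_0 [simp]: "ev 0 x = 0"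
  by (simp add: ev_def)

lemma ev_pCons [simp]: "ev (pCons a p) x = csc j a x + N (ev p x)"
  by (cases "a = 0 \<and> p = 0") (auto simp: ev_def linear_0[OF lin_N])

lemma ev_in: "x \<in> S \<Longrightarrow> ev p x \<in> S"
  by (induction p) (auto intro!: subspace_add S csc_in N_in simp: subspace_0[OF S])

lemma ev_add: "ev (p + q) x = ev p x + ev q x"
  by (induction p q rule: poly_induct2) (simp_all add: csc_add linear_add[OF lin_N])

lemma ev_smult: "x \<in> S \<Longrightarrow> ev (smult c p) x = csc j c (ev p x)"
  by (induction p) (simp_all add: csc_add_right N_csc ev_in csc_mult)

lemma ev_monom: "ev (monom c k) x = (N ^^ k) (csc j c x)"
  by (induction k) (simp_all add: monom_0 monom_Suc linear_0[OF lin_N])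

lemma ev_sum: "ev (sum f A) x = (\<Sum>i\<in>A. ev (f i) x)"
  by (induction A rule: infinite_finite_induct) (simp_all add: ev_add)

lemma ev_linear_factor: "x \<in> S \<Longrightarrow> ev ([:- l, 1:] * p) x = N (ev p x) - csc j l (ev p x)"
  using ev_add[of "smult (- l) p" "pCons 0 p" x] ev_smult[of x "- l" p]
  by (simp add: csc_minus)

lemma N_pow_scaleR: "(N ^^ k) (r *\<^sub>R x) = r *\<^sub>R (N ^^ k) x"
  by (induction k) (simp_all add: linear_scale[OF lin_N])

lemma annihilating_poly: "\<exists>p. p \<noteq> 0 \<and> ev p x = 0"
proof (cases "inj_on (\<lambda>k. (N ^^ k) x) {..DIM('a)}")
  case False
  then obtain a b where ab: "a \<noteq> b" "(N ^^ a) x = (N ^^ b) x" by (auto simp: inj_on_def)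
  have "coeff (monom 1 a + monom (- 1) b :: complex poly) a = 1" using ab by (simp)
  then have "monom 1 a + monom (- 1) b \<noteq> (0 :: complex poly)" by fastforce
  moreover have "ev (monom 1 a + monom (- 1) b) x = 0"
    using ab N_pow_scaleR[of b "-1" x] by (simp add: ev_add ev_monom csc_minus)
  ultimately show ?thesis by blast
next
  case True
  let ?n = "\<lambda>k. (N ^^ k) x"
  have "card (?n ` {..DIM('a)}) = Suc DIM('a)" using True by (simp add: card_image)
  then have "dependent (?n ` {..DIM('a)})" by (intro dependent_biggerset) auto
  then obtain u where u: "\<exists>v\<in>?n ` {..DIM('a)}. u v \<noteq> 0" "(\<Sum>v\<in>?n ` {..DIM('a)}. u v *\<^sub>R v) = 0"
    by (subst (asm) dependent_finite) auto
  define p where "p = (\<Sum>k\<le>DIM('a). monom (complex_of_real (u (?n k))) k)"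
  obtain k where k: "k \<le> DIM('a)" "u (?n k) \<noteq> 0" using u(1) by auto
  have "coeff p k = of_real (u (?n k))"
    using k by (simp add: p_def coeff_sum if_distrib cong: if_cong)
  then have "p \<noteq> 0" using k by auto
  moreover have "ev p x = 0"
    using u(2) True by (simp add: p_def ev_sum ev_monom csc_of_real N_pow_scaleR sum.reindex)
  ultimately show ?thesis by blast
qed

lemma shift_prod_commute_factor:
  "x \<in> S \<Longrightarrow> shift_prod j N ls (N x - csc j l x) = N (shift_prod j N ls x) - csc j l (shift_prod j N ls x)"
proof (induction ls arbitrary: x)
  case (Cons k ls)
  have "N (N x - csc j l x) - csc j k (N x - csc j l x) = N (N x - csc j k x) - csc j l (N x - csc j k x)"
    using Cons.prems
    by (simp add: linear_diff[OF lin_N] N_csc csc_diff_right flip: csc_mult)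
      (simp add: mult.commute)
  then show ?case using Cons by (simp add: subspace_diff[OF S] N_in csc_in)
qed simp

text \<open>Among \<open>x\<close>, \<open>N x\<close>, \<open>N (N x)\<close>, \<open>\<dots>\<close> there is a linear relation, that is, a polynomial that
annihilates \<open>x\<close>; over the complex numbers it is a product of linear factors.\<close>

lemma annihilating_list_vector: assumes x: "x \<in> S" shows "\<exists>ls. shift_prod j N ls x = 0"
proof -
  obtain p where p: "p \<noteq> 0" "ev p x = 0" using annihilating_poly by blast
  obtain A where A: "p = smult (lead_coeff p) (\<Prod>l\<in>#A. [:- l, 1:])"
    using alg_closed_imp_factorization[OF p(1)] by blast
  obtain ls where ls: "mset ls = A" using ex_mset by blast
  have *: "shift_prod j N ls x = ev (\<Prod>l\<leftarrow>ls. [:- l, 1:]) x" for ls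
  proof (induction ls)
    case (Cons l ls)
    have "shift_prod j N (l # ls) x = N (shift_prod j N ls x) - csc j l (shift_prod j N ls x)"
      using shift_prod_commute_factor[OF x] by simp
    then show ?case using ev_linear_factor[OF x] Cons.IH by simp
  qed (simp add: linear_0[OF lin_N] one_pCons)
  have "p = smult (lead_coeff p) (\<Prod>l\<leftarrow>ls. [:- l, 1:])"
    using A by (metis ls mset_map prod_mset_prod_list)
  then have "csc j (lead_coeff p) (shift_prod j N ls x) = 0"
    using p(2) ev_smult[OF x] * by metis
  then show ?thesis using csc_eq_0 p(1) shift_prod_in[OF x] by fastforce
qed

text \<open>Basis vectors are treated one after the other: a list for the earlier ones is followed by one that
annihilates the image of the next.\<close>

lemma annihilating_list: "\<exists>ls. \<forall>x\<in>S. shift_prod j N ls x = 0"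
proof -
  obtain B where B: "B \<subseteq> S" "independent B" "S \<subseteq> span B" "card B = dim S" using basis_exists by blast
  have "finite B" using B(2) by (rule independent_imp_finite)
  then have "B \<subseteq> S \<Longrightarrow> \<exists>ls. \<forall>x\<in>B. shift_prod j N ls x = 0"
  proof (induction B)
    case (insert b B)
    then obtain ls where ls: "\<forall>x\<in>B. shift_prod j N ls x = 0" by auto
    obtain ls' where "shift_prod j N ls' (shift_prod j N ls b) = 0"
      using annihilating_list_vector[OF shift_prod_in] insert.prems by blast
    then show ?case using ls linear_0[OF linear_shift_prod]
      by (intro exI[of _ "ls @ ls'"]) (auto simp: shift_prod_append)
  qed simp
  then obtain ls where ls: "\<forall>x\<in>B. shift_prod j N ls x = 0" using B by blast
  have "shift_prod j N ls x = 0" if "x \<in> S" for x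
    using linear_eq_0_on_span[OF linear_shift_prod, of B ls x] ls that B by auto
  then show ?thesis by blast
qed

text \<open>The first factor of an annihilating product that kills the partial product applied to a nonzero
vector exhibits an eigenvector.\<close>

lemma eigenvector_exists:
  assumes "S \<noteq> {0}" shows "\<exists>x l. x \<in> S \<and> x \<noteq> 0 \<and> N x = csc j l x"
proof -
  obtain x where x: "x \<in> S" "x \<noteq> 0" using assms subspace_0[OF S] by blast
  obtain ls where "shift_prod j N ls x = 0" using annihilating_list x by blast
  with x show ?thesis
  proof (induction ls arbitrary: x)
    case (Cons l ls)
    show ?case
    proof (cases "N x - csc j l x = 0")
      case False
      then show ?thesis using Cons.prems
        by (intro Cons.IH[of "N x - csc j l x"]) (auto intro!: subspace_diff S N_in csc_in)
    qed (use Cons in auto)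
  qed auto
qed

lemma finite_eigenvalues: "finite {l. \<exists>x\<in>S. x \<noteq> 0 \<and> N x = csc j l x}"
proof -
  obtain ls where ls: "\<forall>x\<in>S. shift_prod j N ls x = 0" using annihilating_list by blast
  have "l \<in> set ls" if "x \<in> S" "x \<noteq> 0" "N x = csc j l x" for l x
    using shift_prod_eigen[OF that(1,3), of ls] ls that csc_eq_0
    by (fastforce simp: prod_list_zero_iff)
  then show ?thesis by (auto intro: finite_subset[of _ "set ls"])
qed

text \<open>The kernel of \<open>1 + c N\<close> is the eigenspace of \<open>N\<close> for \<open>- 1 / c\<close> if \<open>c\<close> is nonzero, and zero if \<open>c\<close> is zero.\<close>

lemma finite_singular: "finite {c. \<exists>x\<in>S. x \<noteq> 0 \<and> x + csc j c (N x) = 0}"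
proof (rule finite_subset)
  show "finite ((\<lambda>l. - inverse l) ` {l. \<exists>x\<in>S. x \<noteq> 0 \<and> N x = csc j l x})"
    using finite_eigenvalues by simp
  show "{c. \<exists>x\<in>S. x \<noteq> 0 \<and> x + csc j c (N x) = 0} \<subseteq> (\<lambda>l. - inverse l) ` {l. \<exists>x\<in>S. x \<noteq> 0 \<and> N x = csc j l x}"
  proof clarify
    fix c x assume x: "x \<in> S" "x \<noteq> 0" "x + csc j c (N x) = 0"
    then have c: "c \<noteq> 0" by auto
    have "csc j c (N x) = - x" using x(3) by (simp add: add_eq_0_iff)
    then have "csc j (inverse c * c) (N x) = csc j (inverse c) (- x)"
      using x N_in by (simp add: csc_mult)
    then have "N x = csc j (- inverse c) x" using c by (simp add: csc_minus csc_minus_right)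
    then show "c \<in> (\<lambda>l. - inverse l) ` {l. \<exists>x\<in>S. x \<noteq> 0 \<and> N x = csc j l x}"
      using x c by (intro image_eqI[of _ _ "- inverse c"]) (auto simp: inverse_minus_eq)
  qed
qed

end

section \<open>Quaternionic modules\<close>

lemma S2_iff: "v \<in> S2 \<longleftrightarrow> v \<bullet> v = 1"
  by (simp add: S2_def norm_eq_1)

definition stable_subspace :: "(real^3 \<Rightarrow> 'a \<Rightarrow> 'a::real_vector) \<Rightarrow> 'a set \<Rightarrow> bool" where
  "stable_subspace R F \<longleftrightarrow> subspace F \<and> (\<forall>t. \<forall>x\<in>F. R t x \<in> F)"

text \<open>A quaternionic module is given by the action of the imaginary quaternions.  The action is bilinear on
the whole ambient space, but obeys the quaternion relations only on \<open>E\<close>; in this way submodules are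
modules for the same \<open>R\<close>.\<close>

locale quat_module =
  fixes E :: "'a::euclidean_space set" and R :: "real^3 \<Rightarrow> 'a \<Rightarrow> 'a"
  assumes E: "subspace E" and bil: "bilinear R" and R_in: "x \<in> E \<Longrightarrow> R t x \<in> E"
    and R_R: "x \<in> E \<Longrightarrow> R s (R t x) = R (cross3 s t) x - (s \<bullet> t) *\<^sub>R x"
begin

lemma linear_R: "linear (R t)"
  using bil by (simp add: bilinear_def)

lemmas R_simps = bilinear_ladd[OF bil] bilinear_radd[OF bil] bilinear_lmul[OF bil] bilinear_rmul[OF bil]
  bilinear_lneg[OF bil] bilinear_rneg[OF bil] bilinear_lsub[OF bil] bilinear_rsub[OF bil]
  bilinear_lzero[OF bil] bilinear_rzero[OF bil]

lemma R_sq: "x \<in> E \<Longrightarrow> R t (R t x) = - (t \<bullet> t) *\<^sub>R x"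
  by (simp add: R_R R_simps)

lemma R_unit: "x \<in> E \<Longrightarrow> v \<in> S2 \<Longrightarrow> R v (R v x) = - x"
  by (simp add: R_sq S2_iff)

lemma R_anticomm: "x \<in> E \<Longrightarrow> s \<bullet> t = 0 \<Longrightarrow> R s (R t x) = - R t (R s x)"
  using cross_skew[of s t] by (simp add: R_R R_simps inner_commute)

lemma R_eq_0: assumes "x \<in> E" "R t x = 0" "t \<noteq> 0" shows "x = 0"
  using R_sq[OF assms(1), of t] assms by (simp add: R_simps)

lemma R_inverse: assumes "x \<in> E" "t \<noteq> 0" shows "R t (- (1 / (t \<bullet> t)) *\<^sub>R R t x) = x"
  using assms by (simp add: R_simps R_sq)

lemma stable_quat_module: "stable_subspace R F \<Longrightarrow> F \<subseteq> E \<Longrightarrow> quat_module F R"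
  unfolding stable_subspace_def using bil R_R by unfold_locales auto

lemma complex_structure_R: "v \<in> S2 \<Longrightarrow> complex_structure E (\<lambda>x. - R v x)"
  using E linear_R R_in by unfold_locales (auto simp: R_simps R_unit linear_compose_neg subspace_neg)

text \<open>The points at which \<open>U\<close> contains a nonzero complex line.  For \<open>v\<close> in the sphere, \<open>U\<close> and \<open>R v U\<close> have
zero intersection if and only if \<open>v\<close> is not such a point.\<close>

definition complex_points :: "'a set \<Rightarrow> (real^3) set" where
  "complex_points U = {v \<in> S2. \<exists>x\<in>U. x \<noteq> 0 \<and> R v x \<in> U}"

definition spans_at :: "'a set \<Rightarrow> 'a set \<Rightarrow> real^3 \<Rightarrow> bool" where
  "spans_at U F v \<longleftrightarrow> (\<forall>x\<in>F. \<exists>a\<in>U. \<exists>b\<in>U. x = a + R v b)"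

end

section \<open>Orthogonal parts\<close>

text \<open>The map to the quotient by \<open>U\<close>, realised as the orthogonal projection along \<open>U\<close>.\<close>

definition perp :: "'a::euclidean_space set \<Rightarrow> 'a \<Rightarrow> 'a" where
  "perp U x = (THE y. y \<in> U\<^sup>\<bottom> \<and> x - y \<in> U)"

lemma perp_unique: assumes "subspace U" "y \<in> U\<^sup>\<bottom>" "x - y \<in> U" shows "perp U x = y"
  unfolding perp_def
proof (rule the_equality)
  fix z assume z: "z \<in> U\<^sup>\<bottom> \<and> x - z \<in> U"
  then have "(x - y) - (x - z) \<in> U" using assms subspace_diff by blast
  moreover have "z - y \<in> U\<^sup>\<bottom>" using z assms subspace_diff[OF subspace_orthogonal_comp] by blast
  ultimately have "z - y \<in> U \<inter> U\<^sup>\<bottom>" by simp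
  then show "z = y" using orthogonal_Int_0[OF assms(1)] by simp
qed (use assms in auto)

lemma perp: assumes "subspace U" shows "perp U x \<in> U\<^sup>\<bottom>" "x - perp U x \<in> U"
proof -
  obtain a b where "x = a + b" "a \<in> U" "b \<in> U\<^sup>\<bottom>"
    using subspace_sum_orthogonal_comp[OF assms] by (metis UNIV_I set_plus_elim)
  then show "perp U x \<in> U\<^sup>\<bottom>" "x - perp U x \<in> U" using perp_unique[OF assms, of b x] by auto
qed

lemma linear_perp: assumes "subspace U" shows "linear (perp U)"
proof (rule linearI)
  note P = perp[OF assms] and O = subspace_orthogonal_comp[of U]
  show "perp U (x + y) = perp U x + perp U y" for x y
    using P[of x] P[of y] subspace_add[OF assms P(2)[of x] P(2)[of y]]
    by (intro perp_unique[OF assms]) (auto intro: subspace_add[OF O] simp: algebra_simps)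
  show "perp U (r *\<^sub>R x) = r *\<^sub>R perp U x" for r x
    using P[of x] subspace_mul[OF assms P(2)[of x], of r]
    by (intro perp_unique[OF assms]) (auto intro: subspace_mul[OF O] simp: algebra_simps)
qed

lemma perp_eq_0_iff: "subspace U \<Longrightarrow> perp U x = 0 \<longleftrightarrow> x \<in> U"
  using perp(2)[of U x] perp_unique[of U 0 x] subspace_0[OF subspace_orthogonal_comp] by auto

lemma perp_in: "subspace U \<Longrightarrow> subspace E \<Longrightarrow> U \<subseteq> E \<Longrightarrow> x \<in> E \<Longrightarrow> perp U x \<in> E"
  using perp(2)[of U x] subspace_diff[of E x "x - perp U x"] by auto

lemma perp_id: "subspace U \<Longrightarrow> x \<in> U\<^sup>\<bottom> \<Longrightarrow> perp U x = x"
  by (rule perp_unique) (auto simp: subspace_0)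

section \<open>The stereographic coordinate\<close>

text \<open>For unit vectors this is \<open>(v + w) / \<bar>v + w\<bar>\<^sup>2\<close>, the inversion that maps the sphere without \<open>- w\<close> onto the plane of the vectors
with \<open>w\<close>-component \<open>1/2\<close>; the coordinates in this plane form \<open>coord\<close>.  As a quaternion it is, up to sign, the inverse of \<open>v + w\<close>.\<close>

definition st :: "real^3 \<Rightarrow> real^3 \<Rightarrow> real^3" where
  "st w v = (1 / (2 + 2 * (v \<bullet> w))) *\<^sub>R (v + w)"

definition coord :: "real^3 \<Rightarrow> real^3 \<Rightarrow> real^3 \<Rightarrow> complex" where
  "coord w e v = Complex (st w v \<bullet> e) (st w v \<bullet> cross3 w e)"

definition frame :: "real^3 \<Rightarrow> real^3 \<Rightarrow> bool" where
  "frame w e \<longleftrightarrow> w \<in> S2 \<and> e \<in> S2 \<and> w \<bullet> e = 0"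

lemma frame_exists: assumes "w \<in> S2" shows "\<exists>e. frame w e"
proof -
  obtain y where y: "y \<noteq> 0" "orthogonal w y"
    using orthogonal_to_vector_exists[of w] by auto
  then have "frame w ((1 / norm y) *\<^sub>R y)"
    using assms by (simp add: frame_def S2_def orthogonal_def)
  then show ?thesis by blast
qed

lemma antipode: assumes "v \<in> S2" "w \<in> S2" "v \<noteq> - w" shows "1 + v \<bullet> w \<noteq> 0"
proof
  assume "1 + v \<bullet> w = 0"
  then have "(v + w) \<bullet> (v + w) = 0"
    using assms by (simp add: inner_add_left inner_add_right S2_iff inner_commute)
  then show False using assms(3) by (simp add: add_eq_0_iff2)
qed

context
  fixes w e :: "real^3"
  assumes fr: "frame w e"
begin

lemma frame_S2: "w \<in> S2" "e \<in> S2" "cross3 w e \<in> S2" 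
  and frame_dots: "w \<bullet> w = 1" "e \<bullet> e = 1" "w \<bullet> e = 0" "e \<bullet> w = 0" "w \<bullet> cross3 w e = 0" "e \<bullet> cross3 w e = 0"
    "cross3 w e \<bullet> w = 0" "cross3 w e \<bullet> e = 0" "cross3 w e \<bullet> cross3 w e = 1"
proof -
  have "(norm (cross3 w e))\<^sup>2 = 1"
    using norm_cross_dot[of w e] fr by (simp add: frame_def S2_def)
  then show "cross3 w e \<bullet> cross3 w e = 1" by (simp add: power2_norm_eq_inner)
  then show "cross3 w e \<in> S2" by (simp add: S2_iff)
qed (use fr in \<open>auto simp: frame_def S2_iff dot_cross_self inner_commute\<close>)

lemma frame_cross: "cross3 w (cross3 w e) = - e" "cross3 (cross3 w e) e = - w" "cross3 e (cross3 w e) = w"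
proof -
  show "cross3 w (cross3 w e) = - e"
    using frame_dots Lagrange[of w w e] by simp
  show *: "cross3 (cross3 w e) e = - w"
    using frame_dots Lagrange[of e w e] cross_skew[of "cross3 w e" e] by simp
  then show "cross3 e (cross3 w e) = w" using cross_skew[of e "cross3 w e"] by simp
qed

text \<open>The remainder \<open>y\<close> of the expansion is orthogonal to the frame; its product with \<open>cross3 w e\<close> vanishes
by the Lagrange formula, and so does its inner product, hence its norm.\<close>

lemma frame_expansion: "x = (x \<bullet> w) *\<^sub>R w + (x \<bullet> e) *\<^sub>R e + (x \<bullet> cross3 w e) *\<^sub>R cross3 w e"
proof -
  define y where "y = x - ((x \<bullet> w) *\<^sub>R w + (x \<bullet> e) *\<^sub>R e + (x \<bullet> cross3 w e) *\<^sub>R cross3 w e)"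
  have y: "y \<bullet> w = 0" "y \<bullet> e = 0" "y \<bullet> cross3 w e = 0"
    using frame_dots by (simp_all add: y_def inner_diff_left inner_add_left)
  have "cross3 y (cross3 w e) = 0" using y by (simp add: Lagrange)
  then have "norm y * norm (cross3 w e) = 0"
    using norm_cross_dot[of y "cross3 w e"] y(3) by simp
  then have "y = 0" using frame_dots(9) by auto
  then show ?thesis by (simp add: y_def)
qed

lemma st_dot: assumes "v \<in> S2" "v \<noteq> - w" shows "st w v \<bullet> w = 1 / 2" "st w v \<bullet> v = 1 / 2"
proof -
  have "(v + w) \<bullet> w = (2 + 2 * (v \<bullet> w)) / 2" "(v + w) \<bullet> v = (2 + 2 * (v \<bullet> w)) / 2"
    using assms(1) frame_dots by (simp_all add: S2_iff inner_add_left inner_add_right inner_commute)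
  then show "st w v \<bullet> w = 1 / 2" "st w v \<bullet> v = 1 / 2"
    using antipode[OF assms(1) frame_S2(1) assms(2)] by (simp_all add: st_def)
qed

lemma st_cross: "cross3 v (st w v) = cross3 (st w v) w"
  by (simp add: st_def cross_add_left cross_add_right cross_mult_left cross_mult_right)

lemma st_expansion: assumes "v \<in> S2" "v \<noteq> - w"
  shows "st w v = (1/2) *\<^sub>R w + Re (coord w e v) *\<^sub>R e + Im (coord w e v) *\<^sub>R cross3 w e"
  using frame_expansion[of "st w v"] st_dot[OF assms] by (simp add: coord_def)

lemma st_nz: assumes "v \<in> S2" "v \<noteq> - w" shows "st w v \<noteq> 0"
  using st_dot[OF assms] by auto

lemma st_inverts: assumes "v \<in> S2" "v \<noteq> - w" shows "v = (1 / (st w v \<bullet> st w v)) *\<^sub>R st w v - w"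
proof -
  have "st w v \<bullet> st w v = 1 / (2 + 2 * (v \<bullet> w))"
    using st_dot[OF assms] by (simp add: st_def[of w v] inner_add_right)
  then show ?thesis using antipode[OF assms(1) frame_S2(1) assms(2)]
    by (simp add: st_def)
qed

lemma coord_inj: "inj_on (coord w e) (S2 - {- w})"
proof (rule inj_onI)
  fix u v assume "u \<in> S2 - {- w}" "v \<in> S2 - {- w}" "coord w e u = coord w e v"
  then show "u = v" using st_expansion[of u] st_expansion[of v] st_inverts[of u] st_inverts[of v] by auto
qed

lemma coord_w: "coord w e w = 0"
  using frame_dots by (simp add: coord_def st_def complex_eq_iff)

lemma coord_surj: "\<exists>v\<in>S2 - {- w}. coord w e v = c"
proof -
  define m where "m = (1/2) *\<^sub>R w + Re c *\<^sub>R e + Im c *\<^sub>R cross3 w e"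
  have mm: "m \<bullet> w = 1/2" "m \<bullet> e = Re c" "m \<bullet> cross3 w e = Im c"
    using frame_dots by (simp_all add: m_def inner_add_left)
  then have m0: "m \<bullet> m \<noteq> 0" by auto
  define v where "v = (1 / (m \<bullet> m)) *\<^sub>R m - w"
  have vw: "2 + 2 * (v \<bullet> w) = 1 / (m \<bullet> m)"
    using mm frame_dots by (simp add: v_def inner_diff_left)
  have "v \<bullet> v = 1"
    using mm frame_dots m0 by (simp add: v_def inner_diff_left inner_diff_right inner_commute field_simps)
  moreover have "v \<noteq> - w" using m0 by (auto simp: v_def)
  moreover have "st w v = m" unfolding st_def vw using m0 by (simp add: v_def)
  ultimately show ?thesis using mm by (intro bexI[of _ v]) (auto simp: coord_def S2_iff)
qed

end

section \<open>The linear pencil of a subspace\<close>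

text \<open>A real left inverse \<open>G\<close> is made complex linear by averaging it with \<open>- j G j'\<close>.\<close>

lemma complex_left_inverse:
  fixes A :: "'a::euclidean_space \<Rightarrow> 'b::euclidean_space"
  assumes "complex_structure S j" "linear A" "linear j'" "\<And>z. j' (j' z) = - z"
    and "\<And>x. x \<in> S \<Longrightarrow> A (j x) = j' (A x)" "inj_on A S"
  obtains G where "linear G" "range G \<subseteq> S" "\<And>x. x \<in> S \<Longrightarrow> G (A x) = x" "\<And>z. G (j' z) = j (G z)"
proof -
  interpret complex_structure S j by fact
  obtain G0 where G0: "range G0 \<subseteq> S" "linear G0" "\<And>x. x \<in> S \<Longrightarrow> G0 (A x) = x"
    using linear_exists_left_inverse_on[OF assms(2) S assms(6)] by auto
  define G where "G z = (1/2) *\<^sub>R (G0 z - j (G0 (j' z)))" for z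
  have in_S: "G0 z \<in> S" for z using G0(1) by auto
  have "linear G"
    unfolding G_def
    using linear_compose[OF linear_compose[OF assms(3) G0(2)] lin_j]
    by (intro linear_compose_scale_right linear_compose_sub G0) (simp add: o_def)
  moreover have "range G \<subseteq> S"
    using in_S by (auto simp: G_def intro!: subspace_mul subspace_diff S j_in)
  moreover have "G (A x) = x" if "x \<in> S" for x
    using that G0(3)[OF that] G0(3)[OF j_in[OF that]] assms(5)[OF that]
    by (simp add: G_def j_j flip: scaleR_2)
  moreover have "G (j' z) = j (G z)" for z
    using in_S by (simp add: G_def linear_scale[OF lin_j] linear_diff[OF lin_j] assms(4) linear_neg[OF G0(2)]
      linear_neg[OF lin_j] j_j algebra_simps)
  ultimately show ?thesis using that by blast
qed

lemma linear_cscale: "linear (cscale c)"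
  by (rule linearI) (auto simp: cscale_def algebra_simps)

lemma cscale_ii [simp]: "cscale \<i> (cscale \<i> z) = - z"
  by (simp add: cscale_def prod_eq_iff)

lemma cscale_Pair: "cscale c (a, b) = (Re c *\<^sub>R a - Im c *\<^sub>R b, Re c *\<^sub>R b + Im c *\<^sub>R a)"
  by (simp add: cscale_def)

text \<open>With \<open>m = st w v\<close> one has \<open>R v (R m y) = R m (R w y)\<close>, so \<open>y \<mapsto> (R m y, R v (R m y))\<close> trivialises \<open>E01\<close>
away from \<open>- w\<close>.  It is complex linear for the structure \<open>- R w\<close> on \<open>E\<close>, and \<open>L v\<close>, its composition with the map to
the complexified quotient, is affine in the coordinate, because \<open>m\<close> is (\<open>L_eq\<close>).\<close>

locale quat_pencil = quat_module E R for E :: "'a::euclidean_space set" and R +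
  fixes U :: "'a set" and w e :: "real^3"
  assumes U: "subspace U" "U \<subseteq> E" and fr: "frame w e"
begin

sublocale cE: complex_structure E "\<lambda>x. - R w x"
  using complex_structure_R fr by (simp add: frame_def)

abbreviation (input) jE :: "'a \<Rightarrow> 'a" where "jE x \<equiv> - R w x"

definition Quot :: "'a set" where "Quot = E \<inter> U\<^sup>\<bottom>"

definition L0 :: "'a \<Rightarrow> 'a \<times> 'a" where
  "L0 y = ((1/2) *\<^sub>R perp U (R w y), - (1/2) *\<^sub>R perp U y)"

definition L1 :: "'a \<Rightarrow> 'a \<times> 'a" where
  "L1 y = (perp U (R e y), perp U (R e (R w y)))"

definition L :: "real^3 \<Rightarrow> 'a \<Rightarrow> 'a \<times> 'a" where
  "L v y = (perp U (R (st w v) y), perp U (R v (R (st w v) y)))"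

lemmas perp_simps = linear_add[OF linear_perp[OF U(1)]] linear_scale[OF linear_perp[OF U(1)]]
  linear_neg[OF linear_perp[OF U(1)]] linear_diff[OF linear_perp[OF U(1)]]

lemmas fS2 = frame_S2[OF fr] and fdots = frame_dots[OF fr]

lemma subspace_Quot: "subspace (Quot \<times> Quot)"
  unfolding Quot_def by (intro subspace_Times subspace_inter E subspace_orthogonal_comp)

lemma perp_Quot: "x \<in> E \<Longrightarrow> perp U x \<in> Quot"
  using perp[OF U(1)] perp_in[OF U(1) E U(2)] by (simp add: Quot_def)

lemma Quot_Times: "cscale c z \<in> Quot \<times> Quot" if "z \<in> Quot \<times> Quot"
proof -
  have "subspace Quot" unfolding Quot_def by (intro subspace_inter E subspace_orthogonal_comp)
  then show ?thesis using that
    by (cases z) (auto simp: cscale_def intro!: subspace_add subspace_diff subspace_mul)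
qed

lemma cQ: "complex_structure (Quot \<times> Quot) (cscale \<i>)"
  by (intro complex_structure.intro subspace_Quot linear_cscale Quot_Times cscale_ii)

lemma R_e_w: "x \<in> E \<Longrightarrow> R (cross3 w e) x = - R e (R w x)"
  using fdots cross_skew[of e w] by (simp add: R_R R_simps)

lemma st_comm: assumes "y \<in> E" "v \<in> S2" "v \<noteq> - w"
  shows "R v (R (st w v) y) = R (st w v) (R w y)"
  using assms st_dot[OF fr assms(2,3)] st_cross[OF fr, of v] by (simp add: R_R inner_commute)

lemma L_eq: assumes "y \<in> E" "v \<in> S2" "v \<noteq> - w"
  shows "L v y = L0 y + cscale (coord w e v) (L1 y)"
proof -
  have 1: "R (st w v) y = (1/2) *\<^sub>R R w y + Re (coord w e v) *\<^sub>R R e y - Im (coord w e v) *\<^sub>R R e (R w y)"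
    if "y \<in> E" for y
    using that by (subst st_expansion[OF fr assms(2,3)]) (simp add: R_simps R_e_w)
  show ?thesis
    unfolding L_def st_comm[OF assms] L0_def L1_def
    using assms R_in fS2
    by (simp add: 1 cscale_Pair perp_simps R_unit R_simps)
qed

lemma linear_L0: "linear L0" and linear_L1: "linear L1"
proof -
  show "linear L0" "linear L1"
    unfolding L0_def L1_def
    by (auto intro!: linearI simp: R_simps perp_simps algebra_simps)
qed

lemma L0_in: "y \<in> E \<Longrightarrow> L0 y \<in> Quot \<times> Quot" and L1_in: "y \<in> E \<Longrightarrow> L1 y \<in> Quot \<times> Quot"
proof -
  have "subspace Quot" unfolding Quot_def by (intro subspace_inter E subspace_orthogonal_comp)
  then show "y \<in> E \<Longrightarrow> L0 y \<in> Quot \<times> Quot" "y \<in> E \<Longrightarrow> L1 y \<in> Quot \<times> Quot"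
    unfolding L0_def L1_def by (auto intro!: subspace_mul subspace_neg perp_Quot R_in)
qed

lemma L0_complex: "y \<in> E \<Longrightarrow> L0 (- R w y) = cscale \<i> (L0 y)"
  and L1_complex: "y \<in> E \<Longrightarrow> L1 (- R w y) = cscale \<i> (L1 y)"
  using fS2 by (simp_all add: L0_def L1_def cscale_Pair R_simps R_unit perp_simps)

lemma L_eq_0_iff: "L v y = 0 \<longleftrightarrow> R (st w v) y \<in> U \<and> R v (R (st w v) y) \<in> U"
  using perp_eq_0_iff[OF U(1)] by (simp add: L_def prod_eq_iff)

lemma L0_eq_0_iff: "L0 y = 0 \<longleftrightarrow> y \<in> U \<and> R w y \<in> U"
  using perp_eq_0_iff[OF U(1)] by (auto simp: L0_def prod_eq_iff)

lemma L0_inj: "w \<notin> complex_points U \<Longrightarrow> inj_on L0 E"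
  using linear_inj_on_iff_eq_0[OF linear_L0 E] fS2 L0_eq_0_iff by (auto simp: complex_points_def)

text \<open>Multiplication by \<open>st w v\<close> is a bijection from the kernel of \<open>L v\<close> to the vectors \<open>x\<close> of \<open>U\<close> with \<open>R v x\<close> in
\<open>U\<close>.\<close>

lemma complex_point_iff: assumes "v \<in> S2" "v \<noteq> - w"
  shows "v \<in> complex_points U \<longleftrightarrow> (\<exists>y\<in>E. y \<noteq> 0 \<and> L v y = 0)"
proof
  assume "v \<in> complex_points U"
  then obtain x where x: "x \<in> U" "x \<noteq> 0" "R v x \<in> U" by (auto simp: complex_points_def)
  let ?y = "- (1 / (st w v \<bullet> st w v)) *\<^sub>R R (st w v) x"
  have xE: "x \<in> E" using x U by auto
  have *: "R (st w v) ?y = x" by (rule R_inverse[OF xE st_nz[OF fr assms]])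
  moreover have "?y \<in> E" by (intro subspace_mul[OF E] R_in xE)
  moreover have "?y \<noteq> 0" using x * by (metis bilinear_rzero[OF bil])
  ultimately show "\<exists>y\<in>E. y \<noteq> 0 \<and> L v y = 0" using x L_eq_0_iff by metis
next
  assume "\<exists>y\<in>E. y \<noteq> 0 \<and> L v y = 0"
  then show "v \<in> complex_points U"
    using L_eq_0_iff R_eq_0 st_nz[OF fr assms] assms by (fastforce simp: complex_points_def)
qed

lemma complex_endo_L1:
  assumes "linear G" "range G \<subseteq> E" "\<And>z. G (cscale \<i> z) = jE (G z)"
  shows "complex_endo E jE (\<lambda>y. G (L1 y))"
proof (intro complex_endo.intro cE.complex_structure_axioms complex_endo_axioms.intro)
  show "linear (\<lambda>y. G (L1 y))" using linear_compose[OF linear_L1 assms(1)] by (simp add: o_def)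
  show "G (L1 x) \<in> E" for x using assms(2) by auto
  show "x \<in> E \<Longrightarrow> G (L1 (jE x)) = jE (G (L1 x))" for x using L1_complex assms(3) by metis
qed

text \<open>If \<open>L0\<close> has a complex linear left inverse \<open>G\<close>, then \<open>L v y = 0\<close> implies \<open>(1 + c N) y = 0\<close> for \<open>N = G L1\<close>,
which for nonzero \<open>y\<close> is possible for finitely many \<open>c\<close> only.\<close>

lemma finite_complex_points: assumes "w \<notin> complex_points U" shows "finite (complex_points U)"
proof -
  obtain G where G: "linear G" "range G \<subseteq> E" "\<And>x. x \<in> E \<Longrightarrow> G (L0 x) = x" "\<And>z. G (cscale \<i> z) = jE (G z)"
    by (rule complex_left_inverse[OF cE.complex_structure_axioms linear_L0 linear_cscale cscale_ii L0_complex L0_inj[OF assms]]) (assumption, rule that)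
  interpret complex_endo E jE "\<lambda>y. G (L1 y)" by (rule complex_endo_L1[OF G(1,2,4)])
  have "coord w e ` (complex_points U - {- w}) \<subseteq> {c. \<exists>x\<in>E. x \<noteq> 0 \<and> x + csc jE c (G (L1 x)) = 0}"
  proof clarify
    fix v assume v: "v \<in> complex_points U" "v \<noteq> - w"
    then have "v \<in> S2" by (simp add: complex_points_def)
    then obtain y where y: "y \<in> E" "y \<noteq> 0" "L v y = 0" using complex_point_iff v by blast
    then have "G (L0 y + cscale (coord w e v) (L1 y)) = 0"
      using L_eq v \<open>v \<in> S2\<close> linear_0[OF G(1)] by metis
    then have "y + csc jE (coord w e v) (G (L1 y)) = 0"
      using y by (simp add: linear_add[OF G(1)] G(3) cscale_eq_csc[of "coord w e v"])
        (simp add: csc_def linear_add[OF G(1)] linear_scale[OF G(1)] G(4))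
    then show "\<exists>x\<in>E. x \<noteq> 0 \<and> x + csc jE (coord w e v) (G (L1 x)) = 0" using y by blast
  qed
  then have "finite (coord w e ` (complex_points U - {- w}))" using finite_singular finite_subset by blast
  moreover have "inj_on (coord w e) (complex_points U - {- w})"
    using coord_inj[OF fr] by (rule inj_on_subset) (auto simp: complex_points_def)
  ultimately show ?thesis using finite_imageD by fastforce
qed

lemma L0_surj: assumes "spans_at U E w" "z \<in> Quot \<times> Quot" shows "\<exists>y\<in>E. L0 y = z"
proof -
  obtain a b where z: "z = (a, b)" "a \<in> E" "b \<in> E" "a \<in> U\<^sup>\<bottom>" "b \<in> U\<^sup>\<bottom>"
    using assms(2) by (cases z) (auto simp: Quot_def)
  obtain a1 a2 where a: "a1 \<in> U" "a2 \<in> U" "a = a1 + R w a2" using assms(1) z by (auto simp: spans_at_def)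
  obtain b1 b2 where b: "b1 \<in> U" "b2 \<in> U" "b = b1 + R w b2" using assms(1) z by (auto simp: spans_at_def)
  have p0: "perp U x = 0" if "x \<in> U" for x using that perp_eq_0_iff[OF U(1)] by simp
  have ab: "perp U (R w a2) = a" "perp U (R w b2) = b"
    using perp_id[OF U(1)] z a b p0 by (metis add_0 perp_simps(1))+
  have E2: "a2 \<in> E" "b2 \<in> E" using a b U by auto
  have "L0 (2 *\<^sub>R (a2 - R w b2)) = z"
    using E2 fS2 p0[OF a(2)] p0[OF b(2)] by (simp add: L0_def z ab R_simps perp_simps R_unit)
  moreover have "2 *\<^sub>R (a2 - R w b2) \<in> E" by (intro subspace_mul subspace_diff E E2 R_in)
  ultimately show ?thesis by blast
qed

text \<open>Now \<open>L0\<close> is invertible, and an eigenvector of \<open>inverse L0 L1\<close> for \<open>l\<close> is in the kernel of \<open>L0 + c L1\<close> for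
\<open>c = - 1 / l\<close>.  The eigenvalue is not \<open>0\<close>: the kernel of \<open>L1\<close> belongs to the point \<open>- w\<close> at infinity,
which is complex only if \<open>w\<close> is.\<close>

lemma complex_points_nonempty:
  assumes "w \<notin> complex_points U" "spans_at U E w" "E \<noteq> {0}" shows "complex_points U \<noteq> {}"
proof -
  obtain G where G: "linear G" "range G \<subseteq> E" "\<And>x. x \<in> E \<Longrightarrow> G (L0 x) = x" "\<And>z. G (cscale \<i> z) = jE (G z)"
    by (rule complex_left_inverse[OF cE.complex_structure_axioms linear_L0 linear_cscale cscale_ii L0_complex L0_inj[OF assms(1)]]) (assumption, rule that)
  interpret complex_endo E jE "\<lambda>y. G (L1 y)" by (rule complex_endo_L1[OF G(1,2,4)])
  obtain y l where y: "y \<in> E" "y \<noteq> 0" "G (L1 y) = csc jE l y" using eigenvector_exists[OF assms(3)] by blast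
  have L0G: "L0 (G z) = z" if "z \<in> Quot \<times> Quot" for z using L0_surj[OF assms(2) that] G(3) by auto
  have L0c: "L0 (csc jE c y) = cscale c (L0 y)" for c
    unfolding cscale_eq_csc[of c] L0_complex[OF y(1), symmetric] csc_def
    by (simp only: linear_add[OF linear_L0] linear_scale[OF linear_L0])
  have L1y: "L1 y = cscale l (L0 y)" using L0G[OF L1_in[OF y(1)]] y(3) L0c by simp
  have "l \<noteq> 0"
  proof
    assume "l = 0"
    then have "L1 y = 0" using L1y by (simp add: cscale_def prod_eq_iff)
    then have "R e y \<in> U" "R e (R w y) \<in> U" using perp_eq_0_iff[OF U(1)] by (auto simp: L1_def prod_eq_iff)
    moreover have "R e (R w y) = - R w (R e y)" using y R_anticomm fdots by blast
    ultimately have "R e y \<in> U" "R w (R e y) \<in> U" using subspace_neg[OF U(1)] by fastforce+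
    moreover have "R e y \<noteq> 0" using R_eq_0 y fdots by fastforce
    ultimately show False using assms(1) fS2 by (auto simp: complex_points_def)
  qed
  obtain v where v: "v \<in> S2" "v \<noteq> - w" "coord w e v = - inverse l"
    using coord_surj[OF fr, of "- inverse l"] by auto
  have "L v y = L0 y + cscale (- inverse l) (cscale l (L0 y))"
    using L_eq[OF y(1) v(1,2)] v(3) L1y by simp
  also have "\<dots> = 0"
    using complex_structure.csc_mult[OF cQ L0_in[OF y(1)], of "- inverse l" l] \<open>l \<noteq> 0\<close>
    by (simp add: cscale_eq_csc[of l] cscale_eq_csc[of "- inverse l"] complex_structure.csc_minus[OF cQ]
       complex_structure.csc_simps[OF cQ])
  finally show ?thesis using complex_point_iff[OF v(1,2)] y by blast
qed

end

context quat_module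
begin

lemma finite_complex_points:
  assumes "subspace U" "U \<subseteq> E" "w \<in> S2" "w \<notin> complex_points U" shows "finite (complex_points U)"
proof -
  obtain e where "frame w e" using frame_exists assms by blast
  then interpret quat_pencil E R U w e using assms by unfold_locales auto
  show ?thesis using finite_complex_points assms by blast
qed

lemma complex_points_nonempty:
  assumes "subspace U" "U \<subseteq> E" "w \<in> S2" "w \<notin> complex_points U" "spans_at U E w" "E \<noteq> {0}"
  shows "complex_points U \<noteq> {}"
proof -
  obtain e where "frame w e" using frame_exists assms by blast
  then interpret quat_pencil E R U w e using assms by unfold_locales auto
  show ?thesis using complex_points_nonempty assms by blast
qed

end

section \<open>Obstructions to quaternionic linear maps\<close>

lemma separating_functional:
  fixes X :: "'a::real_vector set"
  assumes "subspace X" "k \<notin> X"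
  shows "\<exists>f::'a \<Rightarrow> real. linear f \<and> (\<forall>x\<in>X. f x = 0) \<and> f k \<noteq> 0"
proof -
  obtain B where B: "B \<subseteq> X" "independent B" "X \<subseteq> span B" using maximal_independent_subset by blast
  have sB: "span B = X" using B assms(1) by (simp add: span_minimal subset_antisym)
  then have "independent (insert k B)" using B(2) assms(2) by (simp add: independent_insert)
  then obtain f :: "'a \<Rightarrow> real" where f: "linear f" "\<forall>x\<in>insert k B. f x = (if x = k then 1 else 0)"
    using linear_independent_extend[of "insert k B" "\<lambda>x. if x = k then 1 else 0"] by blast
  have "f x = 0" if "x \<in> X" for x
    using that f B assms linear_eq_0_on_span[of f B x] sB by (metis insertI2 subsetD)
  then show ?thesis using f by (intro exI[of _ f]) auto
qed

definition sum_space :: "'a::real_vector set \<Rightarrow> 'a set \<Rightarrow> 'a set" where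
  "sum_space A B = {a + b |a b. a \<in> A \<and> b \<in> B}"

lemma sum_spaceI: "a \<in> A \<Longrightarrow> b \<in> B \<Longrightarrow> a + b \<in> sum_space A B"
  by (auto simp: sum_space_def)

lemma subspace_sum_space: "subspace A \<Longrightarrow> subspace B \<Longrightarrow> subspace (sum_space A B)"
  unfolding sum_space_def by (rule subspace_sums)

lemma sum_space_upper: "subspace A \<Longrightarrow> subspace B \<Longrightarrow> A \<subseteq> sum_space A B"
    "subspace A \<Longrightarrow> subspace B \<Longrightarrow> B \<subseteq> sum_space A B"
  unfolding sum_space_def using subspace_0 by force+

definition direct_split :: "'a::real_vector set \<Rightarrow> 'a set \<Rightarrow> 'a set \<Rightarrow> bool" where
  "direct_split E A B \<longleftrightarrow> A \<subseteq> E \<and> B \<subseteq> E \<and> A \<inter> B = {0} \<and> E \<subseteq> sum_space A B"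

context quat_module
begin

lemma frame_table:
  assumes "frame w e" "x \<in> E"
  shows "R w (R w x) = - x" "R e (R e x) = - x" "R (cross3 w e) (R (cross3 w e) x) = - x"
    "R w (R e x) = R (cross3 w e) x" "R e (R w x) = - R (cross3 w e) x"
    "R e (R (cross3 w e) x) = R w x" "R (cross3 w e) (R e x) = - R w x"
    "R (cross3 w e) (R w x) = R e x" "R w (R (cross3 w e) x) = - R e x"
  using assms frame_dots[OF assms(1)] frame_cross[OF assms(1)] cross_skew[of e w] cross_skew[of "cross3 w e" w]
  by (simp_all add: R_R R_simps)

lemma R_frame_expansion:
  assumes "frame w e"
  shows "R t x = (t \<bullet> w) *\<^sub>R R w x + (t \<bullet> e) *\<^sub>R R e x + (t \<bullet> cross3 w e) *\<^sub>R R (cross3 w e) x"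
  by (subst frame_expansion[OF assms, of t]) (simp add: R_simps)

lemma quaternionic_from_frame:
  assumes "linear g" "frame w e" "x \<in> E" "g x \<in> E" "g (R w x) = R w (g x)" "g (R e x) = R e (g x)"
     "g (R (cross3 w e) x) = R (cross3 w e) (g x)"
  shows "g (R t x) = R t (g x)"
  unfolding R_frame_expansion[OF assms(2), of t]
  by (simp add: linear_add[OF assms(1)] linear_scale[OF assms(1)] assms(5-7))

text \<open>Four times the projection of \<open>g\<close> to its quaternionic linear part.\<close>

definition average :: "real^3 \<Rightarrow> real^3 \<Rightarrow> ('a \<Rightarrow> 'a) \<Rightarrow> 'a \<Rightarrow> 'a" where
  "average w e g x = g x - R w (g (R w x)) - R e (g (R e x)) - R (cross3 w e) (g (R (cross3 w e) x))"

lemma linear_average: "linear g \<Longrightarrow> linear (average w e g)"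
  unfolding average_def
  by (intro linearI) (simp_all add: linear_add linear_scale R_simps algebra_simps)

lemma average_quaternionic:
  assumes "linear g" "frame w e" "stable_subspace R T" "T \<subseteq> E" "\<And>x. x \<in> T \<Longrightarrow> g x \<in> E" "x \<in> T"
  shows "average w e g (R t x) = R t (average w e g x)"
proof (rule quaternionic_from_frame[OF linear_average[OF assms(1)] assms(2)])
  have T: "R t y \<in> T" if "y \<in> T" for t y using assms(3) that by (simp add: stable_subspace_def)
  have xE: "x \<in> E" using assms by auto
  note gE = assms(5)[OF assms(6)] assms(5)[OF T[OF assms(6)]]
  show "x \<in> E" by fact
  show "average w e g x \<in> E" using gE by (auto simp: average_def intro!: subspace_diff E R_in)
  show "average w e g (R w x) = R w (average w e g x)" "average w e g (R e x) = R e (average w e g x)"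
     "average w e g (R (cross3 w e) x) = R (cross3 w e) (average w e g x)"
    using gE xE by (simp_all add: average_def frame_table[OF assms(2)] linear_neg[OF assms(1)] R_simps)
qed

definition rank_one :: "'a \<Rightarrow> 'a \<Rightarrow> 'a \<Rightarrow>\<^sub>L 'a" where
  "rank_one x y = Blinfun (\<lambda>z. (x \<bullet> z) *\<^sub>R y)"

lemma rank_one_apply [simp]: "blinfun_apply (rank_one x y) z = (x \<bullet> z) *\<^sub>R y"
proof -
  have "bounded_linear (\<lambda>z. (x \<bullet> z) *\<^sub>R y)" by (intro bounded_linear_intros)
  then show ?thesis by (simp add: rank_one_def bounded_linear_Blinfun_apply)
qed

text \<open>If \<open>k\<close> is not the sum of a quaternionic linear map \<open>b\<close> from \<open>T\<close> to \<open>S\<close> and a map \<open>z\<close> from \<open>B\<close> to \<open>A\<close>, then a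
linear functional \<open>f\<close> on the endomorphisms separates it from such sums.  The functional has the form
\<open>g \<mapsto> trace (h g)\<close>, where \<open>h\<close> is determined by the values of \<open>f\<close> on operators of rank one.  Vanishing on
the maps \<open>z\<close> means that \<open>h\<close> kills \<open>A\<close> and has values in \<open>B\<close>; vanishing on the maps \<open>b\<close>, applied to averages
of operators of rank one, means that the average of \<open>h\<close> vanishes.\<close>

lemma duality:
  assumes S: "stable_subspace R S" "S \<subseteq> E" and T: "stable_subspace R T" "T \<subseteq> E"
    and A: "subspace A" and B: "subspace B" and k: "linear k"
    and no: "\<nexists>b z. linear b \<and> linear z \<and> (\<forall>x\<in>T. b x \<in> S) \<and> (\<forall>t. \<forall>x\<in>T. b (R t x) = R t (b x))
                 \<and> (\<forall>x\<in>B. z x \<in> A) \<and> (\<forall>x. k x = b x + z x)"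
  obtains h where "linear h" "\<And>x. x \<in> A \<Longrightarrow> h x = 0" "\<And>x. h x \<in> B"
    "\<And>w e y. frame w e \<Longrightarrow> y \<in> S \<Longrightarrow> average w e h y = 0"
    "(\<Sum>i\<in>Basis. h (k i) \<bullet> i) \<noteq> 0"
proof -
  define H where "H = {b :: 'a \<Rightarrow>\<^sub>L 'a. (\<forall>x\<in>T. b x \<in> S) \<and> (\<forall>t. \<forall>x\<in>T. b (R t x) = R t (b x))}"
  define Z where "Z = {z :: 'a \<Rightarrow>\<^sub>L 'a. \<forall>x\<in>B. z x \<in> A}"
  define K where "K = Blinfun k"
  have Kk: "blinfun_apply K x = k x" for x
    using k by (simp add: K_def bounded_linear_Blinfun_apply linear_conv_bounded_linear)
  have subS: "subspace S" using S by (simp add: stable_subspace_def)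
  have "subspace H" unfolding H_def subspace_def
    by (auto simp: blinfun.bilinear_simps R_simps intro: subspace_add subspace_mul subspace_0 subS)
  moreover have "subspace Z" unfolding Z_def subspace_def
    by (auto simp: blinfun.bilinear_simps intro: subspace_add subspace_mul subspace_0 A)
  ultimately have sub: "subspace {b + z |b z. b \<in> H \<and> z \<in> Z}" by (rule subspace_sums)
  have "K \<notin> {b + z |b z. b \<in> H \<and> z \<in> Z}"
  proof
    assume "K \<in> {b + z |b z. b \<in> H \<and> z \<in> Z}"
    then obtain b z where bz: "K = b + z" "b \<in> H" "z \<in> Z" by auto
    have "linear (blinfun_apply b)" "linear (blinfun_apply z)"
      by (simp_all add: blinfun.bounded_linear_right bounded_linear.linear)
    moreover have "\<forall>x. k x = b x + z x" using bz(1) Kk by (metis plus_blinfun.rep_eq)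
    ultimately show False using no bz(2,3) unfolding H_def Z_def by blast
  qed
  from separating_functional[OF sub this] obtain f :: "('a \<Rightarrow>\<^sub>L 'a) \<Rightarrow> real" where
    f: "linear f" "\<And>b z. b \<in> H \<Longrightarrow> z \<in> Z \<Longrightarrow> f (b + z) = 0" "f K \<noteq> 0" by blast
  have "0 \<in> H" "0 \<in> Z" using \<open>subspace H\<close> \<open>subspace Z\<close> by (auto intro: subspace_0)
  then have fH: "f b = 0" if "b \<in> H" for b using f(2)[OF that \<open>0 \<in> Z\<close>] by simp
  have fZ: "f z = 0" if "z \<in> Z" for z using f(2)[OF \<open>0 \<in> H\<close> that] by simp
  define h where "h y = (\<Sum>i\<in>Basis. f (rank_one i y) *\<^sub>R i)" for y
  have h_inner: "h y \<bullet> x = f (rank_one x y)" for x y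
  proof -
    have "rank_one x y = (\<Sum>i\<in>Basis. (x \<bullet> i) *\<^sub>R rank_one i y)"
    proof (rule blinfun_eqI)
      fix z
      have "(x \<bullet> z) *\<^sub>R y = (\<Sum>i\<in>Basis. (x \<bullet> i) * (i \<bullet> z)) *\<^sub>R y"
        by (subst euclidean_inner[of x z]) (simp add: inner_commute)
      then show "blinfun_apply (rank_one x y) z = blinfun_apply (\<Sum>i\<in>Basis. (x \<bullet> i) *\<^sub>R rank_one i y) z"
        by (simp add: blinfun.sum_left blinfun.scaleR_left scaleR_left.sum)
    qed
    then have "f (rank_one x y) = (\<Sum>i\<in>Basis. (x \<bullet> i) * f (rank_one i y))"
      by (simp add: linear_sum[OF f(1)] linear_scale[OF f(1)])
    then show ?thesis by (simp add: h_def inner_sum_left mult.commute inner_commute[of x])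
  qed
  have lin_h: "linear h"
  proof (rule linearI)
    have 1: "rank_one i (x + y) = rank_one i x + rank_one i y" for i x y
      by (rule blinfun_eqI) (simp add: blinfun.bilinear_simps algebra_simps)
    have 2: "rank_one i (r *\<^sub>R x) = r *\<^sub>R rank_one i x" for i x r
      by (rule blinfun_eqI) (simp add: blinfun.bilinear_simps)
    show "h (x + y) = h x + h y" for x y
      by (simp add: h_def 1 linear_add[OF f(1)] scaleR_left_distrib sum.distrib)
    show "h (r *\<^sub>R x) = r *\<^sub>R h x" for r x
      by (simp add: h_def 2 linear_scale[OF f(1)] scaleR_sum_right)
  qed
  moreover have "h x = 0" if "x \<in> A" for x
  proof -
    have "h x \<bullet> y = 0" for y
      unfolding h_inner using that by (intro fZ) (auto simp: Z_def intro: subspace_mul A)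
    then show ?thesis by (metis inner_eq_zero_iff)
  qed
  moreover have hB: "h x \<in> B" for x
  proof -
    have "h x \<bullet> y = 0" if "y \<in> B\<^sup>\<bottom>" for y
      unfolding h_inner using that A
      by (intro fZ) (auto simp: Z_def orthogonal_comp_def orthogonal_def inner_commute intro: subspace_0)
    then have "h x \<in> B\<^sup>\<bottom>\<^sup>\<bottom>" by (auto simp: orthogonal_comp_def orthogonal_def inner_commute)
    then show ?thesis using orthogonal_comp_self[OF B] by simp
  qed
  moreover have "average w e h y = 0" if fr: "frame w e" and y: "y \<in> S" for w e y
  proof -
    let ?f = "cross3 w e"
    have yE: "y \<in> E" using y S by auto
    have "average w e h y \<bullet> x = 0" for x
    proof -
      let ?a = "\<lambda>t. adjoint (R t) x"
      (* the average of the operator z \<mapsto> (x \<bullet> z) y, again a sum of operators of rank one *)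
      let ?b = "rank_one x y - rank_one (?a w) (R w y) - rank_one (?a e) (R e y) - rank_one (?a ?f) (R ?f y)"
      have b: "blinfun_apply ?b z = average w e (blinfun_apply (rank_one x y)) z" for z
        by (simp add: blinfun.bilinear_simps average_def R_simps adjoint_clauses[OF linear_R])
      have "?b \<in> H"
      proof -
        have "blinfun_apply ?b z \<in> S" for z
          using y S by (auto simp: blinfun.bilinear_simps stable_subspace_def intro!: subspace_diff subspace_mul)
        moreover have "blinfun_apply ?b (R t z) = R t (blinfun_apply ?b z)" if "z \<in> T" for t z
          unfolding b using fr T that yE
          by (intro average_quaternionic) (auto simp: blinfun.bounded_linear_right bounded_linear.linear
              intro: subspace_mul[OF E])
        ultimately show ?thesis by (simp add: H_def)
      qed
      then have "f ?b = 0" by (rule fH)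
      then show ?thesis
        by (simp add: linear_diff[OF f(1)] average_def inner_diff_left adjoint_works[OF linear_R] flip: h_inner)
    qed
    then show ?thesis by (metis inner_eq_zero_iff)
  qed
  moreover have "(\<Sum>i\<in>Basis. h (k i) \<bullet> i) \<noteq> 0"
  proof -
    have "K = (\<Sum>i\<in>Basis. rank_one i (k i))"
    proof (rule blinfun_eqI)
      fix z
      have "k z = k (\<Sum>i\<in>Basis. (z \<bullet> i) *\<^sub>R i)" by (simp add: euclidean_representation)
      also have "\<dots> = (\<Sum>i\<in>Basis. (i \<bullet> z) *\<^sub>R k i)"
        by (simp add: linear_sum[OF k] linear_scale[OF k] inner_commute)
      finally show "blinfun_apply K z = blinfun_apply (\<Sum>i\<in>Basis. rank_one i (k i)) z"
        by (simp add: Kk blinfun.sum_left)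
    qed
    then show ?thesis using f(3) by (simp add: linear_sum[OF f(1)] h_inner)
  qed
  ultimately show ?thesis using that[of h] by simp
qed

text \<open>Commutation with \<open>R w\<close> is immediate.  Commutation with \<open>R e\<close> is the vanishing of the average at
\<open>R (cross3 w e) z\<close>, rewritten by the multiplication table.\<close>

lemma anticommutator_quaternionic:
  assumes S: "stable_subspace R S" "S \<subseteq> E" and h: "linear h" "\<And>y. y \<in> S \<Longrightarrow> h y \<in> E"
    and fr: "frame w e" and av: "\<And>y. y \<in> S \<Longrightarrow> average w e h y = 0" and y: "y \<in> S"
  shows "h (R w (R t y)) + R w (h (R t y)) = R t (h (R w y) + R w (h y))"
proof -
  have RS: "R t z \<in> S" if "z \<in> S" for t z using S(1) that by (simp add: stable_subspace_def)
  let ?g = "\<lambda>y. h (R w y) + R w (h y)"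
  have lin: "linear ?g"
    by (intro linearI) (simp_all add: R_simps linear_add[OF h(1)] linear_scale[OF h(1)] algebra_simps)
  have E': "z \<in> E" "h z \<in> E" "h (R s z) \<in> E" if "z \<in> S" for z s using that S h RS by auto
  have e: "?g (R e z) = R e (?g z)" if z: "z \<in> S" for z
  proof -
    have "average w e h (R (cross3 w e) z) = 0" using av RS z by blast
    then have "h (R (cross3 w e) z) + R w (h (R e z)) - R e (h (R w z)) + R (cross3 w e) (h z) = 0"
      using E'[OF z] by (simp add: average_def frame_table[OF fr] linear_neg[OF h(1)] R_simps)
    then show ?thesis using E'[OF z]
      by (simp add: frame_table[OF fr] R_simps algebra_simps eq_neg_iff_add_eq_0)
  qed
  have w: "?g (R w z) = R w (?g z)" if z: "z \<in> S" for z
    using E'[OF z] by (simp add: frame_table[OF fr] linear_neg[OF h(1)] R_simps)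
  have "?g (R t y) = R t (?g y)"
  proof (rule quaternionic_from_frame[OF lin fr])
    show "y \<in> E" "?g y \<in> E" using E'[OF y] by (auto intro: subspace_add[OF E] R_in)
    have "?g (R w (R e y)) = R w (R e (?g y))" using w[OF RS[OF y]] e[OF y] by simp
    then show "?g (R (cross3 w e) y) = R (cross3 w e) (?g y)"
      using frame_table(4)[OF fr E'(1)[OF y]] frame_table(4)[OF fr \<open>?g y \<in> E\<close>] by metis
  qed (use w e y in auto)
  then show ?thesis .
qed


section \<open>Splitting off a submodule\<close>

definition projection :: "'a set \<Rightarrow> ('a \<Rightarrow> 'a) \<Rightarrow> bool" where
  "projection S p \<longleftrightarrow> linear p \<and> (\<forall>x\<in>E. p x \<in> S) \<and> (\<forall>x\<in>S. p x = x) \<and>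
     (\<forall>x\<in>E. \<forall>t. p (R t x) = R t (p x))"

text \<open>Morphisms of pairs from \<open>S\<close>, with real subspace \<open>U \<inter> S\<close>, to the quotient by \<open>S\<close>, which is
identified with the kernel of \<open>p\<close>.\<close>

definition quotient_morphism :: "'a set \<Rightarrow> 'a set \<Rightarrow> ('a \<Rightarrow> 'a) \<Rightarrow> ('a \<Rightarrow> 'a) \<Rightarrow> bool" where
  "quotient_morphism U S p g \<longleftrightarrow> linear g \<and> (\<forall>x\<in>S. g x \<in> E \<and> p (g x) = 0) \<and>
     (\<forall>x\<in>S. \<forall>t. g (R t x) = R t (g x)) \<and> (\<forall>x\<in>U \<inter> S. \<exists>y\<in>U. g x = y - p y)"

text \<open>Averaging an arbitrary projection.\<close>

lemma quaternionic_projection: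
  assumes "stable_subspace R S" "S \<subseteq> E"
  shows "\<exists>p. projection S p"
proof -
  have subS: "subspace S" and RS: "\<And>x t. x \<in> S \<Longrightarrow> R t x \<in> S"
    using assms(1) by (auto simp: stable_subspace_def)
  obtain w :: "real^3" where "w \<in> S2" using frame_exists by (metis S2_def norm_axis_1 mem_sphere_0)
  then obtain e where fr: "frame w e" using frame_exists by blast
  define q where "q x = x - perp S x" for x
  have q: "linear q" "q x \<in> S" for x
    unfolding q_def using perp[OF subS] linear_perp[OF subS] by (auto intro: linear_compose_sub linear_ident)
  have qid: "q x = x" if "x \<in> S" for x using that perp_eq_0_iff[OF subS] by (simp add: q_def)
  define p where "p x = (1/4) *\<^sub>R average w e q x" for x
  have "projection S p"
    unfolding projection_def
  proof (intro conjI ballI allI)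
    show "linear p" unfolding p_def by (intro linear_compose_scale_right linear_average q)
    show "p x \<in> S" if "x \<in> E" for x
      using q(2) by (auto simp: p_def average_def intro!: subspace_mul subspace_diff subS RS)
    show "p x = x" if "x \<in> S" for x
    proof -
      have "x \<in> E" using that assms by auto
      then have "average w e q x = 4 *\<^sub>R x"
        using RS[OF that] by (simp add: average_def qid that frame_table[OF fr])
          (metis one_add_one numeral_Bit0 scaleR_2 scaleR_left_distrib add.assoc)
      then show ?thesis by (simp add: p_def)
    qed
    show "p (R t x) = R t (p x)" if "x \<in> E" for x t
      using average_quaternionic[OF q(1) fr _ _ _ that, of t] E q(2) assms(2) R_in
      by (auto simp: p_def R_simps stable_subspace_def)
  qed
  then show ?thesis by blast
qed

text \<open>Let \<open>T0\<close> be the kernel of \<open>p\<close> and let \<open>x + k x\<close>, with \<open>k x\<close> in \<open>S\<close>, be a lift to \<open>U\<close> of \<open>x\<close> in the image \<open>B\<close> of \<open>U\<close> in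
\<open>T0\<close>.  If \<open>k = b + z\<close> with \<open>b\<close> quaternionic linear and \<open>z\<close> mapping \<open>B\<close> to \<open>U \<inter> S\<close>, then the graph of \<open>b\<close> is the
required complement.  Otherwise duality gives an \<open>h\<close> from \<open>S\<close> to \<open>T0\<close> for which all \<open>h R w + R w h\<close> are morphisms of pairs and
hence zero; then \<open>h\<close> anticommutes with the \<open>R w\<close>, its average is \<open>- 2 h\<close>, and so \<open>h = 0\<close>, contrary to
the trace condition.\<close>

lemma splitting:
  assumes S: "stable_subspace R S" "S \<subseteq> E" and U: "subspace U" "U \<subseteq> E"
    and pr: "projection S p"
    and hom: "\<And>g. quotient_morphism U S p g \<Longrightarrow> \<forall>x\<in>S. g x = 0"
  shows "\<exists>T. stable_subspace R T \<and> direct_split E S T \<and> U \<subseteq> sum_space (U \<inter> S) (U \<inter> T)"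
proof -
  have p: "linear p" "\<And>x. x \<in> E \<Longrightarrow> p x \<in> S" "\<And>x. x \<in> S \<Longrightarrow> p x = x"
      "\<And>x t. x \<in> E \<Longrightarrow> p (R t x) = R t (p x)"
    using pr by (auto simp: projection_def)
  define T0 where "T0 = {x \<in> E. p x = 0}"
  define q where "q x = x - p x" for x
  have subS: "subspace S" and RS: "\<And>x t. x \<in> S \<Longrightarrow> R t x \<in> S"
    using S by (auto simp: stable_subspace_def)
  have qT: "q x \<in> T0" if "x \<in> E" for x
  proof -
    have "p x \<in> E" using p(2)[OF that] S by auto
    then show ?thesis using that p(2)[OF that] by (simp add: q_def T0_def subspace_diff[OF E] linear_diff[OF p(1)] p(3))
  qed
  have lin_q: "linear q" unfolding q_def by (intro linear_compose_sub linear_ident p)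
  have T0: "stable_subspace R T0" "T0 \<subseteq> E"
    using p(4) R_in E unfolding stable_subspace_def T0_def subspace_def
    by (auto simp: linear_add[OF p(1)] linear_scale[OF p(1)] linear_0[OF p(1)] R_simps)
  define B where "B = q ` U"
  have B: "subspace B" "B \<subseteq> T0" unfolding B_def using lin_q U qT by (auto intro: linear_subspace_image)
  obtain s where s: "range s \<subseteq> U" "linear s" "\<And>x. x \<in> B \<Longrightarrow> q (s x) = x"
    using linear_exists_right_inverse_on[OF lin_q U(1)] by (auto simp: B_def)
  have sU: "s x \<in> U" for x using s(1) by auto
  define k where "k x = p (s x)" for x
  have lin_k: "linear k" unfolding k_def using linear_compose[OF s(2) p(1)] by (simp add: o_def)
  have kS: "k x \<in> S" for x using sU U p(2) by (auto simp: k_def)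
  have k: "x + k x = s x" if "x \<in> B" for x using s(3)[OF that] by (simp add: k_def q_def algebra_simps)
  have "\<exists>b z. linear b \<and> linear z \<and> (\<forall>x\<in>T0. b x \<in> S) \<and> (\<forall>t. \<forall>x\<in>T0. b (R t x) = R t (b x))
                 \<and> (\<forall>x\<in>B. z x \<in> U \<inter> S) \<and> (\<forall>x. k x = b x + z x)"
  proof (rule ccontr)
    assume no: "\<not> ?thesis"
    obtain h where h: "linear h" "\<And>x. x \<in> U \<inter> S \<Longrightarrow> h x = 0" "\<And>x. h x \<in> B"
      "\<And>w e y. frame w e \<Longrightarrow> y \<in> S \<Longrightarrow> average w e h y = 0" "(\<Sum>i\<in>Basis. h (k i) \<bullet> i) \<noteq> 0"
      by (rule duality[OF S T0 subspace_inter[OF U(1) subS] B(1) lin_k no]) blast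
    have hT: "h x \<in> T0" for x using h(3) B(2) by auto
    then have hE: "h x \<in> E" for x using T0(2) by auto
    have anti: "h (R w y) + R w (h y) = 0" if fr: "frame w e" and "y \<in> S" for w e y
    proof (rule hom[THEN bspec, OF _ that(2)], unfold quotient_morphism_def, intro conjI ballI allI)
      show "linear (\<lambda>y. h (R w y) + R w (h y))"
        by (intro linearI) (simp_all add: R_simps linear_add[OF h(1)] linear_scale[OF h(1)] algebra_simps)
      show "h (R w x) + R w (h x) \<in> E" "p (h (R w x) + R w (h x)) = 0" if "x \<in> S" for x
      proof -
        have "h (R w x) \<in> T0" "R w (h x) \<in> T0" using hT T0 by (auto simp: stable_subspace_def)
        then show "h (R w x) + R w (h x) \<in> E" "p (h (R w x) + R w (h x)) = 0"
          using E by (auto simp: T0_def linear_add[OF p(1)] intro: subspace_add)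
      qed
      show "h (R w (R t x)) + R w (h (R t x)) = R t (h (R w x) + R w (h x))" if "x \<in> S" for x t
        using anticommutator_quaternionic[OF S h(1) hE fr h(4)[OF fr] that] .
      show "\<exists>y\<in>U. h (R w x) + R w (h x) = y - p y" if "x \<in> U \<inter> S" for x
        using h(2)[OF that] h(3)[of "R w x"] by (auto simp: B_def q_def R_simps)
    qed
    have "h y = 0" if y: "y \<in> S" for y
    proof -
      obtain w :: "real^3" where "w \<in> S2" by (metis S2_def norm_axis_1 mem_sphere_0)
      then obtain e where fr: "frame w e" using frame_exists by blast
      have fr2: "frame e (cross3 w e)" "frame (cross3 w e) w"
        using frame_S2[OF fr] frame_dots[OF fr] by (auto simp: frame_def)
      have 1: "R v (h (R v y)) = h y" if "frame v v'" for v v'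
      proof -
        have "h (R v y) = - R v (h y)" using anti[OF that y] by (simp add: eq_neg_iff_add_eq_0)
        then show ?thesis using that hE by (simp add: R_simps R_unit frame_def)
      qed
      have "average w e h y = h y - h y - h y - h y"
        using 1[OF fr] 1[OF fr2(1)] 1[OF fr2(2)] by (simp add: average_def)
      then have "h y = - h y" using h(4)[OF fr y] by simp
      then have "2 *\<^sub>R h y = 0" unfolding scaleR_2 by (metis add.right_inverse)
      then show ?thesis by simp
    qed
    then show False using h(5) kS by simp
  qed
  then obtain b z where bz: "linear b" "linear z" "\<And>x. x \<in> T0 \<Longrightarrow> b x \<in> S" "\<And>t x. x \<in> T0 \<Longrightarrow> b (R t x) = R t (b x)"
     "\<And>x. x \<in> B \<Longrightarrow> z x \<in> U \<inter> S" "\<And>x. k x = b x + z x" by blast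
  define T where "T = (\<lambda>x. x + b x) ` T0"
  have lin1: "linear (\<lambda>x. x + b x)" by (intro linear_compose_add linear_ident bz)
  have subT0: "subspace T0" and RT0: "\<And>t x. x \<in> T0 \<Longrightarrow> R t x \<in> T0"
    using T0 by (auto simp: stable_subspace_def)
  have pb: "p (x + b x) = b x" "q (x + b x) = x" if "x \<in> T0" for x
    using that p(3)[OF bz(3)[OF that]] by (auto simp: T0_def q_def linear_add[OF p(1)])
  show ?thesis
  proof (intro exI conjI)
    show "stable_subspace R T"
      unfolding stable_subspace_def
    proof (intro conjI allI ballI)
      show "subspace T" unfolding T_def by (rule linear_subspace_image[OF lin1 subT0])
      show "R t x \<in> T" if "x \<in> T" for t x
        using that bz(4) RT0 unfolding T_def by (auto simp: R_simps intro!: image_eqI[of _ _ "R t _"])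
    qed
    have TE: "T \<subseteq> E" using T0(2) bz(3) S(2) E by (auto simp: T_def intro: subspace_add)
    have ST: "S \<inter> T = {0}"
    proof -
      have "x = 0" if "x \<in> S" "x \<in> T" for x
      proof -
        obtain y where "y \<in> T0" "x = y + b y" using \<open>x \<in> T\<close> by (auto simp: T_def)
        then have "y = 0" using pb(2)[of y] p(3)[OF \<open>x \<in> S\<close>] by (simp add: q_def)
        then show ?thesis using \<open>x = y + b y\<close> by (simp add: linear_0[OF bz(1)])
      qed
      moreover have "0 \<in> T" using linear_subspace_image[OF lin1 subT0] subspace_0 unfolding T_def by blast
      ultimately show ?thesis using subspace_0[OF subS] by blast
    qed
    have "x \<in> sum_space S T" if "x \<in> E" for x
    proof -
      have "x = (p x - b (q x)) + (q x + b (q x))" by (simp add: q_def)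
      moreover have "p x - b (q x) \<in> S" using p(2)[OF that] bz(3) qT[OF that] by (intro subspace_diff subS) auto
      moreover have "q x + b (q x) \<in> T" using qT[OF that] by (auto simp: T_def)
      ultimately show ?thesis using sum_spaceI by metis
    qed
    then show "direct_split E S T" using S(2) TE ST by (auto simp: direct_split_def)
    have "x \<in> sum_space (U \<inter> S) (U \<inter> T)" if x: "x \<in> U" for x
    proof -
      define y where "y = q x"
      have y: "y \<in> B" "y \<in> T0" using x B by (auto simp: y_def B_def)
      have "y + b y = s y - z y" using k[OF y(1)] bz(6)[of y] by (simp add: algebra_simps)
      then have 1: "y + b y \<in> U" using sU bz(5)[OF y(1)] by (auto intro: subspace_diff U)
      have 2: "x - (y + b y) = p x - b y" by (simp add: y_def q_def)
      have "p x - b y \<in> S" using x U p(2) bz(3)[OF y(2)] by (auto intro: subspace_diff subS)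
      then have "x - (y + b y) \<in> S" unfolding 2 .
      then have "x - (y + b y) \<in> U \<inter> S" using subspace_diff[OF U(1) x 1] by blast
      moreover have "y + b y \<in> U \<inter> T" using 1 y by (auto simp: T_def)
      ultimately show ?thesis using sum_spaceI[of "x - (y + b y)" _ "y + b y"] by simp
    qed
    then show "U \<subseteq> sum_space (U \<inter> S) (U \<inter> T)" by blast
  qed
qed

end

section \<open>Decomposition of a real subspace\<close>

text \<open>For two points of the sphere that are not proportional, \<open>1\<close>, \<open>v\<close>, \<open>u\<close> and \<open>v u\<close> span the quaternions.\<close>

lemma S2_basis:
  assumes "v \<in> S2" "u \<in> S2" "u \<noteq> v" "u \<noteq> - v"
  shows "\<exists>a b c. t = a *\<^sub>R v + b *\<^sub>R u + c *\<^sub>R cross3 v u"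
proof -
  define y where "y = u - (u \<bullet> v) *\<^sub>R v"
  have yv: "v \<bullet> y = 0" using assms by (simp add: y_def inner_diff_right S2_iff inner_commute)
  have "y \<noteq> 0"
  proof
    assume "y = 0"
    then have *: "u = (u \<bullet> v) *\<^sub>R v" by (simp add: y_def)
    then have "norm u = \<bar>u \<bullet> v\<bar> * norm v" by (metis norm_scaleR)
    then have "\<bar>u \<bullet> v\<bar> = 1" using assms by (simp add: S2_def)
    then show False using * assms(3,4) by (auto simp: abs_if split: if_splits)
  qed
  define k where "k = norm y"
  have k: "k \<noteq> 0" using \<open>y \<noteq> 0\<close> by (simp add: k_def)
  define e where "e = (1 / k) *\<^sub>R y"
  have fr: "frame v e"
    using assms(1) yv \<open>y \<noteq> 0\<close> by (simp add: frame_def e_def k_def S2_def)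
  have e: "e = (1/k) *\<^sub>R u - ((u \<bullet> v)/k) *\<^sub>R v"
    using k by (simp add: e_def y_def algebra_simps)
  have "cross3 v e = (1/k) *\<^sub>R cross3 v u"
    by (simp add: e cross_mult_right Cross3.right_diff_distrib)
  then have "t = (t \<bullet> v) *\<^sub>R v + (t \<bullet> e) *\<^sub>R ((1/k) *\<^sub>R u - ((u \<bullet> v)/k) *\<^sub>R v) + ((t \<bullet> cross3 v e)/k) *\<^sub>R cross3 v u"
    using frame_expansion[OF fr, of t] e by simp
  then have "t = (t \<bullet> v - (t \<bullet> e) * ((u \<bullet> v)/k)) *\<^sub>R v + ((t \<bullet> e)/k) *\<^sub>R u + ((t \<bullet> cross3 v e)/k) *\<^sub>R cross3 v u"
    by (simp add: algebra_simps)
  then show ?thesis by blast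
qed

lemma infinite_S2: "infinite S2"
proof
  assume fin: "finite S2"
  have "\<exists>w::real^3. w \<in> S2" by (metis S2_def norm_axis_1 mem_sphere_0)
  then obtain w e :: "real^3" where fr: "frame w e" using frame_exists by blast
  have "UNIV \<subseteq> coord w e ` (S2 - {- w})" 
  proof
    show "c \<in> coord w e ` (S2 - {- w})" for c using coord_surj[OF fr, of c] by auto
  qed
  then have "finite (UNIV :: complex set)" using fin by (meson finite_Diff finite_imageI finite_subset)
  then show False by (simp add: infinite_UNIV_char_0)
qed

lemma max_dim_subspace:
  fixes P :: "'a::euclidean_space set \<Rightarrow> bool"
  assumes "P A" shows "\<exists>M. P M \<and> (\<forall>F. P F \<longrightarrow> dim F \<le> dim M)"
proof (rule ex_has_greatest_nat[of P A dim "Suc DIM('a)"])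
  show "\<forall>y. P y \<longrightarrow> dim y < Suc DIM('a)" by (simp add: dim_subset_UNIV less_Suc_eq_le)
qed (rule assms)

lemma min_dim_subspace:
  fixes P :: "'a::euclidean_space set \<Rightarrow> bool"
  assumes "P A" shows "\<exists>M. P M \<and> (\<forall>F. P F \<longrightarrow> dim M \<le> dim F)"
  using ex_has_least_nat[of P A dim] assms by blast

context quat_module
begin

lemma stable_sum_space:
  assumes "stable_subspace R A" "stable_subspace R B" shows "stable_subspace R (sum_space A B)"
proof -
  have "R t x \<in> sum_space A B" if "x \<in> sum_space A B" for t x
  proof -
    obtain a b where "a \<in> A" "b \<in> B" "x = a + b" using \<open>x \<in> sum_space A B\<close> by (auto simp: sum_space_def)
    then show ?thesis using assms by (auto simp: R_simps stable_subspace_def intro: sum_spaceI)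
  qed
  then show ?thesis using assms subspace_sum_space[of A B] by (simp add: stable_subspace_def)
qed

definition generically_spanned :: "'a set \<Rightarrow> 'a set \<Rightarrow> bool" where
  "generically_spanned U F \<longleftrightarrow> stable_subspace R F \<and> F \<subseteq> E \<and> finite {v \<in> S2. \<not> spans_at (U \<inter> F) F v}"

text \<open>The quotient by \<open>K\<close> of the pair given by \<open>U\<close> generically has no complex points.  The quotient
is not formed; a vector of its real subspace is represented in \<open>U + K\<close>.\<close>

definition generically_real :: "'a set \<Rightarrow> 'a set \<Rightarrow> bool" where
  "generically_real U K \<longleftrightarrow> stable_subspace R K \<and> K \<subseteq> E \<and>
     finite {v \<in> S2. \<exists>x\<in>sum_space U K. R v x \<in> sum_space U K \<and> x \<notin> K}"

lemma spans_atD: "spans_at U F v \<Longrightarrow> x \<in> F \<Longrightarrow> \<exists>a\<in>U. \<exists>b\<in>U. x = a + R v b"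
  by (simp add: spans_at_def)

lemma spans_at_sum:
  assumes U: "subspace U" and AB: "subspace A" "subspace B"
    and "spans_at (U \<inter> A) A v" "spans_at (U \<inter> B) B v"
  shows "spans_at (U \<inter> sum_space A B) (sum_space A B) v"
  unfolding spans_at_def
proof
  fix x assume "x \<in> sum_space A B"
  then obtain a b where x: "x = a + b" "a \<in> A" "b \<in> B" by (auto simp: sum_space_def)
  obtain a1 a2 where a: "a1 \<in> U \<inter> A" "a2 \<in> U \<inter> A" "a = a1 + R v a2" using spans_atD[OF assms(4) x(2)] by blast
  obtain b1 b2 where b: "b1 \<in> U \<inter> B" "b2 \<in> U \<inter> B" "b = b1 + R v b2" using spans_atD[OF assms(5) x(3)] by blast
  have "x = (a1 + b1) + R v (a2 + b2)" using x a b by (simp add: R_simps)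
  moreover have "a1 + b1 \<in> U \<inter> sum_space A B" "a2 + b2 \<in> U \<inter> sum_space A B"
    using a b by (auto intro: sum_spaceI subspace_add U)
  ultimately show "\<exists>a\<in>U \<inter> sum_space A B. \<exists>b\<in>U \<inter> sum_space A B. x = a + R v b" by blast
qed

lemma generically_spanned_sum:
  assumes "subspace U" "generically_spanned U A" "generically_spanned U B"
  shows "generically_spanned U (sum_space A B)"
  unfolding generically_spanned_def
proof (intro conjI)
  have A: "stable_subspace R A" "A \<subseteq> E" "subspace A" and B: "stable_subspace R B" "B \<subseteq> E" "subspace B"
    using assms by (auto simp: generically_spanned_def stable_subspace_def)
  show "stable_subspace R (sum_space A B)" using stable_sum_space A B by blast
  show "sum_space A B \<subseteq> E" using A B E by (auto simp: sum_space_def intro: subspace_add)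
  have "{v \<in> S2. \<not> spans_at (U \<inter> sum_space A B) (sum_space A B) v}
     \<subseteq> {v \<in> S2. \<not> spans_at (U \<inter> A) A v} \<union> {v \<in> S2. \<not> spans_at (U \<inter> B) B v}"
    using spans_at_sum[OF assms(1) A(3) B(3)] by blast
  moreover have "finite ({v \<in> S2. \<not> spans_at (U \<inter> A) A v} \<union> {v \<in> S2. \<not> spans_at (U \<inter> B) B v})"
    using assms(2,3) by (simp add: generically_spanned_def)
  ultimately show "finite {v \<in> S2. \<not> spans_at (U \<inter> sum_space A B) (sum_space A B) v}"
    by (rule finite_subset)
qed

text \<open>If \<open>U\<close> contains the complex line spanned by \<open>x\<close> and \<open>R v x\<close>, then the quaternionic line of \<open>x\<close> is spanned at all
points other than \<open>v\<close> and \<open>- v\<close>.\<close>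

lemma generically_spanned_line:
  assumes U: "subspace U" "U \<subseteq> E" and v: "v \<in> S2" and x: "x \<in> U" "R v x \<in> U"
  obtains F where "generically_spanned U F" "x \<in> F"
proof
  define F where "F = {a *\<^sub>R x + R t x |a t. True}"
  have xE: "x \<in> E" using x U by auto
  show "x \<in> F" unfolding F_def by (rule CollectI, rule exI[of _ 1], rule exI[of _ 0]) (simp add: R_simps)
  show "generically_spanned U F"
    unfolding generically_spanned_def
  proof (intro conjI)
    show "stable_subspace R F"
      unfolding stable_subspace_def subspace_def
    proof (intro conjI allI ballI)
      show "0 \<in> F" unfolding F_def by (rule CollectI, rule exI[of _ 0], rule exI[of _ 0]) (simp add: R_simps)
      show "y + z \<in> F" if yz: "y \<in> F" "z \<in> F" for y z
      proof -
        obtain a s b t where "y = a *\<^sub>R x + R s x" "z = b *\<^sub>R x + R t x" using yz by (auto simp: F_def)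
        then have "y + z = (a + b) *\<^sub>R x + R (s + t) x" by (simp add: R_simps algebra_simps)
        then show ?thesis by (auto simp: F_def)
      qed
      show "c *\<^sub>R y \<in> F" if y: "y \<in> F" for c y
      proof -
        obtain a s where "y = a *\<^sub>R x + R s x" using y by (auto simp: F_def)
        then have "c *\<^sub>R y = (c * a) *\<^sub>R x + R (c *\<^sub>R s) x" by (simp add: R_simps algebra_simps)
        then show ?thesis by (auto simp: F_def)
      qed
      show "R t y \<in> F" if y: "y \<in> F" for t y
      proof -
        obtain a s where "y = a *\<^sub>R x + R s x" using y by (auto simp: F_def)
        then have "R t y = (- (t \<bullet> s)) *\<^sub>R x + R (a *\<^sub>R t + cross3 t s) x"
          using xE by (simp add: R_simps R_R algebra_simps)
        then show ?thesis unfolding F_def by blast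
      qed
    qed
    show "F \<subseteq> E" using xE E R_in by (auto simp: F_def intro!: subspace_add subspace_mul)
    have "spans_at (U \<inter> F) F u" if u: "u \<in> S2" "u \<noteq> v" "u \<noteq> - v" for u
      unfolding spans_at_def
    proof
      fix y assume "y \<in> F"
      then obtain a t where y: "y = a *\<^sub>R x + R t x" by (auto simp: F_def)
      obtain b c d where t: "t = b *\<^sub>R v + c *\<^sub>R u + d *\<^sub>R cross3 v u" using S2_basis[OF v u(1)] u by blast
      have "y = ((a - d * (u \<bullet> v)) *\<^sub>R x + b *\<^sub>R R v x) + R u (c *\<^sub>R x - d *\<^sub>R R v x)"
        using xE cross_skew[of v u] by (simp add: y t R_simps R_R algebra_simps)
      moreover have "(a - d * (u \<bullet> v)) *\<^sub>R x + b *\<^sub>R R v x \<in> U \<inter> F" "c *\<^sub>R x - d *\<^sub>R R v x \<in> U \<inter> F"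
      proof -
        have "p *\<^sub>R x + q *\<^sub>R R v x \<in> U \<inter> F" for p q
        proof -
          have "p *\<^sub>R x + q *\<^sub>R R v x = p *\<^sub>R x + R (q *\<^sub>R v) x" by (simp add: R_simps)
          then have "p *\<^sub>R x + q *\<^sub>R R v x \<in> F" unfolding F_def by blast
          then show ?thesis using x by (simp add: subspace_add subspace_mul U)
        qed
        from this[of "a - d * (u \<bullet> v)" b] this[of c "- d"]
        show "(a - d * (u \<bullet> v)) *\<^sub>R x + b *\<^sub>R R v x \<in> U \<inter> F" "c *\<^sub>R x - d *\<^sub>R R v x \<in> U \<inter> F" by auto
      qed
      ultimately show "\<exists>a\<in>U \<inter> F. \<exists>b\<in>U \<inter> F. y = a + R u b" by blast
    qed
    then have "{u \<in> S2. \<not> spans_at (U \<inter> F) F u} \<subseteq> {v, - v}" by blast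
    then show "finite {u \<in> S2. \<not> spans_at (U \<inter> F) F u}" using finite_subset by blast
  qed
qed

text \<open>Let \<open>A\<close> be a generically spanned submodule of largest dimension.  The image of a morphism from \<open>A\<close> to the
quotient by \<open>A\<close> could be added to \<open>A\<close>, so it is zero, and \<open>A\<close> splits off.  If the complement had a complex
point, \<open>generically_spanned_line\<close> would enlarge \<open>A\<close>.\<close>

lemma split_generically_spanned:
  assumes U: "subspace U" "U \<subseteq> E"
  obtains A B where "generically_spanned U A" "stable_subspace R B" "complex_points (U \<inter> B) = {}"
    "direct_split E A B" "U \<subseteq> sum_space (U \<inter> A) (U \<inter> B)"
proof -
  have "generically_spanned U {0}"
    using subspace_0[OF U(1)] subspace_0[OF E]
    by (auto simp: generically_spanned_def stable_subspace_def R_simps spans_at_def)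
  then obtain A where A: "generically_spanned U A" "\<And>F. generically_spanned U F \<Longrightarrow> dim F \<le> dim A"
    using max_dim_subspace[of "generically_spanned U"] by blast
  have Ast: "stable_subspace R A" "A \<subseteq> E" "subspace A"
    using A(1) by (auto simp: generically_spanned_def stable_subspace_def)
  have max: "F = A" if "generically_spanned U F" "A \<subseteq> F" for F
    using that A(2)[OF that(1)] Ast subspace_dim_equal[of A F]
    by (auto simp: generically_spanned_def stable_subspace_def)
  obtain p where pr: "projection A p" using quaternionic_projection[OF Ast(1,2)] by blast
  then have p: "linear p" "\<And>x. x \<in> E \<Longrightarrow> p x \<in> A" "\<And>x. x \<in> A \<Longrightarrow> p x = x"
    "\<And>x t. x \<in> E \<Longrightarrow> p (R t x) = R t (p x)"
    by (auto simp: projection_def)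
  have hom: "\<forall>x\<in>A. g x = 0" if qg: "quotient_morphism U A p g" for g
  proof
    fix x assume x: "x \<in> A"
    have g: "linear g" "\<And>x. x \<in> A \<Longrightarrow> g x \<in> E \<and> p (g x) = 0"
      "\<And>x t. x \<in> A \<Longrightarrow> g (R t x) = R t (g x)" "\<And>x. x \<in> U \<inter> A \<Longrightarrow> \<exists>y\<in>U. g x = y - p y"
      using qg by (auto simp: quotient_morphism_def)
    define F where "F = sum_space A (g ` A)"
    have "stable_subspace R (g ` A)"
      using Ast linear_subspace_image[OF g(1)] g(3) unfolding stable_subspace_def by (auto simp: g(3)[symmetric])
    then have Fst: "stable_subspace R F" and AF: "A \<subseteq> F" "g ` A \<subseteq> F"
      using Ast(1) stable_sum_space sum_space_upper[of A "g ` A"] by (auto simp: F_def stable_subspace_def)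
    have FE: "F \<subseteq> E" using Ast(2) g(2) E by (auto simp: F_def sum_space_def intro: subspace_add)
    have subF: "subspace F" using Fst by (simp add: stable_subspace_def)
    have "spans_at (U \<inter> F) F v" if v: "spans_at (U \<inter> A) A v" for v
      unfolding spans_at_def
    proof
      fix y assume "y \<in> F"
      then obtain r r' where y: "y = r + g r'" "r \<in> A" "r' \<in> A" by (auto simp: F_def sum_space_def)
      obtain a b where ab: "a \<in> U \<inter> A" "b \<in> U \<inter> A" "r' = a + R v b" using spans_atD[OF v y(3)] by blast
      obtain a' b' where a': "a' \<in> U" "g a = a' - p a'" and b': "b' \<in> U" "g b = b' - p b'" using g(4) ab by meson
      have pA: "p a' \<in> A" "p b' \<in> A" using p(2) a' b' U by auto
      have "a' = p a' + g a" "b' = p b' + g b" using a' b' by auto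
      then have inF: "a' \<in> F" "b' \<in> F" using pA ab unfolding F_def by (metis IntD2 imageI sum_spaceI)+
      have "r - p a' - R v (p b') \<in> A" using y pA Ast by (auto simp: stable_subspace_def intro!: subspace_diff)
      then obtain c d where cd: "c \<in> U \<inter> A" "d \<in> U \<inter> A" "r - p a' - R v (p b') = c + R v d"
        using spans_atD[OF v] by blast
      have "y = r + (g a + R v (g b))" using y ab g(3) by (simp add: linear_add[OF g(1)])
      also have "\<dots> = (r - p a' - R v (p b')) + a' + R v b'" using a' b' by (simp add: R_simps)
      also have "\<dots> = (c + a') + R v (d + b')" by (simp add: cd R_simps)
      finally have "y = (c + a') + R v (d + b')" .
      moreover have "c + a' \<in> U \<inter> F" "d + b' \<in> U \<inter> F" using cd a' b' inF AF by (auto intro!: subspace_add U subF)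
      ultimately show "\<exists>a\<in>U \<inter> F. \<exists>b\<in>U \<inter> F. y = a + R v b" by blast
    qed
    then have "{v \<in> S2. \<not> spans_at (U \<inter> F) F v} \<subseteq> {v \<in> S2. \<not> spans_at (U \<inter> A) A v}" by blast
    then have "finite {v \<in> S2. \<not> spans_at (U \<inter> F) F v}"
      using A(1) by (auto simp: generically_spanned_def intro: finite_subset)
    then have "generically_spanned U F" using Fst FE by (simp add: generically_spanned_def)
    then have "g x \<in> A" using max AF x by blast
    then show "g x = 0" using p(3) g(2)[OF x] by metis
  qed
  obtain B where B: "stable_subspace R B" "direct_split E A B" "U \<subseteq> sum_space (U \<inter> A) (U \<inter> B)"
    using splitting[OF Ast(1,2) U pr hom] by blast
  have AB: "A \<inter> B = {0}" using B(2) by (simp add: direct_split_def)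
  have "complex_points (U \<inter> B) = {}"
  proof -
    have False if v: "v \<in> S2" "x \<in> U \<inter> B" "x \<noteq> 0" "R v x \<in> U" for v x
    proof -
      obtain F where F: "generically_spanned U F" "x \<in> F"
        using generically_spanned_line[OF U v(1), of x] v by blast
      have "F \<subseteq> sum_space A F" "A \<subseteq> sum_space A F"
        using F(1) Ast(3) sum_space_upper[of A F] by (auto simp: generically_spanned_def stable_subspace_def)
      then have "F \<subseteq> A" using max[OF generically_spanned_sum[OF U(1) A(1) F(1)]] by blast
      then show False using F(2) v AB by blast
    qed
    then show ?thesis by (auto simp: complex_points_def)
  qed
  then show ?thesis using that A(1) B by blast
qed

text \<open>Dually, let \<open>A\<close> be a submodule of smallest dimension for which the quotient generically has no complex
points.  The kernel of a morphism from \<open>A\<close> to the quotient by \<open>A\<close> again has this property, so the morphism is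
zero, and \<open>A\<close> splits off.  If \<open>D = (U \<inter> A) + R v (U \<inter> A)\<close> were a proper subspace of \<open>A\<close>, the largest
submodule \<open>K\<close> contained in \<open>D\<close> would have this property, too.\<close>

lemma split_generically_real:
  assumes U: "subspace U" "U \<subseteq> E"
  obtains A B where "stable_subspace R A" "\<And>v. v \<in> S2 \<Longrightarrow> spans_at (U \<inter> A) A v"
    "stable_subspace R B" "finite (complex_points (U \<inter> B))"
    "direct_split E A B" "U \<subseteq> sum_space (U \<inter> A) (U \<inter> B)"
proof -
  have "sum_space U E = E" using U E sum_space_upper(2)[OF U(1) E] by (auto simp: sum_space_def intro: subspace_add)
  then have "generically_real U E" using E R_in by (auto simp: generically_real_def stable_subspace_def)
  then obtain A where A: "generically_real U A" "\<And>F. generically_real U F \<Longrightarrow> dim A \<le> dim F"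
    using min_dim_subspace[of "generically_real U"] by blast
  have Ast: "stable_subspace R A" "A \<subseteq> E" "subspace A" and RA: "\<And>t x. x \<in> A \<Longrightarrow> R t x \<in> A"
    using A(1) by (auto simp: generically_real_def stable_subspace_def)
  have min: "F = A" if "generically_real U F" "F \<subseteq> A" for F
    using that A(2)[OF that(1)] Ast subspace_dim_equal[of F A]
    by (auto simp: generically_real_def stable_subspace_def)
  have UA: "U \<subseteq> sum_space U A" "A \<subseteq> sum_space U A" using sum_space_upper[OF U(1) Ast(3)] by auto
  have sUA: "subspace (sum_space U A)" using subspace_sum_space[OF U(1) Ast(3)] .
  obtain p where pr: "projection A p" using quaternionic_projection[OF Ast(1,2)] by blast
  then have p: "linear p" "\<And>x. x \<in> E \<Longrightarrow> p x \<in> A" "\<And>x. x \<in> A \<Longrightarrow> p x = x"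
    "\<And>x t. x \<in> E \<Longrightarrow> p (R t x) = R t (p x)"
    by (auto simp: projection_def)
  let ?bad = "{v \<in> S2. \<exists>x\<in>sum_space U A. R v x \<in> sum_space U A \<and> x \<notin> A}"
  have bad: "finite ?bad" using A(1) by (simp add: generically_real_def)
  have hom: "\<forall>x\<in>A. g x = 0" if qg: "quotient_morphism U A p g" for g
  proof
    fix x assume x: "x \<in> A"
    have g: "linear g" "\<And>x. x \<in> A \<Longrightarrow> g x \<in> E \<and> p (g x) = 0"
      "\<And>x t. x \<in> A \<Longrightarrow> g (R t x) = R t (g x)" "\<And>x. x \<in> U \<inter> A \<Longrightarrow> \<exists>y\<in>U. g x = y - p y"
      using qg by (auto simp: quotient_morphism_def)
    define K where "K = {x \<in> A. g x = 0}"
    have K: "stable_subspace R K" "K \<subseteq> E" "K \<subseteq> A" "subspace K"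
      using Ast g(3) unfolding stable_subspace_def K_def subspace_def
      by (auto simp: linear_add[OF g(1)] linear_scale[OF g(1)] linear_0[OF g(1)] R_simps)
    have "{v \<in> S2. \<exists>x\<in>sum_space U K. R v x \<in> sum_space U K \<and> x \<notin> K} \<subseteq> ?bad"
    proof (rule ccontr)
      assume "\<not> ?thesis"
      then obtain v x where v: "v \<in> S2" "x \<in> sum_space U K" "R v x \<in> sum_space U K" "x \<notin> K" "v \<notin> ?bad" by blast
      then obtain a k b k' where ab: "a \<in> U" "k \<in> K" "x = a + k" "b \<in> U" "k' \<in> K" "R v x = b + k'"
        by (auto simp: sum_space_def)
      have "x \<in> A" using v ab K(3) by (auto simp: sum_space_def)
      have "x - k \<in> A" "R v x - k' \<in> A" using \<open>x \<in> A\<close> RA ab(2,5) K(3) by (auto intro!: subspace_diff Ast(3))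
      then have abA: "a \<in> U \<inter> A" "b \<in> U \<inter> A" using ab by simp_all
      obtain a' b' where a': "a' \<in> U" "g a = a' - p a'" and b': "b' \<in> U" "g b = b' - p b'" using g(4) abA by meson
      have "g x = g a" "g (R v x) = g b" using ab by (auto simp: linear_add[OF g(1)] K_def)
      then have "R v (a' - p a') = b' - p b'" using g(3)[OF \<open>x \<in> A\<close>] a' b' by metis
      moreover have "y - p y \<in> sum_space U A" if "y \<in> U" for y
        using that UA p(2) U by (auto intro!: subspace_diff sUA)
      ultimately have "a' - p a' \<in> A" using v(1,5) a'(1) b'(1) by auto
      then have "g a = 0" using a'(2) p(3) g(2)[of a] abA by (metis IntD2)
      then show False using v(4) \<open>x \<in> A\<close> \<open>g x = g a\<close> by (simp add: K_def)
    qed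
    then have "finite {v \<in> S2. \<exists>x\<in>sum_space U K. R v x \<in> sum_space U K \<and> x \<notin> K}"
      using bad by (rule finite_subset)
    then have "generically_real U K" using K by (simp add: generically_real_def)
    then have "x \<in> K" using min K x by blast
    then show "g x = 0" by (simp add: K_def)
  qed
  obtain B where B: "stable_subspace R B" "direct_split E A B" "U \<subseteq> sum_space (U \<inter> A) (U \<inter> B)"
    using splitting[OF Ast(1,2) U pr hom] by blast
  have AB: "A \<inter> B = {0}" using B(2) by (simp add: direct_split_def)
  have "complex_points (U \<inter> B) \<subseteq> ?bad"
    using UA(1) AB by (fastforce simp: complex_points_def)
  then have "finite (complex_points (U \<inter> B))" using bad finite_subset by blast
  moreover have "spans_at (U \<inter> A) A v" if v: "v \<in> S2" for v
  proof -
    define D where "D = {a + R v b |a b. a \<in> U \<inter> A \<and> b \<in> U \<inter> A}"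
    have subUA: "subspace (U \<inter> A)" by (intro subspace_inter U Ast)
    have subD: "subspace D"
    proof -
      have "D = sum_space (U \<inter> A) (R v ` (U \<inter> A))" by (auto simp: D_def sum_space_def)
      then show ?thesis by (simp add: subspace_sum_space subUA linear_subspace_image[OF linear_R])
    qed
    have UD: "U \<inter> A \<subseteq> D"
    proof
      fix x assume "x \<in> U \<inter> A"
      moreover have "x = x + R v 0" by (simp add: R_simps)
      ultimately show "x \<in> D" unfolding D_def using subspace_0[OF subUA] by blast
    qed
    have DA: "D \<subseteq> A" using RA Ast(3) by (auto simp: D_def intro: subspace_add)
    have RvD: "R v x \<in> D" if "x \<in> D" for x
    proof -
      obtain a b where x: "x = a + R v b" "a \<in> U \<inter> A" "b \<in> U \<inter> A" using \<open>x \<in> D\<close> by (auto simp: D_def)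
      have "R v x = - b + R v a" using x v Ast by (simp add: R_simps R_unit subset_iff)
      moreover have "- b \<in> U \<inter> A" using x subspace_neg[OF subUA] by blast
      ultimately show ?thesis unfolding D_def using x by blast
    qed
    define K where "K = {x \<in> D. \<forall>t. R t x \<in> D}"
    have K: "stable_subspace R K" "K \<subseteq> A" "K \<subseteq> D"
    proof -
      have "R t (R s x) \<in> D" if "x \<in> K" for s t x
      proof -
        have "x \<in> E" "x \<in> D" "R (cross3 t s) x \<in> D" using that DA Ast(2) by (auto simp: K_def)
        then show ?thesis by (simp add: R_R subspace_diff subD subspace_mul)
      qed
      then show "stable_subspace R K"
        using subD unfolding stable_subspace_def subspace_def by (auto simp: K_def R_simps)
      show "K \<subseteq> A" "K \<subseteq> D" using DA by (auto simp: K_def)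
    qed
    have "{u \<in> S2. \<exists>x\<in>sum_space U K. R u x \<in> sum_space U K \<and> x \<notin> K} \<subseteq> ?bad \<union> {v, - v}"
    proof (rule ccontr)
      assume "\<not> ?thesis"
      then obtain u x where u: "u \<in> S2" "x \<in> sum_space U K" "R u x \<in> sum_space U K" "x \<notin> K" "u \<notin> ?bad" "u \<noteq> v" "u \<noteq> - v"
        by blast
      then obtain a k b k' where ab: "a \<in> U" "k \<in> K" "x = a + k" "b \<in> U" "k' \<in> K" "R u x = b + k'"
        by (auto simp: sum_space_def)
      have xA: "x \<in> A" using u ab K by (auto simp: sum_space_def)
      have "x - k \<in> A" "R u x - k' \<in> A" using xA RA ab(2,5) K(2) by (auto intro!: subspace_diff Ast(3))
      then have "a \<in> U \<inter> A" "b \<in> U \<inter> A" using ab by simp_all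
      then have xD: "x \<in> D" "R u x \<in> D" using ab K(3) UD by (auto intro!: subspace_add subD)
      (* D contains x, R v x, R u x and R v (R u x), which span the quaternionic line of x *)
      have "R (cross3 v u) x = R v (R u x) + (v \<bullet> u) *\<^sub>R x" using xA Ast(2) by (simp add: R_R subset_iff)
      then have cD: "R (cross3 v u) x \<in> D" using xD RvD by (auto intro!: subspace_add subspace_mul subD)
      have "R t x \<in> D" for t
      proof -
        obtain b c d where t: "t = b *\<^sub>R v + c *\<^sub>R u + d *\<^sub>R cross3 v u" using S2_basis[OF v u(1,6,7)] by blast
        show ?thesis using xD cD RvD by (auto simp: t R_simps intro!: subspace_add subspace_mul subD)
      qed
      then show False using u(4) xD by (simp add: K_def)
    qed
    moreover have "finite (?bad \<union> {v, - v})" using bad by simp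
    ultimately have "finite {u \<in> S2. \<exists>x\<in>sum_space U K. R u x \<in> sum_space U K \<and> x \<notin> K}" by (rule finite_subset)
    then have "generically_real U K" using K Ast(2) by (auto simp: generically_real_def)
    then have "A \<subseteq> D" using min K by blast
    then show ?thesis unfolding spans_at_def D_def by blast
  qed
  ultimately show ?thesis using that Ast(1) B by blast
qed

lemma spans_at_summand:
  assumes "spans_at U (sum_space A B) v" "stable_subspace R A" "stable_subspace R B" "A \<inter> B = {0}"
    "U \<subseteq> sum_space (U \<inter> A) (U \<inter> B)"
  shows "spans_at (U \<inter> B) B v"
  unfolding spans_at_def
proof
  have sub: "subspace A" "subspace B" using assms by (auto simp: stable_subspace_def)
  fix x assume x: "x \<in> B"
  then have "x \<in> sum_space A B" using sum_space_upper(2)[OF sub] by blast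
  then obtain a b where ab: "a \<in> U" "b \<in> U" "x = a + R v b" using spans_atD[OF assms(1)] by blast
  obtain a1 a2 where a: "a1 \<in> U \<inter> A" "a2 \<in> U \<inter> B" "a = a1 + a2" using ab assms(5) by (auto simp: sum_space_def)
  obtain b1 b2 where b: "b1 \<in> U \<inter> A" "b2 \<in> U \<inter> B" "b = b1 + b2" using ab assms(5) by (auto simp: sum_space_def)
  have "a1 + R v b1 = x - (a2 + R v b2)" using ab a b by (simp add: R_simps)
  moreover have "a1 + R v b1 \<in> A" using a b assms(2) by (auto simp: stable_subspace_def intro: subspace_add)
  moreover have "x - (a2 + R v b2) \<in> B" using x a b assms(3) by (auto simp: stable_subspace_def intro!: subspace_diff subspace_add)
  ultimately have "x - (a2 + R v b2) = 0" using assms(4) by (metis IntI singletonD)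
  then show "\<exists>a\<in>U \<inter> B. \<exists>b\<in>U \<inter> B. x = a + R v b" using a b by auto
qed

theorem decomposition_exists:
  assumes U: "subspace U" "U \<subseteq> E"
  obtains A B C where "stable_subspace R A" "stable_subspace R B" "stable_subspace R C"
    "direct_split E (sum_space A B) C" "direct_split (sum_space A B) A B"
    "U \<subseteq> sum_space (sum_space (U \<inter> A) (U \<inter> B)) (U \<inter> C)"
    "\<And>v. v \<in> S2 \<Longrightarrow> spans_at (U \<inter> A) A v"
    "finite (complex_points (U \<inter> B))" "finite {v \<in> S2. \<not> spans_at (U \<inter> B) B v}"
    "complex_points (U \<inter> C) = {}"
proof -
  obtain D C where D: "generically_spanned U D" and C: "stable_subspace R C" "complex_points (U \<inter> C) = {}"
    "direct_split E D C" "U \<subseteq> sum_space (U \<inter> D) (U \<inter> C)"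
    using split_generically_spanned[OF U] by blast
  have Dst: "stable_subspace R D" "D \<subseteq> E" "subspace D"
    using D by (auto simp: generically_spanned_def stable_subspace_def)
  interpret D: quat_module D R by (rule stable_quat_module[OF Dst(1,2)])
  have UD: "subspace (U \<inter> D)" "U \<inter> D \<subseteq> D" using U Dst by (auto intro: subspace_inter)
  obtain A B where AB: "stable_subspace R A" "\<And>v. v \<in> S2 \<Longrightarrow> spans_at (U \<inter> D \<inter> A) A v"
    "stable_subspace R B" "finite (complex_points (U \<inter> D \<inter> B))"
    "direct_split D A B" "U \<inter> D \<subseteq> sum_space (U \<inter> D \<inter> A) (U \<inter> D \<inter> B)"
    using D.split_generically_real[OF UD] by blast
  have sub: "A \<subseteq> D" "B \<subseteq> D" "U \<inter> D \<inter> A = U \<inter> A" "U \<inter> D \<inter> B = U \<inter> B" "A \<inter> B = {0}"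
    using AB(5) by (auto simp: direct_split_def)
  have DAB: "D = sum_space A B"
    using AB(5) Dst(3) by (auto simp: direct_split_def sum_space_def intro: subspace_add)
  show ?thesis
  proof
    show "direct_split E (sum_space A B) C" "direct_split (sum_space A B) A B" using C(3) AB(5) DAB by auto
    show "U \<subseteq> sum_space (sum_space (U \<inter> A) (U \<inter> B)) (U \<inter> C)"
    proof
      fix x assume "x \<in> U"
      then obtain d c where x: "x = d + c" "d \<in> U \<inter> D" "c \<in> U \<inter> C" using C(4) by (auto simp: sum_space_def)
      then have "d \<in> sum_space (U \<inter> A) (U \<inter> B)" using AB(6) sub by auto
      then show "x \<in> sum_space (sum_space (U \<inter> A) (U \<inter> B)) (U \<inter> C)" using x sum_spaceI by metis
    qed
    have "{v \<in> S2. \<not> spans_at (U \<inter> B) B v} \<subseteq> {v \<in> S2. \<not> spans_at (U \<inter> D) D v}"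
    proof -
      have "spans_at (U \<inter> D \<inter> B) B v" if "spans_at (U \<inter> D) D v" for v
        using spans_at_summand[of "U \<inter> D" A B v] that AB sub DAB by auto
      then show ?thesis using sub by auto
    qed
    then show "finite {v \<in> S2. \<not> spans_at (U \<inter> B) B v}"
      using D by (auto simp: generically_spanned_def intro: finite_subset)
  qed (use AB C sub in auto)
qed

end

section \<open>Vanishing of morphisms and uniqueness\<close>

lemma projection_along:
  fixes A B :: "'a::euclidean_space set"
  assumes "subspace A" "subspace B" "A \<inter> B = {0}"
  shows "\<exists>p. linear p \<and> (\<forall>x\<in>A. p x = 0) \<and> (\<forall>x\<in>B. p x = x)"
proof -
  have "inj_on (perp A) B"
    using assms linear_inj_on_iff_eq_0[OF linear_perp[OF assms(1)] assms(2)] perp_eq_0_iff[OF assms(1)] by blast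
  then obtain g where g: "linear g" "\<And>x. x \<in> B \<Longrightarrow> g (perp A x) = x"
    using linear_exists_left_inverse_on[OF linear_perp[OF assms(1)] assms(2)] by auto
  have "linear (g \<circ> perp A)" by (rule linear_compose[OF linear_perp[OF assms(1)] g(1)])
  moreover have "(g \<circ> perp A) x = 0" if "x \<in> A" for x
    using perp_eq_0_iff[OF assms(1), THEN iffD2, OF that] linear_0[OF g(1)] by simp
  ultimately show ?thesis using g(2) by (intro exI[of _ "g \<circ> perp A"]) auto
qed

lemma sum_space_unique:
  assumes "subspace A" "subspace B" "A \<inter> B = {0}" "a \<in> A" "a' \<in> A" "b \<in> B" "b' \<in> B" "a + b = a' + b'"
  shows "a = a'" "b = b'"
proof -
  have "a - a' \<in> A" using assms by (simp add: subspace_diff)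
  moreover have "b' - b \<in> B" using assms by (simp add: subspace_diff)
  moreover have eq: "a - a' = b' - b" using assms(8) by (simp add: algebra_simps)
  ultimately have "a - a' \<in> A \<inter> B" by simp
  then have "a - a' = 0" using assms(3) by blast
  then show "a = a'" "b = b'" using eq by auto
qed

context quat_module
begin

text \<open>The sum \<open>V + R v V\<close> is \<open>F\<close>.\<close>

lemma dim_complex_span:
  assumes V: "subspace V" "V \<subseteq> F" and F: "stable_subspace R F" "F \<subseteq> E" and v: "v \<in> S2" "spans_at V F v"
  shows "dim F + dim (V \<inter> R v ` V) = 2 * dim V"
proof -
  have "F = {x + y |x y. x \<in> V \<and> y \<in> R v ` V}"
  proof
    show "F \<subseteq> {x + y |x y. x \<in> V \<and> y \<in> R v ` V}" using spans_atD[OF v(2)] by blast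
    show "{x + y |x y. x \<in> V \<and> y \<in> R v ` V} \<subseteq> F"
      using F V(2) by (auto simp: stable_subspace_def intro!: subspace_add)
  qed
  moreover have "inj_on (R v) (span V)"
  proof -
    have "span V = V" using V(1) by (rule span_eq_iff[THEN iffD2])
    have nz: "v \<noteq> 0" using v(1) by (auto simp: S2_def)
    have "\<forall>x\<in>V. R v x = 0 \<longrightarrow> x = 0"
      using R_eq_0[OF _ _ nz] V(2) F(2) by blast
    then show ?thesis using linear_inj_on_iff_eq_0[OF linear_R V(1), of v] \<open>span V = V\<close> by (simp only: \<open>span V = V\<close>)
  qed
  then have "dim (R v ` V) = dim V" by (intro dim_image_eq linear_R)
  ultimately show ?thesis
    using dim_sums_Int[OF V(1) linear_subspace_image[OF linear_R V(1)], of v] by simp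
qed

lemma real_at_spanned_point:
  assumes V: "subspace V" "V \<subseteq> F" and F: "stable_subspace R F" "F \<subseteq> E"
    and w: "w \<in> S2" "spans_at V F w" "w \<notin> complex_points V" and v: "v \<in> S2" "spans_at V F v"
  shows "v \<notin> complex_points V"
proof -
  have "V \<inter> R w ` V \<subseteq> {0}" using w R_simps by (auto simp: complex_points_def)
  then have "dim (V \<inter> R w ` V) = 0" by (simp only: dim_eq_0)
  then have "dim (V \<inter> R v ` V) = 0"
    using dim_complex_span[OF V F w(1,2)] dim_complex_span[OF V F v] by linarith
  then have *: "V \<inter> R v ` V \<subseteq> {0}" by (simp only: dim_eq_0)
  show ?thesis
  proof
    assume "v \<in> complex_points V"
    then obtain x where x: "x \<in> V" "x \<noteq> 0" "R v x \<in> V" by (auto simp: complex_points_def)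
    then have "R v x = 0" using * by blast
    moreover have "x \<in> E" "v \<noteq> 0" using x V F v(1) by (auto simp: S2_def)
    ultimately show False using x R_eq_0 by blast
  qed
qed

text \<open>In the first case \<open>W\<close> spans \<open>G\<close> as in a CR pair and \<open>V\<close> has as few complex points as in a torsion or co-CR pair; in
the second case \<open>W\<close> spans \<open>G\<close> as in a torsion pair and \<open>V\<close> is as in a co-CR pair.\<close>

definition incompatible :: "'a set \<Rightarrow> 'a set \<Rightarrow> 'a set \<Rightarrow> bool" where
  "incompatible W G V \<longleftrightarrow> (\<forall>v\<in>S2. spans_at W G v) \<and> (\<exists>v\<in>S2. v \<notin> complex_points V) \<or>
     (\<exists>v\<in>S2. spans_at W G v) \<and> complex_points V = {}"

text \<open>In both cases \<open>V\<close> is half of \<open>F\<close>, so that being spanned and not being complex are equivalent at each point.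
By \<open>complex_points_nonempty\<close> there is a complex point unless \<open>F = 0\<close>; this excludes each of the two cases.\<close>

lemma incompatible_zero:
  assumes V: "subspace V" "V \<subseteq> F" and F: "stable_subspace R F" "F \<subseteq> E" and "incompatible V F V"
  shows "F = {0}"
proof (rule ccontr)
  assume "F \<noteq> {0}"
  interpret F: quat_module F R by (rule stable_quat_module[OF F])
  obtain w where w: "w \<in> S2" "spans_at V F w" "w \<notin> complex_points V"
    using assms(5) by (auto simp: incompatible_def)
  then have ne: "complex_points V \<noteq> {}" using F.complex_points_nonempty[OF V w(1,3,2) \<open>F \<noteq> {0}\<close>] by simp
  then have "\<forall>v\<in>S2. spans_at V F v" using assms(5) by (auto simp: incompatible_def)
  then have "complex_points V = {}"
    using real_at_spanned_point[OF V F w] by (auto simp: complex_points_def)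
  then show False using ne by simp
qed

text \<open>The projection of \<open>G\<close> to \<open>B\<close> along \<open>A\<close>, with the image of \<open>W\<close> as real subspace, is zero by \<open>incompatible_zero\<close>.\<close>

lemma component_vanishes:
  assumes A: "stable_subspace R A" and B: "stable_subspace R B" "B \<subseteq> E" and AB: "A \<inter> B = {0}"
    and G: "stable_subspace R G" "G \<subseteq> sum_space A B"
    and W: "subspace W" "W \<subseteq> G" "W \<subseteq> sum_space (U \<inter> A) (U \<inter> B)"
    and inc: "incompatible W G (U \<inter> B)"
  shows "G \<subseteq> A"
proof -
  have sub: "subspace A" "subspace B" "subspace G" using A B G by (auto simp: stable_subspace_def)
  note unique = sum_space_unique[OF sub(1,2) AB]
  define pB where "pB X = {b \<in> B. \<exists>a\<in>A. a + b \<in> X}" for X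
  have subpB: "subspace (pB X)" if "subspace X" for X
  proof -
    have "pB X = B \<inter> sum_space A X"
    proof -
      have "b \<in> sum_space A X" if "a \<in> A" "a + b \<in> X" for a b
        using sum_spaceI[of "- a" A "a + b" X] that subspace_neg[OF sub(1)] by auto
      moreover have "\<exists>a\<in>A. a + b \<in> X" if "b \<in> sum_space A X" for b
      proof -
        obtain a x where "b = a + x" "a \<in> A" "x \<in> X" using \<open>b \<in> sum_space A X\<close> by (auto simp: sum_space_def)
        then show ?thesis using subspace_neg[OF sub(1)] by (intro bexI[of _ "- a"]) auto
      qed
      ultimately show ?thesis by (auto simp: pB_def)
    qed
    then show ?thesis using subspace_sum_space[OF sub(1) that] by (simp add: subspace_inter sub)
  qed
  have F: "stable_subspace R (pB G)"
  proof -
    have "R t b \<in> pB G" if b: "b \<in> pB G" for t b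
    proof -
      obtain a where "a \<in> A" "a + b \<in> G" "b \<in> B" using b by (auto simp: pB_def)
      then have "R t a \<in> A" "R t b \<in> B" "R t (a + b) \<in> G"
        using A B G unfolding stable_subspace_def by blast+
      then have "R t a \<in> A" "R t b \<in> B" "R t a + R t b \<in> G" by (simp_all add: R_simps)
      then show ?thesis by (auto simp: pB_def)
    qed
    then show ?thesis using subpB[OF sub(3)] by (simp add: stable_subspace_def)
  qed
  have VU: "pB W \<subseteq> U \<inter> B"
  proof
    fix b assume "b \<in> pB W"
    then obtain a where a: "a \<in> A" "b \<in> B" "a + b \<in> W" by (auto simp: pB_def)
    then obtain a' b' where "a + b = a' + b'" "a' \<in> U \<inter> A" "b' \<in> U \<inter> B" using W(3) by (auto simp: sum_space_def)
    then show "b \<in> U \<inter> B" using unique(2)[of a a' b b'] a by auto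
  qed
  have spans: "spans_at (pB W) (pB G) v" if v: "spans_at W G v" for v
    unfolding spans_at_def
  proof
    fix b assume "b \<in> pB G"
    then obtain a where a: "a \<in> A" "b \<in> B" "a + b \<in> G" by (auto simp: pB_def)
    then obtain x y where xy: "x \<in> W" "y \<in> W" "a + b = x + R v y" using spans_atD[OF v] by blast
    obtain x1 x2 where x: "x = x1 + x2" "x1 \<in> U \<inter> A" "x2 \<in> U \<inter> B" using xy W(3) by (auto simp: sum_space_def)
    obtain y1 y2 where y: "y = y1 + y2" "y1 \<in> U \<inter> A" "y2 \<in> U \<inter> B" using xy W(3) by (auto simp: sum_space_def)
    have "a + b = (x1 + R v y1) + (x2 + R v y2)" using xy x y by (simp add: R_simps)
    moreover have "x1 + R v y1 \<in> A" "x2 + R v y2 \<in> B"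
      using x y A B by (auto simp: stable_subspace_def intro: subspace_add)
    ultimately have "b = x2 + R v y2" using unique(2) a by metis
    moreover have "x2 \<in> pB W" "y2 \<in> pB W" using x y xy by (auto simp: pB_def)
    ultimately show "\<exists>a\<in>pB W. \<exists>c\<in>pB W. b = a + R v c" by blast
  qed
  have "complex_points (pB W) \<subseteq> complex_points (U \<inter> B)" using VU unfolding complex_points_def by blast
  then have "incompatible (pB W) (pB G) (pB W)" using inc spans unfolding incompatible_def by blast
  moreover have "pB W \<subseteq> pB G" "pB G \<subseteq> E" using W(2) B(2) by (auto simp: pB_def)
  ultimately have "pB G = {0}" using incompatible_zero[OF subpB[OF W(1)] _ F] by blast
  show ?thesis
  proof
    fix x assume x: "x \<in> G"
    then obtain a b where ab: "x = a + b" "a \<in> A" "b \<in> B" using G(2) by (auto simp: sum_space_def)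
    then have "b \<in> pB G" using x by (auto simp: pB_def)
    then show "x \<in> A" using ab \<open>pB G = {0}\<close> by simp
  qed
qed

lemma complement_iso:
  assumes A: "stable_subspace R A" and B: "stable_subspace R B" and C: "stable_subspace R C"
    and AB: "A \<inter> B = {0}" and AC: "A \<inter> C = {0}" and sum_eq: "sum_space A B = sum_space A C"
    and UB: "U \<inter> sum_space A B \<subseteq> sum_space (U \<inter> A) (U \<inter> B)"
    and UC: "U \<inter> sum_space A C \<subseteq> sum_space (U \<inter> A) (U \<inter> C)"
  obtains p where "linear p" "inj_on p B" "p ` B = C" "p ` (U \<inter> B) = U \<inter> C"
    "\<And>t x. x \<in> B \<Longrightarrow> p (R t x) = R t (p x)"
proof -
  have sub: "subspace A" "subspace B" "subspace C" using A B C by (auto simp: stable_subspace_def)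
  obtain p where p: "linear p" "\<And>x. x \<in> A \<Longrightarrow> p x = 0" "\<And>x. x \<in> C \<Longrightarrow> p x = x"
    using projection_along[OF sub(1,3) AC] by blast
  have to: "\<exists>a\<in>A. b = a + p b \<and> p b \<in> C" if "b \<in> B" for b
  proof -
    have "b \<in> sum_space A C" using that sum_space_upper(2)[OF sub(1,2)] sum_eq by blast
    then obtain a c where "b = a + c" "a \<in> A" "c \<in> C" by (auto simp: sum_space_def)
    then show ?thesis by (auto simp: linear_add[OF p(1)] p)
  qed
  have lift: "\<exists>b\<in>X. p b = c" if "c \<in> C" "c \<in> sum_space A X" for c X
  proof -
    obtain a b where "c = a + b" "a \<in> A" "b \<in> X" using \<open>c \<in> sum_space A X\<close> by (auto simp: sum_space_def)
    then show ?thesis using p(3)[OF \<open>c \<in> C\<close>] p(2) by (auto simp: linear_add[OF p(1)])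
  qed
  have CU: "U \<inter> C \<subseteq> sum_space A (U \<inter> B)"
  proof
    fix c assume c: "c \<in> U \<inter> C"
    then have "c \<in> U \<inter> sum_space A B" using sum_eq sum_space_upper(2)[OF sub(1,3)] by blast
    then have "c \<in> sum_space (U \<inter> A) (U \<inter> B)" using UB by blast
    then show "c \<in> sum_space A (U \<inter> B)" unfolding sum_space_def by blast
  qed
  have "U \<inter> B \<subseteq> sum_space A (U \<inter> C)"
  proof
    fix c assume c: "c \<in> U \<inter> B"
    then have "c \<in> U \<inter> sum_space A C" using sum_eq sum_space_upper(2)[OF sub(1,2)] by blast
    then have "c \<in> sum_space (U \<inter> A) (U \<inter> C)" using UC by blast
    then show "c \<in> sum_space A (U \<inter> C)" unfolding sum_space_def by blast
  qed
  then have toU: "p b \<in> U \<inter> C" if "b \<in> U \<inter> B" for b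
  proof -
    obtain a c where "b = a + c" "a \<in> A" "c \<in> U \<inter> C"
      using \<open>U \<inter> B \<subseteq> sum_space A (U \<inter> C)\<close> \<open>b \<in> U \<inter> B\<close> by (auto simp: sum_space_def)
    then show ?thesis by (auto simp: linear_add[OF p(1)] p)
  qed
  show ?thesis
  proof
    show "linear p" by fact
    have "x = 0" if "x \<in> B" "p x = 0" for x using to[OF that(1)] that AB by auto
    then show "inj_on p B" using linear_inj_on_iff_eq_0[OF p(1) sub(2)] by blast
    show "p ` B = C"
    proof
      show "p ` B \<subseteq> C" using to by blast
      show "C \<subseteq> p ` B"
      proof
        fix c assume "c \<in> C"
        then obtain b where "b \<in> B" "p b = c" using lift[of c B] sum_space_upper(2)[OF sub(1,3)] sum_eq by blast
        then show "c \<in> p ` B" by blast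
      qed
    qed
    show "p ` (U \<inter> B) = U \<inter> C"
    proof
      show "p ` (U \<inter> B) \<subseteq> U \<inter> C" using toU by blast
      show "U \<inter> C \<subseteq> p ` (U \<inter> B)"
      proof
        fix c assume "c \<in> U \<inter> C"
        then obtain b where "b \<in> U \<inter> B" "p b = c" using lift[of c "U \<inter> B"] CU by blast
        then show "c \<in> p ` (U \<inter> B)" by blast
      qed
    qed
    show "p (R t x) = R t (p x)" if "x \<in> B" for t x
    proof -
      obtain a where a: "a \<in> A" "x = a + p x" "p x \<in> C" using to[OF \<open>x \<in> B\<close>] by blast
      have "R t x = R t a + R t (p x)" using a(2) by (metis R_simps(2))
      moreover have "R t a \<in> A" "R t (p x) \<in> C" using a A C by (auto simp: stable_subspace_def)
      ultimately show ?thesis using p by (simp add: linear_add[OF p(1)])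
    qed
  qed
qed

definition split3 :: "'a set \<Rightarrow> 'a set \<Rightarrow> 'a set \<Rightarrow> 'a set \<Rightarrow> bool" where
  "split3 U A B C \<longleftrightarrow> stable_subspace R A \<and> stable_subspace R B \<and> stable_subspace R C \<and>
     direct_split E (sum_space A B) C \<and> direct_split (sum_space A B) A B \<and>
     U \<subseteq> sum_space (sum_space (U \<inter> A) (U \<inter> B)) (U \<inter> C) \<and>
     (\<forall>v\<in>S2. spans_at (U \<inter> A) A v) \<and>
     (\<exists>v\<in>S2. spans_at (U \<inter> B) B v \<and> v \<notin> complex_points (U \<inter> B)) \<and> complex_points (U \<inter> C) = {}"

lemma split3D:
  assumes U: "subspace U" "U \<subseteq> E" and s: "split3 U A B C"
  shows "stable_subspace R (sum_space A B)" "sum_space A B \<inter> C = {0}" "A \<inter> B = {0}" "sum_space (sum_space A B) C = E"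
    "A \<subseteq> E" "B \<subseteq> E" "C \<subseteq> E"
    "U \<subseteq> sum_space (U \<inter> sum_space A B) (U \<inter> C)" "U \<inter> sum_space A B \<subseteq> sum_space (U \<inter> A) (U \<inter> B)"
proof -
  have st: "stable_subspace R A" "stable_subspace R B" "stable_subspace R C"
    and ds: "direct_split E (sum_space A B) C" "direct_split (sum_space A B) A B"
    and Us: "U \<subseteq> sum_space (sum_space (U \<inter> A) (U \<inter> B)) (U \<inter> C)"
    using s unfolding split3_def by blast+
  have sub: "subspace A" "subspace B" "subspace C" using st by (simp_all add: stable_subspace_def)
  have subAB: "subspace (sum_space A B)" using sub by (simp add: subspace_sum_space)
  show "stable_subspace R (sum_space A B)" by (rule stable_sum_space[OF st(1,2)])
  show AB0: "sum_space A B \<inter> C = {0}" "A \<inter> B = {0}" using ds unfolding direct_split_def by blast+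
  have ABE: "sum_space A B \<subseteq> E" "C \<subseteq> E" "E \<subseteq> sum_space (sum_space A B) C" using ds(1) unfolding direct_split_def by blast+
  show "C \<subseteq> E" by fact
  show "A \<subseteq> E" "B \<subseteq> E" using ABE(1) sum_space_upper[OF sub(1,2)] by blast+
  show "sum_space (sum_space A B) C = E"
  proof
    show "sum_space (sum_space A B) C \<subseteq> E"
      using ABE E unfolding sum_space_def[of "sum_space A B"] by (auto intro!: subspace_add)
  qed (rule ABE)
  have inc: "sum_space (U \<inter> A) (U \<inter> B) \<subseteq> U \<inter> sum_space A B"
    using U(1) by (auto simp: sum_space_def intro: subspace_add)
  show "U \<subseteq> sum_space (U \<inter> sum_space A B) (U \<inter> C)"
    using Us inc unfolding sum_space_def[of _ "U \<inter> C"] by blast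
  show "U \<inter> sum_space A B \<subseteq> sum_space (U \<inter> A) (U \<inter> B)"
  proof
    fix x assume x: "x \<in> U \<inter> sum_space A B"
    then obtain d c where d: "x = d + c" "d \<in> sum_space (U \<inter> A) (U \<inter> B)" "c \<in> U \<inter> C"
      using Us unfolding sum_space_def[of _ "U \<inter> C"] by blast
    have "x = d"
    proof (rule sum_space_unique(1)[OF subAB sub(3) AB0(1)])
      show "x + 0 = d + c" using d by simp
    qed (use x d inc subspace_0[OF sub(3)] in blast)+
    then show "x \<in> sum_space (U \<inter> A) (U \<inter> B)" using d by simp
  qed
qed

lemma split3D_points:
  assumes "split3 U A B C"
  shows "\<forall>v\<in>S2. spans_at (U \<inter> A) A v" "\<exists>v\<in>S2. spans_at (U \<inter> B) B v" "\<exists>v\<in>S2. v \<notin> complex_points (U \<inter> B)"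
    "complex_points (U \<inter> C) = {}"
  using assms unfolding split3_def by blast+

lemma split3_le:
  assumes U: "subspace U" "U \<subseteq> E" and s: "split3 U A B C" and s': "split3 U A' B' C'"
  shows "A \<subseteq> A'" "sum_space A B \<subseteq> sum_space A' B'"
proof -
  note d = split3D[OF U s] and d' = split3D[OF U s']
  have st: "stable_subspace R A" "stable_subspace R B" "stable_subspace R A'" "stable_subspace R B'" "stable_subspace R C'"
    using s s' by (auto simp: split3_def)
  have sub: "subspace A" "subspace B" "subspace (sum_space A' B')" "subspace (U \<inter> A)" "subspace (U \<inter> B)"
    using st U d'(1) by (auto simp: stable_subspace_def subspace_inter)
  have "\<exists>v. v \<in> S2" using split3D_points(2)[OF s] by blast
  note c = split3D_points[OF s] split3D_points[OF s'] this
  have UAB: "U \<inter> A \<subseteq> sum_space (U \<inter> sum_space A' B') (U \<inter> C')" "U \<inter> B \<subseteq> sum_space (U \<inter> sum_space A' B') (U \<inter> C')"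
    using d'(8) by blast+
  have inc: "incompatible (U \<inter> A) A (U \<inter> C')" "incompatible (U \<inter> B) B (U \<inter> C')" "incompatible (U \<inter> A) A (U \<inter> B')"
    unfolding incompatible_def using c by blast+
  have GE: "A \<subseteq> sum_space (sum_space A' B') C'" "B \<subseteq> sum_space (sum_space A' B') C'" using d(5,6) d'(4) by simp_all
  have A: "A \<subseteq> sum_space A' B'"
    by (rule component_vanishes[OF d'(1) st(5) d'(7,2) st(1) GE(1) sub(4) _ UAB(1) inc(1)]) blast
  have B: "B \<subseteq> sum_space A' B'"
    by (rule component_vanishes[OF d'(1) st(5) d'(7,2) st(2) GE(2) sub(5) _ UAB(2) inc(2)]) blast
  show "sum_space A B \<subseteq> sum_space A' B'"
    using A B sub(3) by (auto simp: sum_space_def[of A B] intro: subspace_add)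
  show "A \<subseteq> A'"
  proof (rule component_vanishes[OF st(3,4) d'(6,3) st(1) A sub(4) _ _ inc(3)])
    show "U \<inter> A \<subseteq> sum_space (U \<inter> A') (U \<inter> B')" using A d'(9) by blast
  qed blast
qed

end

section \<open>Pairs as quaternionic modules\<close>

text \<open>The action is extended to the ambient space by the orthogonal projection to \<open>Car P\<close>, since nothing is
known about \<open>Rep P\<close> outside \<open>Car P\<close>.\<close>

definition act :: "('a::euclidean_space, 'm) qspace_scheme \<Rightarrow> real^3 \<Rightarrow> 'a \<Rightarrow> 'a" where
  "act P t x = Rep P (0, t) (x - perp (Car P) x)"

lemma act_in_Car:
  assumes "is_qspace P" "x \<in> Car P" shows "act P t x = Rep P (0, t) x"
  using assms perp_eq_0_iff[of "Car P" x] by (simp add: act_def is_qspace_def)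

lemma qspace_module: assumes "is_qspace P" shows "quat_module (Car P) (act P)"
proof -
  have S: "subspace (Car P)" and h: "hypercomplex (Car P) (Rep P)" using assms by (auto simp: is_qspace_def)
  have pr: "x - perp (Car P) x \<in> Car P" for x using perp(2)[OF S] .
  have lin: "linear (Rep P q)" "\<And>x. x \<in> Car P \<Longrightarrow> linear (\<lambda>q. Rep P q x)"
    "\<And>x. x \<in> Car P \<Longrightarrow> Rep P q x \<in> Car P"
    "\<And>x. x \<in> Car P \<Longrightarrow> Rep P qone x = x" 
    "\<And>p x. x \<in> Car P \<Longrightarrow> Rep P (qmult p q) x = Rep P p (Rep P q x)" for q
    using h unfolding hypercomplex_def by blast+
  show ?thesis
  proof
    show "subspace (Car P)" by fact
    show "bilinear (act P)"
      unfolding bilinear_def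
    proof (intro conjI allI)
      show "linear (act P t)" for t
      proof -
        have "linear (\<lambda>x. x - perp (Car P) x)" by (intro linear_compose_sub linear_ident linear_perp S)
        from linear_compose[OF this lin(1)] show ?thesis unfolding act_def by (simp add: o_def)
      qed
      show "linear (\<lambda>t. act P t x)" for x
      proof (rule linearI)
        show "act P (s + t) x = act P s x + act P t x" for s t
          using linear_add[OF lin(2)[OF pr], of "(0, s)" "(0, t)"] by (simp add: act_def)
        show "act P (r *\<^sub>R t) x = r *\<^sub>R act P t x" for r t
          using linear_scale[OF lin(2)[OF pr], of r "(0, t)"] by (simp add: act_def)
      qed
    qed
    show "act P t x \<in> Car P" if "x \<in> Car P" for t x using lin(3)[OF pr] by (simp add: act_def)
    show "act P s (act P t x) = act P (cross3 s t) x - (s \<bullet> t) *\<^sub>R x" if x: "x \<in> Car P" for s t x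
    proof -
      have "qmult (0, s) (0, t) = (0, cross3 s t) - (s \<bullet> t) *\<^sub>R qone" by (simp add: qmult_def qone_def)
      then have "Rep P (0, s) (Rep P (0, t) x) = Rep P ((0, cross3 s t) - (s \<bullet> t) *\<^sub>R qone) x"
        using lin(5)[OF x, of "(0, s)" "(0, t)"] by simp
      also have "\<dots> = Rep P (0, cross3 s t) x - (s \<bullet> t) *\<^sub>R x"
        using linear_diff[OF lin(2)[OF x], of "(0, cross3 s t)" "(s \<bullet> t) *\<^sub>R qone"]
          linear_scale[OF lin(2)[OF x], of "s \<bullet> t" qone] lin(4)[OF x] by simp
      finally show ?thesis using x lin(3)[OF x] by (simp add: act_in_Car[OF assms])
    qed
  qed
qed

lemma Rep_act:
  assumes "is_qspace P" "x \<in> Car P" shows "Rep P (a, t) x = a *\<^sub>R x + act P t x"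
proof -
  have l: "linear (\<lambda>q. Rep P q x)" "Rep P qone x = x" using assms by (auto simp: is_qspace_def hypercomplex_def)
  have "(a, t) = a *\<^sub>R qone + (0, t)" by (simp add: qone_def)
  then have "Rep P (a, t) x = a *\<^sub>R Rep P qone x + Rep P (0, t) x"
    using linear_add[OF l(1), of "a *\<^sub>R qone" "(0, t)"] linear_scale[OF l(1), of a qone] by simp
  then show ?thesis using l act_in_Car[OF assms] by simp
qed

lemma hypercomplexI:
  assumes "\<And>q. linear (\<rho> q)" "quat_module E R" "\<And>x a t. x \<in> E \<Longrightarrow> \<rho> (a, t) x = a *\<^sub>R x + R t x"
  shows "hypercomplex E \<rho>"
proof -
  interpret quat_module E R by fact
  have in_E: "\<rho> q x \<in> E" if "x \<in> E" for q x
    using that by (cases q) (auto simp: assms(3) intro: subspace_add subspace_mul E R_in)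
  show ?thesis
    unfolding hypercomplex_def
  proof (intro conjI allI ballI)
    show "linear (\<rho> q)" for q by fact
    show "\<rho> q ` E \<subseteq> E" for q using in_E by blast
    show "linear (\<lambda>q. \<rho> q x)" if "x \<in> E" for x
      using that by (intro linearI) (auto simp: assms(3) R_simps algebra_simps)
    show "\<rho> qone x = x" if "x \<in> E" for x using that by (simp add: qone_def assms(3) R_simps)
    show "\<rho> (qmult p q) x = \<rho> p (\<rho> q x)" if "x \<in> E" for p q x
      using that in_E[OF that, of q]
      by (cases p; cases q) (simp add: qmult_def assms(3) R_simps R_R algebra_simps subspace_add[OF E] subspace_mul[OF E] R_in)
  qed
qed

section \<open>Isomorphisms of pairs\<close>

lemma quaternionic_linear_iff:
  assumes "is_qspace P" "is_qspace P'"
  shows "quaternionic_linear P P' t \<longleftrightarrow> linear t \<and> t ` Car P \<subseteq> Car P' \<and>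
    (\<forall>u\<in>S2. \<exists>v\<in>S2. \<forall>x\<in>Car P. t (act P u x) = act P' v (t x))"
proof -
  have *: "(\<forall>u\<in>S2. \<exists>v\<in>S2. \<forall>x\<in>Car P. t (Rep P (0, u) x) = Rep P' (0, v) (t x)) \<longleftrightarrow>
      (\<forall>u\<in>S2. \<exists>v\<in>S2. \<forall>x\<in>Car P. t (act P u x) = act P' v (t x))"
    if "t ` Car P \<subseteq> Car P'"
  proof -
    have "t (Rep P (0, u) x) = t (act P u x)" "Rep P' (0, v) (t x) = act P' v (t x)" if "x \<in> Car P" for u v x
      using that \<open>t ` Car P \<subseteq> Car P'\<close> act_in_Car[OF assms(1)] act_in_Car[OF assms(2)] by auto
    then show ?thesis by simp
  qed
  have "(\<exists>T. \<forall>J\<in>admissible P. T J \<in> admissible P' \<and> (\<forall>x\<in>Car P. t (J x) = T J (t x))) \<longleftrightarrow>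
      (\<forall>J\<in>admissible P. \<exists>J'. J' \<in> admissible P' \<and> (\<forall>x\<in>Car P. t (J x) = J' (t x)))"
    by (rule bchoice_iff[symmetric])
  also have "\<dots> \<longleftrightarrow> (\<forall>u\<in>S2. \<exists>v\<in>S2. \<forall>x\<in>Car P. t (Rep P (0, u) x) = Rep P' (0, v) (t x))"
    unfolding admissible_def by blast
  finally show ?thesis using * unfolding quaternionic_linear_def by blast
qed

text \<open>An explicit form of \<open>pair_isomorphism\<close>: the correspondence between admissible structures is recorded by
points of the sphere, in both directions, and no inverse map is mentioned.\<close>

definition iso_of_pairs :: "'a::euclidean_space qpair \<Rightarrow> 'b::euclidean_space qpair \<Rightarrow> ('a \<Rightarrow> 'b) \<Rightarrow> bool" where
  "iso_of_pairs P P' t \<longleftrightarrow> linear t \<and> inj_on t (Car P) \<and> t ` Car P = Car P' \<and> t ` Sub P = Sub P' \<and>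
     (\<forall>u\<in>S2. \<exists>v\<in>S2. \<forall>x\<in>Car P. t (act P u x) = act P' v (t x)) \<and>
     (\<forall>v\<in>S2. \<exists>u\<in>S2. \<forall>x\<in>Car P. t (act P u x) = act P' v (t x))"

lemma iso_of_pairsD:
  assumes "iso_of_pairs P P' t"
  shows "linear t" "inj_on t (Car P)" "t ` Car P = Car P'" "t ` Sub P = Sub P'"
    "u \<in> S2 \<Longrightarrow> \<exists>v\<in>S2. \<forall>x\<in>Car P. t (act P u x) = act P' v (t x)"
    "v \<in> S2 \<Longrightarrow> \<exists>u\<in>S2. \<forall>x\<in>Car P. t (act P u x) = act P' v (t x)"
  using assms unfolding iso_of_pairs_def by - (elim conjE, (assumption | (erule bspec, assumption)))+

lemma pair_morphismD:
  assumes "is_qspace P" "is_qspace P'" "pair_morphism P P' t"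
  shows "linear t" "t ` Car P \<subseteq> Car P'" "t ` Sub P \<subseteq> Sub P'"
    "u \<in> S2 \<Longrightarrow> \<exists>v\<in>S2. \<forall>x\<in>Car P. t (act P u x) = act P' v (t x)"
  using assms(3) unfolding pair_morphism_def quaternionic_linear_iff[OF assms(1,2)]
  by - (elim conjE, (assumption | (erule bspec, assumption)))+

lemma pair_isomorphism_iff:
  assumes P: "is_pair P" and P': "is_pair P'"
  shows "pair_isomorphism P P' t \<longleftrightarrow> iso_of_pairs P P' t"
proof -
  have q: "is_qspace P" "is_qspace P'" using P P' by (auto simp: is_pair_def)
  interpret P: quat_module "Car P" "act P" by (rule qspace_module[OF q(1)])
  interpret P': quat_module "Car P'" "act P'" by (rule qspace_module[OF q(2)])
  have sub: "Sub P \<subseteq> Car P" "Sub P' \<subseteq> Car P'" using P P' by (auto simp: is_pair_def)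
  show ?thesis
  proof
    assume "pair_isomorphism P P' t"
    then obtain s where m: "pair_morphism P P' t" "pair_morphism P' P s"
      and st: "\<And>x. x \<in> Car P \<Longrightarrow> s (t x) = x" "\<And>y. y \<in> Car P' \<Longrightarrow> t (s y) = y"
      unfolding pair_isomorphism_def by blast
    note t = pair_morphismD[OF q m(1)] and s = pair_morphismD[OF q(2,1) m(2)]
    have "inj_on t (Car P)" using st(1) by (rule inj_on_inverseI)
    moreover have "t ` Car P = Car P'" 
    proof
      show "Car P' \<subseteq> t ` Car P"
      proof
        fix y assume "y \<in> Car P'"
        then have "s y \<in> Car P" "y = t (s y)" using s(2) st(2) by auto
        then show "y \<in> t ` Car P" by blast
      qed
    qed (rule t(2))
    moreover have "t ` Sub P = Sub P'"
    proof
      show "Sub P' \<subseteq> t ` Sub P"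
      proof
        fix y assume "y \<in> Sub P'"
        then have "s y \<in> Sub P" "y = t (s y)" using s(3) st(2) sub(2) by auto
        then show "y \<in> t ` Sub P" by blast
      qed
    qed (rule t(3))
    moreover have "\<exists>u\<in>S2. \<forall>x\<in>Car P. t (act P u x) = act P' v (t x)" if v: "v \<in> S2" for v
    proof -
      obtain u where u: "u \<in> S2" "\<And>x. x \<in> Car P' \<Longrightarrow> s (act P' v x) = act P u (s x)" using s(4)[OF v] by blast
      have "t (act P u x) = act P' v (t x)" if "x \<in> Car P" for x
      proof -
        have tx: "t x \<in> Car P'" using t(2) that by blast
        have "t (s (act P' v (t x))) = t (act P u x)" using u(2)[OF tx] st(1)[OF that] by simp
        then show ?thesis using st(2)[OF P'.R_in[OF tx]] by simp
      qed
      then show ?thesis using u(1) by blast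
    qed
    ultimately show "iso_of_pairs P P' t" using t(1,4) by (simp add: iso_of_pairs_def)
  next
    assume "iso_of_pairs P P' t"
    note t = iso_of_pairsD[OF this]
    obtain s where s: "linear s" "\<And>x. x \<in> Car P \<Longrightarrow> s (t x) = x"
      using linear_exists_left_inverse_on[OF t(1) P.E t(2)] by blast
    have ts: "t (s y) = y" if y: "y \<in> Car P'" for y
    proof -
      obtain x where "x \<in> Car P" "y = t x" using y t(3) by blast
      then show ?thesis using s(2) by simp
    qed
    have sC: "s ` Car P' \<subseteq> Car P" unfolding t(3)[symmetric] using s(2) by auto
    have sS: "s ` Sub P' \<subseteq> Sub P" unfolding t(4)[symmetric] using s(2) sub(1) by auto
    have "\<exists>u\<in>S2. \<forall>y\<in>Car P'. s (act P' v y) = act P u (s y)" if v: "v \<in> S2" for v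
    proof -
      obtain u where u: "u \<in> S2" "\<And>x. x \<in> Car P \<Longrightarrow> t (act P u x) = act P' v (t x)" using t(6)[OF v] by blast
      have "s (act P' v y) = act P u (s y)" if "y \<in> Car P'" for y
      proof -
        have sy: "s y \<in> Car P" using sC that by blast
        have "act P' v y = t (act P u (s y))" using u(2)[OF sy] ts[OF that] by simp
        then show ?thesis using s(2)[OF P.R_in[OF sy]] by simp
      qed
      then show ?thesis using u(1) by blast
    qed
    then have "pair_morphism P' P s"
      unfolding pair_morphism_def quaternionic_linear_iff[OF q(2,1)] using s(1) sC sS by blast
    moreover have "pair_morphism P P' t"
      unfolding pair_morphism_def quaternionic_linear_iff[OF q] using t by blast
    ultimately show "pair_isomorphism P P' t" unfolding pair_isomorphism_def using s(2) ts by blast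
  qed
qed

lemma isomorphic_pairs_iff:
  "is_pair P \<Longrightarrow> is_pair P' \<Longrightarrow> isomorphic_pairs P P' \<longleftrightarrow> (\<exists>t. iso_of_pairs P P' t)"
  by (simp add: isomorphic_pairs_def pair_isomorphism_iff)

lemma isomorphic_pairs_sym: "isomorphic_pairs P P' \<Longrightarrow> isomorphic_pairs P' P"
  unfolding isomorphic_pairs_def pair_isomorphism_def by blast

lemma iso_of_pairs_trans:
  assumes a: "iso_of_pairs P Q f" and b: "iso_of_pairs Q R g"
  shows "iso_of_pairs P R (g \<circ> f)"
  unfolding iso_of_pairs_def
proof (intro conjI ballI)
  note f = iso_of_pairsD[OF a] and g = iso_of_pairsD[OF b]
  show "linear (g \<circ> f)" by (rule linear_compose[OF f(1) g(1)])
  show "inj_on (g \<circ> f) (Car P)" using comp_inj_on[OF f(2)] g(2) f(3) by simp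
  show "(g \<circ> f) ` Car P = Car R" "(g \<circ> f) ` Sub P = Sub R"
    by (simp_all only: image_comp[symmetric] f(3,4) g(3,4))
  have fx: "f x \<in> Car Q" if "x \<in> Car P" for x using f(3) that by blast
  show "\<exists>v\<in>S2. \<forall>x\<in>Car P. (g \<circ> f) (act P u x) = act R v ((g \<circ> f) x)" if u: "u \<in> S2" for u
  proof -
    obtain v where v: "v \<in> S2" "\<forall>x\<in>Car P. f (act P u x) = act Q v (f x)" using f(5)[OF u] by blast
    obtain v' where "v' \<in> S2" "\<forall>x\<in>Car Q. g (act Q v x) = act R v' (g x)" using g(5)[OF v(1)] by blast
    then show ?thesis using v fx by (intro bexI[of _ v']) auto
  qed
  show "\<exists>u\<in>S2. \<forall>x\<in>Car P. (g \<circ> f) (act P u x) = act R v ((g \<circ> f) x)" if v: "v \<in> S2" for v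
  proof -
    obtain v' where v': "v' \<in> S2" "\<forall>x\<in>Car Q. g (act Q v' x) = act R v (g x)" using g(6)[OF v] by blast
    obtain u where "u \<in> S2" "\<forall>x\<in>Car P. f (act P u x) = act Q v' (f x)" using f(6)[OF v'(1)] by blast
    then show ?thesis using v' fx by (intro bexI[of _ u]) auto
  qed
qed

section \<open>Orientation preserving isometries\<close>

definition rotation :: "(real^3 \<Rightarrow> real^3) \<Rightarrow> bool" where
  "rotation g \<longleftrightarrow> orthogonal_transformation g \<and> (\<forall>x y. cross3 (g x) (g y) = g (cross3 x y))"

text \<open>On the sphere a derivative is determined on tangent vectors only; the curves \<open>cos s u + sin s v\<close> see
it.\<close>

lemma tangent_derivative_unique:
  assumes D: "(T has_derivative D) (at u within S2)" and D': "(T has_derivative D') (at u within S2)"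
    and u: "u \<in> S2" "v \<in> S2" "v \<bullet> u = 0"
  shows "D v = D' v"
proof -
  define c where "c s = cos s *\<^sub>R u + sin s *\<^sub>R v" for s :: real
  have cS: "c s \<in> S2" for s
    using u sin_cos_squared_add[of s] by (simp add: c_def S2_iff inner_add_left inner_add_right inner_commute power2_eq_square algebra_simps)
  have c0: "c 0 = u" by (simp add: c_def)
  have c': "(c has_derivative (\<lambda>h. h *\<^sub>R v)) (at 0 within UNIV)"
    unfolding c_def by (auto intro!: derivative_eq_intros)
  have "(T \<circ> c has_derivative (\<lambda>h. A (h *\<^sub>R v))) (at 0 within UNIV)"
    if "(T has_derivative A) (at u within S2)" for A
    using diff_chain_within[OF c', of T A] has_derivative_subset[OF that, of "c ` UNIV"] cS c0
    by (auto simp: o_def image_subset_iff)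
  from this[OF D] this[OF D'] have "(\<lambda>h. D (h *\<^sub>R v)) = (\<lambda>h. D' (h *\<^sub>R v))"
    using has_derivative_unique by blast
  then have "D (1 *\<^sub>R v) = D' (1 *\<^sub>R v)" by meson
  then show ?thesis by simp
qed

text \<open>A distance preserving map of the unit sphere extends to an orthogonal map, and the sign condition on a tangent
frame forces the determinant to be \<open>1\<close>.\<close>

lemma op_isometry_rotation:
  assumes "op_isometry T" obtains g where "rotation g" "\<And>u. u \<in> S2 \<Longrightarrow> T u = g u"
proof -
  have T: "bij_betw T S2 S2" "\<And>u v. u \<in> S2 \<Longrightarrow> v \<in> S2 \<Longrightarrow> dist (T u) (T v) = dist u v"
    using assms by (auto simp: op_isometry_def)
  have TS: "T u \<in> S2" if "u \<in> S2" for u using T(1) that by (auto simp: bij_betw_def)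
  obtain g where g: "orthogonal_transformation g" "\<And>x. norm x = 1 \<Longrightarrow> g x = T x"
    using isometry_sphere_extend[of T] TS T(2) unfolding S2_def by (force simp: dist_norm)
  have gT: "g x = T x" if "x \<in> S2" for x using that g(2) by (simp add: S2_def)
  have lin: "linear g" using g(1) by (simp add: orthogonal_transformation_linear)
  have dot: "g x \<bullet> g y = x \<bullet> y" for x y using g(1) by (simp add: orthogonal_transformation_def)
  obtain w :: "real^3" where "w \<in> S2" by (metis S2_def norm_axis_1 mem_sphere_0)
  then obtain e where fr: "frame w e" using frame_exists by blast
  let ?f = "cross3 w e"
  note f = frame_S2[OF fr] frame_dots[OF fr] frame_cross[OF fr]
  obtain D where D: "(T has_derivative D) (at w within S2)"
      "\<And>v u. v \<bullet> w = 0 \<Longrightarrow> u \<bullet> w = 0 \<Longrightarrow> w \<bullet> cross3 v u > 0 \<Longrightarrow> T w \<bullet> cross3 (D v) (D u) > 0"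
    using assms f(1) unfolding op_isometry_def by blast
  have "(g has_derivative g) (at w within S2)" using lin by (simp add: linear_imp_has_derivative)
  then have "(T has_derivative g) (at w within S2)"
    using has_derivative_transform[of w S2 T g g] f(1) gT by simp
  then have "D e = g e" "D ?f = g ?f"
    using tangent_derivative_unique[OF D(1)] f by auto
  moreover have "T w \<bullet> cross3 (D e) (D ?f) > 0" by (rule D(2)) (use f in auto)
  ultimately have pos: "g w \<bullet> cross3 (g e) (g ?f) > 0" using gT[OF f(1)] by simp
  have cr: "cross3 (g x) (g y) = det (matrix g) *\<^sub>R g (cross3 x y)" for x y
    by (rule cross_orthogonal_transformation[OF g(1)])
  have "det (matrix g) > 0" using pos f dot[of w w] by (simp add: cr)
  moreover have "det (matrix g) = 1 \<or> det (matrix g) = -1"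
    using g(1) det_orthogonal_matrix orthogonal_transformation_matrix by blast
  ultimately have "det (matrix g) = 1" by linarith
  then have "rotation g" using g(1) cr by (simp add: rotation_def)
  then show ?thesis using that gT by metis
qed

lemma rotationD:
  assumes "rotation g"
  shows "linear g" "g x \<bullet> g y = x \<bullet> y" "cross3 (g x) (g y) = g (cross3 x y)" "u \<in> S2 \<Longrightarrow> g u \<in> S2" "bij g"
  using assms orthogonal_transformation_bij
  by (auto simp: rotation_def orthogonal_transformation_def S2_iff)

lemma rotation_S2_surj: assumes "rotation g" "v \<in> S2" shows "\<exists>u\<in>S2. g u = v"
proof -
  obtain u where "v = g u" using rotationD(5)[OF assms(1)] by (metis bij_pointE)
  then show ?thesis using assms(2) rotationD(2)[OF assms(1), of u u] by (auto simp: S2_iff)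
qed

lemma op_isometry_id: "op_isometry (\<lambda>u. u)"
  unfolding op_isometry_def by (auto simp: bij_betw_def intro!: exI[of _ "\<lambda>u. u"])

lemma lin_ext_eq:
  assumes "rotation g" "\<And>u. u \<in> S2 \<Longrightarrow> T u = g u" shows "lin_ext T (a, v) = (a, g v)"
proof -
  note g = rotationD[OF assms(1)]
  let ?L = "\<lambda>q :: quat. (fst q, g (snd q))"
  have "lin_ext T = ?L"
    unfolding lin_ext_def
  proof (rule the_equality)
    show "linear ?L \<and> ?L qone = qone \<and> (\<forall>u\<in>S2. ?L (0, u) = (0, T u))"
      using assms(2) linear_0[OF g(1)] by (auto simp: qone_def linear_add[OF g(1)] linear_scale[OF g(1)] intro!: linearI)
    fix L :: "quat \<Rightarrow> quat" assume L: "linear L \<and> L qone = qone \<and> (\<forall>u\<in>S2. L (0, u) = (0, T u))"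
    show "L = ?L"
    proof
      fix q :: quat
      obtain a v where q: "q = (a, v)" by fastforce
      have "L (0, v) = (0, g v)"
      proof (cases "v = 0")
        case True
        then show ?thesis using L linear_0[of L] linear_0[OF g(1)] by (simp add: zero_prod_def)
      next
        case False
        let ?u = "(1 / norm v) *\<^sub>R v"
        have "?u \<in> S2" using False by (simp add: S2_def)
        then have "L (norm v *\<^sub>R (0, ?u)) = norm v *\<^sub>R (0, g ?u)"
          using L assms(2) linear_scale[of L "norm v" "(0, ?u)"] by auto
        then show ?thesis using False by (simp add: linear_scale[OF g(1)])
      qed
      moreover have "q = a *\<^sub>R qone + (0, v)" by (simp add: q qone_def)
      ultimately show "L q = ?L q"
        using L linear_add[of L "a *\<^sub>R qone" "(0, v)"] linear_scale[of L a qone] by (simp add: q qone_def)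
    qed
  qed
  then show ?thesis by simp
qed

section \<open>Products\<close>

lemma prod_pair_simps [simp]:
  "Car (prod_pair T P P') = Car P \<times> Car P'" "Sub (prod_pair T P P') = Sub P \<times> Sub P'"
  by (simp_all add: prod_pair_def)

lemma prod_pair:
  assumes P: "is_pair P" and P': "is_pair P'" and g: "rotation g" "\<And>u. u \<in> S2 \<Longrightarrow> T u = g u"
  shows "is_pair (prod_pair T P P')"
    and "\<And>x y t. x \<in> Car P \<Longrightarrow> y \<in> Car P' \<Longrightarrow> act (prod_pair T P P') t (x, y) = (act P t x, act P' (g t) y)"
proof -
  have q: "is_qspace P" "is_qspace P'" using P P' by (auto simp: is_pair_def)
  interpret P: quat_module "Car P" "act P" by (rule qspace_module[OF q(1)])
  interpret P': quat_module "Car P'" "act P'" by (rule qspace_module[OF q(2)])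
  note r = rotationD[OF g(1)]
  have sub: "subspace (Car P \<times> Car P')" by (intro subspace_Times P.E P'.E)
  define R where "R t = map_prod (act P t) (act P' (g t))" for t
  have mod: "quat_module (Car P \<times> Car P') R"
  proof
    show "bilinear R"
      unfolding bilinear_def R_def
      by (auto intro!: linearI simp: P.R_simps P'.R_simps linear_add[OF r(1)] linear_scale[OF r(1)])
    show "x \<in> Car P \<times> Car P' \<Longrightarrow> R t x \<in> Car P \<times> Car P'" for t x
      by (auto simp: R_def P.R_in P'.R_in)
    show "R s (R t x) = R (cross3 s t) x - (s \<bullet> t) *\<^sub>R x" if "x \<in> Car P \<times> Car P'" for s t x
      using that r by (auto simp: R_def P.R_R P'.R_R)
  qed (rule sub)
  let ?\<rho> = "Rep (prod_pair T P P')"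
  have rep: "?\<rho> (a, t) x = a *\<^sub>R x + R t x" if "x \<in> Car P \<times> Car P'" for a t x
    using that lin_ext_eq[OF g, of a t]
    by (auto simp: prod_pair_def R_def Rep_act[OF q(1)] Rep_act[OF q(2)])
  have "linear (?\<rho> k)" for k
  proof -
    have "linear (Rep P k)" "linear (Rep P' (lin_ext T k))" 
      using q unfolding is_qspace_def hypercomplex_def by blast+
    then show ?thesis by (auto simp: prod_pair_def linear_iff)
  qed
  then have "hypercomplex (Car P \<times> Car P') ?\<rho>" using hypercomplexI[OF _ mod rep] by blast
  then have qs: "is_qspace (prod_pair T P P')" using sub by (simp add: is_qspace_def)
  moreover have "subspace (Sub P \<times> Sub P')" "Sub P \<times> Sub P' \<subseteq> Car P \<times> Car P'"
    using P P' by (auto simp: is_pair_def intro: subspace_Times)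
  ultimately show "is_pair (prod_pair T P P')" by (simp add: is_pair_def)
  show "act (prod_pair T P P') t (x, y) = (act P t x, act P' (g t) y)" if "x \<in> Car P" "y \<in> Car P'" for x y t
    using act_in_Car[OF qs, of "(x, y)" t] that rep[of "(x, y)" 0 t] by (simp add: R_def)
qed

section \<open>Germs on the sphere\<close>

text \<open>In terms of filters, properties near a point can be combined by \<open>eventually\<close>-rules.\<close>

lemma near_iff: "near u P \<longleftrightarrow> u \<in> S2 \<and> (\<forall>\<^sub>F v in nhds u. v \<in> S2 \<longrightarrow> P v)"
proof
  assume "near u P"
  then obtain T where "open T" "u \<in> S2 \<inter> T" "\<forall>v\<in>S2 \<inter> T. P v"
    unfolding near_def openin_open by blast
  then show "u \<in> S2 \<and> (\<forall>\<^sub>F v in nhds u. v \<in> S2 \<longrightarrow> P v)" unfolding eventually_nhds by blast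
next
  assume "u \<in> S2 \<and> (\<forall>\<^sub>F v in nhds u. v \<in> S2 \<longrightarrow> P v)"
  then obtain T where "open T" "u \<in> T" "\<forall>v\<in>T. v \<in> S2 \<longrightarrow> P v" "u \<in> S2" unfolding eventually_nhds by blast
  then show "near u P" unfolding near_def openin_open by (intro exI[of _ "S2 \<inter> T"]) auto
qed

lemma near_conj: "near u P \<Longrightarrow> near u Q \<Longrightarrow> near u (\<lambda>v. P v \<and> Q v)"
  by (auto simp: near_iff elim: eventually_elim2)

lemma near_mono: "near u P \<Longrightarrow> (\<And>v. v \<in> S2 \<Longrightarrow> P v \<Longrightarrow> Q v) \<Longrightarrow> near u Q"
  by (auto simp: near_iff elim: eventually_mono)

lemma near_self: "near u P \<Longrightarrow> P u"
  by (auto simp: near_def)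

lemma near_S2: "near u P \<Longrightarrow> u \<in> S2"
  by (simp add: near_iff)

lemma near_triv: "u \<in> S2 \<Longrightarrow> (\<And>v. v \<in> S2 \<Longrightarrow> P v) \<Longrightarrow> near u P"
  by (simp add: near_iff)

lemma near_near: "near u P \<Longrightarrow> near u (\<lambda>v. near v P)"
proof -
  assume a: "near u P"
  then have "\<forall>\<^sub>F v in nhds u. \<forall>\<^sub>F x in nhds v. x \<in> S2 \<longrightarrow> P x"
    by (simp add: near_iff eventually_eventually)
  then show ?thesis using a by (auto simp: near_iff elim: eventually_mono)
qed

lemma near_avoid: assumes "finite F" "u \<in> S2" shows "near u (\<lambda>v. v = u \<or> v \<notin> F)"
proof -
  have "open (- (F - {u}))" by (intro open_Compl finite_imp_closed finite_Diff assms)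
  then have "\<forall>\<^sub>F v in nhds u. v \<in> - (F - {u})" by (intro eventually_nhds_in_open) auto
  then show ?thesis using assms(2) by (auto simp: near_iff elim: eventually_mono)
qed

lemma S2_islimpt: assumes "u \<in> S2" shows "u islimpt S2"
proof -
  have "connected (S2 :: (real^3) set)" by (simp add: S2_def connected_sphere)
  moreover have "S2 \<noteq> {x}" for x using infinite_S2 by (metis finite.emptyI finite_insert)
  ultimately show ?thesis using connected_imp_perfect assms by blast
qed

lemma near_infinite: assumes "near u P" "finite F" shows "\<exists>v\<in>S2. v \<notin> F \<and> P v"
proof -
  have u: "u \<in> S2" by (rule near_S2[OF assms(1)])
  have "near u (\<lambda>v. P v \<and> (v = u \<or> v \<notin> F))" by (rule near_conj[OF assms(1) near_avoid[OF assms(2) u]])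
  then obtain T where T: "open T" "u \<in> T" "\<forall>v\<in>T. v \<in> S2 \<longrightarrow> P v \<and> (v = u \<or> v \<notin> F)"
    unfolding near_iff eventually_nhds by blast
  obtain v where "v \<in> S2" "v \<in> T" "v \<noteq> u" using S2_islimpt[OF u] T(1,2) unfolding islimpt_def by blast
  then show ?thesis using T(3) by blast
qed

text \<open>Complex differentiability at one point, the condition that \<open>holomorphic_near\<close> imposes at all nearby
points.\<close>

definition hol_at :: "('b::real_normed_vector \<Rightarrow> 'b) \<Rightarrow> real^3 \<Rightarrow> (real^3 \<Rightarrow> 'b) \<Rightarrow> bool" where
  "hol_at I v f \<longleftrightarrow> (\<exists>D. (f has_derivative D) (at v within S2) \<and> (\<forall>t. t \<bullet> v = 0 \<longrightarrow> D (cross3 v t) = I (D t)))"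

lemma holomorphic_near_iff: "holomorphic_near I u f \<longleftrightarrow> near u (\<lambda>v. hol_at I v f)"
  by (simp add: holomorphic_near_def hol_at_def)

lemma hol_at_cong: assumes "near v (\<lambda>x. f x = g x)" "hol_at I v f" shows "hol_at I v g"
proof -
  obtain D where D: "(f has_derivative D) (at v within S2)" "\<forall>t. t \<bullet> v = 0 \<longrightarrow> D (cross3 v t) = I (D t)"
    using assms(2) by (auto simp: hol_at_def)
  have "\<forall>\<^sub>F x in at v within S2. f x = g x"
    using assms(1) unfolding near_iff eventually_at_filter by (auto elim: eventually_mono)
  then have "(g has_derivative D) (at v within S2)"
    using has_derivative_transform_eventually[OF D(1)] near_self[OF assms(1)] near_S2[OF assms(1)] by blast
  then show ?thesis using D(2) by (auto simp: hol_at_def)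
qed

lemma hol_at_const: assumes "linear I" shows "hol_at I v (\<lambda>_. c)"
  unfolding hol_at_def by (intro exI[of _ "\<lambda>_. 0"]) (simp add: linear_0[OF assms])

lemma hol_at_add: assumes "linear I" "hol_at I v f" "hol_at I v g" shows "hol_at I v (\<lambda>x. f x + g x)"
proof -
  obtain D D' where "(f has_derivative D) (at v within S2)" "\<forall>t. t \<bullet> v = 0 \<longrightarrow> D (cross3 v t) = I (D t)"
     "(g has_derivative D') (at v within S2)" "\<forall>t. t \<bullet> v = 0 \<longrightarrow> D' (cross3 v t) = I (D' t)"
    using assms by (auto simp: hol_at_def)
  then show ?thesis
    unfolding hol_at_def
    by (intro exI[of _ "\<lambda>t. D t + D' t"]) (auto intro: has_derivative_add simp: linear_add[OF assms(1)])
qed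

lemma hol_at_linear:
  fixes N :: "'a::euclidean_space \<Rightarrow> 'b::real_normed_vector"
  assumes "linear N" "\<And>x. N (I x) = I' (N x)" "hol_at I v f" shows "hol_at I' v (\<lambda>x. N (f x))"
proof -
  obtain D where D: "(f has_derivative D) (at v within S2)" "\<forall>t. t \<bullet> v = 0 \<longrightarrow> D (cross3 v t) = I (D t)"
    using assms by (auto simp: hol_at_def)
  have "bounded_linear N" using assms(1) by (simp add: linear_conv_bounded_linear)
  from bounded_linear.has_derivative[OF this D(1)] show ?thesis
    unfolding hol_at_def using D(2) assms(2) by (intro exI[of _ "\<lambda>t. N (D t)"]) simp
qed

lemma (in complex_structure) hol_at_csc:
  assumes "hol_at ((*) \<i>) v c" "hol_at j v f" "f v \<in> S"
  shows "hol_at j v (\<lambda>x. csc j (c x) (f x))"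
proof -
  obtain C D where C: "(c has_derivative C) (at v within S2)" "\<forall>t. t \<bullet> v = 0 \<longrightarrow> C (cross3 v t) = \<i> * C t"
     and D: "(f has_derivative D) (at v within S2)" "\<forall>t. t \<bullet> v = 0 \<longrightarrow> D (cross3 v t) = j (D t)"
    using assms by (auto simp: hol_at_def)
  have bj: "bounded_linear j" using lin_j by (simp add: linear_conv_bounded_linear)
  have "((\<lambda>x. csc j (c x) (f x)) has_derivative
      (\<lambda>t. (Re (c v) *\<^sub>R D t + Re (C t) *\<^sub>R f v) + (Im (c v) *\<^sub>R j (D t) + Im (C t) *\<^sub>R j (f v)))) (at v within S2)"
    unfolding csc_def
    by (intro has_derivative_add has_derivative_scaleR
        bounded_linear.has_derivative[OF bj] bounded_linear.has_derivative[OF bounded_linear_Re]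
        bounded_linear.has_derivative[OF bounded_linear_Im] C D)
  then show ?thesis
    unfolding hol_at_def using C(2) D(2) assms(3)
    by (intro exI[of _ "\<lambda>t. (Re (c v) *\<^sub>R D t + Re (C t) *\<^sub>R f v) + (Im (c v) *\<^sub>R j (D t) + Im (C t) *\<^sub>R j (f v))"])
      (simp add: linear_add[OF lin_j] linear_scale[OF lin_j] j_j)
qed

lemma complex_structure_ii: "complex_structure (UNIV :: complex set) ((*) \<i>)"
  by unfold_locales (auto intro!: linearI simp: algebra_simps)

lemma csc_ii: "csc ((*) \<i>) a b = a * b"
  by (simp add: csc_def complex_eq_iff)

lemma hol_at_mult: "hol_at ((*) \<i>) v c \<Longrightarrow> hol_at ((*) \<i>) v d \<Longrightarrow> hol_at ((*) \<i>) v (\<lambda>x. c x * d x)"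
  using complex_structure.hol_at_csc[OF complex_structure_ii, of v c d] by (simp add: csc_ii)

lemma linear_ii: "linear ((*) \<i>)"
  by (rule complex_structure.lin_j[OF complex_structure_ii])

lemma hol_at_prod_list:
  "hol_at ((*) \<i>) v c \<Longrightarrow> hol_at ((*) \<i>) v (\<lambda>x. \<Prod>l\<leftarrow>ls. 1 + c x * l)"
  by (induction ls) (auto intro!: hol_at_const linear_ii hol_at_mult hol_at_add)

definition st_deriv :: "real^3 \<Rightarrow> real^3 \<Rightarrow> real^3 \<Rightarrow> real^3" where
  "st_deriv w v t = (1 / (2 + 2 * (v \<bullet> w))) *\<^sub>R (t - (2 * (t \<bullet> w)) *\<^sub>R st w v)"

lemma st_has_derivative:
  assumes "v \<in> S2" "w \<in> S2" "v \<noteq> - w"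
  shows "(st w has_derivative st_deriv w v) (at v within S2)"
proof -
  have k: "2 + 2 * (v \<bullet> w) \<noteq> 0" using antipode[OF assms] by simp
  have "((\<lambda>v. inverse (2 + 2 * (v \<bullet> w)) *\<^sub>R (v + w)) has_derivative
      (\<lambda>t. inverse (2 + 2 * (v \<bullet> w)) *\<^sub>R t
         + (- (inverse (2 + 2 * (v \<bullet> w)) * (2 * (t \<bullet> w)) * inverse (2 + 2 * (v \<bullet> w)))) *\<^sub>R (v + w))) (at v within S2)"
    using k by (auto intro!: derivative_eq_intros)
  moreover have "(\<lambda>t. inverse (2 + 2 * (v \<bullet> w)) *\<^sub>R t
         + (- (inverse (2 + 2 * (v \<bullet> w)) * (2 * (t \<bullet> w)) * inverse (2 + 2 * (v \<bullet> w)))) *\<^sub>R (v + w)) = st_deriv w v"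
    by (auto simp: st_deriv_def st_def scaleR_diff_right inverse_eq_divide mult.commute mult.left_commute)
  ultimately show ?thesis unfolding st_def[abs_def] inverse_eq_divide by simp
qed

text \<open>Put \<open>a = v + w\<close> and \<open>b = v - w\<close>, which are orthogonal.  After multiplication by \<open>k = a \<bullet> a\<close> the claim becomes the
decomposition of \<open>cross3 b t\<close> into its parts along \<open>a\<close> and orthogonal to \<open>a\<close>.\<close>

lemma st_deriv_complex:
  assumes "v \<in> S2" "w \<in> S2" "v \<noteq> - w" "t \<bullet> v = 0"
  shows "st_deriv w v (cross3 v t) = cross3 w (st_deriv w v t)"
proof -
  define k where "k = 2 + 2 * (v \<bullet> w)"
  have k: "k \<noteq> 0" using antipode[OF assms(1-3)] by (simp add: k_def)
  let ?a = "v + w" and ?b = "v - w"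
  have aa: "?a \<bullet> ?a = k" using assms by (simp add: k_def S2_iff inner_add_left inner_add_right inner_commute)
  have ab: "?a \<bullet> ?b = 0" using assms by (simp add: S2_iff inner_add_left inner_add_right inner_diff_right inner_diff_left inner_commute)
  have axb: "cross3 ?a ?b = 2 *\<^sub>R cross3 w v"
    using cross_skew[of v w] by (simp add: cross_add_left Cross3.right_diff_distrib scaleR_2)
  let ?y = "cross3 ?b t"
  have trip: "x \<bullet> cross3 y z = z \<bullet> cross3 x y" for x y z :: "real^3"
    by (simp add: cross3_simps)
  have "?a \<bullet> ?y = 2 * (cross3 v t \<bullet> w)"
    using trip[of ?a ?b t] trip[of w v t] by (simp add: axb inner_commute)
  moreover have "cross3 ?a ?y = (t \<bullet> w) *\<^sub>R ?b"
    using ab assms(4) by (simp add: Lagrange inner_add_left inner_add_right inner_commute)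
  moreover have "k *\<^sub>R ?y = (?a \<bullet> ?y) *\<^sub>R ?a - cross3 ?a (cross3 ?a ?y)"
    using Lagrange[of ?a ?a ?y] aa by simp
  ultimately have "k *\<^sub>R cross3 ?b t = (2 * (cross3 v t \<bullet> w)) *\<^sub>R ?a - (2 * (t \<bullet> w)) *\<^sub>R cross3 w v"
    by (simp add: cross_mult_right axb)
  then have "(1/k) *\<^sub>R (k *\<^sub>R cross3 ?b t) = (1/k) *\<^sub>R ((2 * (cross3 v t \<bullet> w)) *\<^sub>R ?a - (2 * (t \<bullet> w)) *\<^sub>R cross3 w v)"
    by simp
  then have id: "cross3 v t - cross3 w t = (2 * (cross3 v t \<bullet> w)) *\<^sub>R ((1/k) *\<^sub>R ?a) - (2 * (t \<bullet> w)) *\<^sub>R ((1/k) *\<^sub>R cross3 w v)"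
    using k by (simp add: Cross3.left_diff_distrib algebra_simps)
  have st: "st w v = (1/k) *\<^sub>R ?a" by (simp add: st_def k_def)
  have cst: "cross3 w (st w v) = (1/k) *\<^sub>R cross3 w v" by (simp add: st cross_mult_right cross_add_right)
  have "cross3 v t - (2 * (cross3 v t \<bullet> w)) *\<^sub>R st w v = cross3 w t - (2 * (t \<bullet> w)) *\<^sub>R cross3 w (st w v)"
    using id unfolding cst unfolding st by (simp add: algebra_simps)
  then show ?thesis
    unfolding st_deriv_def by (simp add: cross_mult_right Cross3.right_diff_distrib)
qed

lemma hol_at_coord:
  assumes fr: "frame w e" and v: "v \<in> S2" "v \<noteq> - w"
  shows "hol_at ((*) \<i>) v (coord w e)"
proof -
  let ?f = "cross3 w e"
  note w = frame_S2(1)[OF fr]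
  let ?q = "st_deriv w v"
  have "coord w e = (\<lambda>v. of_real (st w v \<bullet> e) + \<i> * of_real (st w v \<bullet> ?f))"
    by (auto simp: coord_def complex_eq_iff)
  moreover have "((\<lambda>v. of_real (st w v \<bullet> e) + \<i> * of_real (st w v \<bullet> ?f)) has_derivative
     (\<lambda>t. of_real (?q t \<bullet> e) + \<i> * of_real (?q t \<bullet> ?f))) (at v within S2)"
    using st_has_derivative[OF v(1) w v(2)] by (auto intro!: derivative_eq_intros)
  ultimately have D: "(coord w e has_derivative (\<lambda>t. of_real (?q t \<bullet> e) + \<i> * of_real (?q t \<bullet> ?f))) (at v within S2)"
    by simp
  have "cross3 w x \<bullet> e = - (x \<bullet> ?f)" "cross3 w x \<bullet> ?f = x \<bullet> e" for x
  proof -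
    have trip: "cross3 a b \<bullet> c = - (b \<bullet> cross3 a c)" for a b c :: "real^3"
      by (simp add: cross3_simps)
    show "cross3 w x \<bullet> e = - (x \<bullet> ?f)" by (rule trip)
    show "cross3 w x \<bullet> ?f = x \<bullet> e" using trip[of w x ?f] frame_cross(1)[OF fr] by simp
  qed
  then show ?thesis
    unfolding hol_at_def using st_deriv_complex[OF v(1) w v(2)] D
    by (intro exI[of _ "\<lambda>t. of_real (?q t \<bullet> e) + \<i> * of_real (?q t \<bullet> ?f)"]) (simp add: complex_eq_iff)
qed

lemma near_coord_domain: assumes "u \<in> S2" "u \<noteq> - w" shows "near u (\<lambda>v. v \<noteq> - w)"
  using near_avoid[of "{- w}" u] assms by (auto elim: near_mono)

lemma holomorphic_near_coord:
  assumes "frame w e" "u \<in> S2" "u \<noteq> - w" shows "holomorphic_near ((*) \<i>) u (coord w e)"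
  unfolding holomorphic_near_iff
  by (rule near_mono[OF near_coord_domain[OF assms(2,3)]]) (rule hol_at_coord[OF assms(1)])

context complex_endo
begin

lemma shift_prod_csc: "x \<in> S \<Longrightarrow> shift_prod j N ls (csc j a x) = csc j a (shift_prod j N ls x)"
proof (induction ls arbitrary: x)
  case (Cons l ls)
  have "N (csc j a x) - csc j l (csc j a x) = csc j a (N x - csc j l x)"
    using Cons.prems by (simp add: N_csc csc_diff_right flip: csc_mult) (simp add: mult.commute)
  then show ?case using Cons by (simp add: subspace_diff[OF S] N_in csc_in)
qed simp

text \<open>A vector germ \<open>w\<close> is torsion modulo the image of \<open>1 + c N\<close>: from
\<open>(1 + c l) w = (1 + c N) w - c (N - l) w\<close> one passes to the germ \<open>c (N - l) w\<close>, and after all factors of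
a product that annihilates \<open>w\<close> have been used nothing is left.  This replaces the determinant and the adjugate.\<close>

lemma solve_up_to_torsion:
  assumes glob: "\<And>x. N (j x) = j (N x)"
    and c: "near u (\<lambda>v. hol_at ((*) \<i>) v c)"
  shows "near u (\<lambda>v. hol_at j v w \<and> w v \<in> S \<and> shift_prod j N ls (w v) = 0) \<Longrightarrow>
    \<exists>y. near u (\<lambda>v. hol_at j v y \<and> y v \<in> S \<and> csc j (\<Prod>l\<leftarrow>ls. 1 + c v * l) (w v) = y v + csc j (c v) (N (y v)))"
proof (induction ls arbitrary: w)
  case Nil
  then show ?case
    by (intro exI[of _ "\<lambda>_. 0"])
      (auto elim!: near_mono intro!: hol_at_const lin_j simp: subspace_0[OF S] linear_0[OF lin_N])
next
  case (Cons l ls)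
  define w' where "w' v = csc j (c v) (N (w v) - csc j l (w v))" for v
  have "near u (\<lambda>v. hol_at j v w' \<and> w' v \<in> S \<and> shift_prod j N ls (w' v) = 0)"
  proof (rule near_mono[OF near_conj[OF c Cons.prems]])
    fix v assume a: "hol_at ((*) \<i>) v c \<and> hol_at j v w \<and> w v \<in> S \<and> shift_prod j N (l # ls) (w v) = 0"
    then have S': "N (w v) - csc j l (w v) \<in> S" by (intro subspace_diff S N_in csc_in) auto
    have "hol_at j v (\<lambda>v. N (w v))" using a by (intro hol_at_linear[where N = N and I = j, OF lin_N glob]) auto
    moreover have "hol_at j v (\<lambda>v. csc j (- l) (w v))"
      using a by (intro hol_at_csc hol_at_const linear_ii) auto
    ultimately have "hol_at j v (\<lambda>v. N (w v) + csc j (- l) (w v))" by (rule hol_at_add[OF lin_j])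
    then have "hol_at j v (\<lambda>v. N (w v) - csc j l (w v))" by (simp add: csc_minus)
    then have "hol_at j v w'" unfolding w'_def using a S' by (intro hol_at_csc) auto
    then show "hol_at j v w' \<and> w' v \<in> S \<and> shift_prod j N ls (w' v) = 0"
      using S' a by (simp add: w'_def csc_in shift_prod_csc)
  qed
  from Cons.IH[OF this] obtain y where y: "near u (\<lambda>v. hol_at j v y \<and> y v \<in> S \<and>
     csc j (\<Prod>l\<leftarrow>ls. 1 + c v * l) (w' v) = y v + csc j (c v) (N (y v)))" by blast
  define f where "f v = (\<Prod>l\<leftarrow>ls. 1 + c v * l)" for v
  show ?case
  proof (rule exI[of _ "\<lambda>v. csc j (f v) (w v) - y v"], rule near_mono[OF near_conj[OF c near_conj[OF Cons.prems y]]])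
    fix v assume a: "hol_at ((*) \<i>) v c \<and> (hol_at j v w \<and> w v \<in> S \<and> shift_prod j N (l # ls) (w v) = 0)
      \<and> hol_at j v y \<and> y v \<in> S \<and> csc j (\<Prod>l\<leftarrow>ls. 1 + c v * l) (w' v) = y v + csc j (c v) (N (y v))"
    then have wy: "w v \<in> S" "y v \<in> S" "N (w v) \<in> S" and eq: "csc j (f v) (w' v) = y v + csc j (c v) (N (y v))"
      by (auto simp: f_def N_in)
    have "hol_at ((*) \<i>) v f" unfolding f_def[abs_def] using a by (intro hol_at_prod_list) auto
    then have "hol_at j v (\<lambda>v. csc j (f v) (w v))" using a by (intro hol_at_csc) auto
    moreover have "hol_at j v (\<lambda>v. csc j (- 1) (y v))" using a by (intro hol_at_csc hol_at_const linear_ii) auto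
    ultimately have "hol_at j v (\<lambda>v. csc j (f v) (w v) + csc j (- 1) (y v))" by (rule hol_at_add[OF lin_j])
    then have h: "hol_at j v (\<lambda>v. csc j (f v) (w v) - y v)" by (simp add: csc_minus)
    have w': "w' v = csc j (c v) (N (w v)) - csc j (c v * l) (w v)"
      using wy by (simp add: w'_def csc_diff_right csc_mult)
    have "csc j ((1 + c v * l) * f v) (w v) = csc j (f v) (w v) + csc j (f v) (csc j (c v * l) (w v))"
      using wy by (simp add: csc_mult[symmetric] csc_add[symmetric] algebra_simps)
    also have "\<dots> = csc j (f v) (w v) + csc j (f v) (csc j (c v) (N (w v))) - csc j (f v) (w' v)"
      by (simp add: w' csc_diff_right)
    also have "csc j (f v) (csc j (c v) (N (w v))) = csc j (c v) (N (csc j (f v) (w v)))"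
      using wy by (simp add: N_csc csc_mult[symmetric] mult.commute)
    finally have "csc j ((1 + c v * l) * f v) (w v) =
        (csc j (f v) (w v) - y v) + csc j (c v) (N (csc j (f v) (w v) - y v))"
      by (simp add: eq linear_diff[OF lin_N] csc_diff_right)
    then show "hol_at j v (\<lambda>v. csc j (f v) (w v) - y v) \<and> csc j (f v) (w v) - y v \<in> S \<and>
        csc j (\<Prod>l\<leftarrow>l # ls. 1 + c v * l) (w v) = (csc j (f v) (w v) - y v) + csc j (c v) (N (csc j (f v) (w v) - y v))"
      using h wy by (simp add: f_def csc_in subspace_diff[OF S])
  qed
qed

end

section \<open>Sections of the sheaf of a pair\<close>

lemma quot_map_perp: "quot_map P = perp (Sub P)"
  by (simp add: fun_eq_iff quot_map_def perp_def)

locale pair_pencil =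
  fixes P :: "'a::euclidean_space qpair" and w e :: "real^3"
  assumes P: "is_pair P" and frP: "frame w e"
begin

abbreviation E where "E \<equiv> Car P"
abbreviation R where "R \<equiv> act P"
abbreviation U where "U \<equiv> Sub P"

lemma qs: "is_qspace P" and subU: "subspace U" and UE: "U \<subseteq> E"
  using P by (auto simp: is_pair_def)

sublocale quat_pencil E R U w e
  using qspace_module[OF qs] subU UE frP
  by (intro quat_pencil.intro quat_pencil_axioms.intro) auto

lemma Quot_eq: "quot_space P = Quot"
  by (simp add: quot_space_def Quot_def)

lemma R_proj: "R t (x - perp E x) = R t x"
proof -
  have "perp E (x - perp E x) = 0" using perp(2)[OF E] perp_eq_0_iff[OF E] by blast
  then show ?thesis by (simp add: act_def)
qed

lemma R_R_R: "R t (R w (R w x)) = - R t x"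
proof -
  have "R w (R w x) = R w (R w (x - perp E x))" by (simp add: R_proj)
  also have "\<dots> = - (x - perp E x)" using R_unit[OF perp(2)[OF E] fS2(1)] .
  finally have "R t (R w (R w x)) = R t (- (x - perp E x))" by simp
  also have "\<dots> = - R t (x - perp E x)" by (rule R_simps(6))
  finally show ?thesis by (simp only: R_proj)
qed

lemma L1_complex_global: "L1 (- R w y) = cscale \<i> (L1 y)"
  by (simp add: L1_def cscale_Pair R_simps R_R_R perp_simps)

lemma L_complex: assumes "y \<in> E" "v \<in> S2" "v \<noteq> - w"
  shows "L v (csc (\<lambda>x. - R w x) c y) = cscale c (L v y)"
proof -
  have 0: "A (csc (\<lambda>x. - R w x) c y) = cscale c (A y)"
    if "linear A" "A (- R w y) = cscale \<i> (A y)" for A :: "'a \<Rightarrow> 'a \<times> 'a" and c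
    unfolding cscale_eq_csc[of c] csc_def that(2)[symmetric] by (simp only: linear_add[OF that(1)] linear_scale[OF that(1)])
  have "cscale c (cscale k z) = cscale k (cscale c z)" for k and z :: "'a \<times> 'a"
    by (simp add: cscale_def prod_eq_iff algebra_simps)
  then show ?thesis
    using L_eq[OF assms] L_eq[OF cE.csc_in[OF assms(1)] assms(2,3)] 0[OF linear_L0 L0_complex[OF assms(1)]]
      0[OF linear_L1 L1_complex[OF assms(1)]]
    by (simp add: linear_add[OF linear_cscale])
qed

definition section_of :: "(real^3 \<Rightarrow> 'a) \<Rightarrow> real^3 \<Rightarrow> 'a \<times> 'a" where
  "section_of y v = (R (st w v) (y v), R v (R (st w v) (y v)))"

lemma quot_section: "quot_map_C P (section_of y v) = L v (y v)"
  by (simp add: quot_map_C_def quot_map_perp section_of_def L_def)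

lemma E01_fibre_iff: "z \<in> E01_fibre P v \<longleftrightarrow> v \<in> S2 \<and> (\<exists>x\<in>E. z = (x, R v x))" if "v \<in> S2"
proof -
  have "map_prod (Rep P (0, v)) (Rep P (0, v)) (x, y) = cscale (- \<i>) (x, y) \<longleftrightarrow> y = R v x" if "x \<in> E" "y \<in> E" for x y
    using that R_unit[OF that(1) \<open>v \<in> S2\<close>]
    by (auto simp: cscale_Pair act_in_Car[OF qs, symmetric])
  then show ?thesis using that R_in by (auto simp: E01_fibre_def)
qed

lemma section_fibre: "y v \<in> E \<Longrightarrow> v \<in> S2 \<Longrightarrow> section_of y v \<in> E01_fibre P v"
  using E01_fibre_iff R_in by (auto simp: section_of_def)

lemma fibre_section:
  assumes "z \<in> E01_fibre P v" "v \<in> S2" "v \<noteq> - w"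
  shows "\<exists>y\<in>E. z = section_of (\<lambda>_. y) v"
proof -
  obtain x where x: "x \<in> E" "z = (x, R v x)" using assms E01_fibre_iff by blast
  let ?y = "- (1 / (st w v \<bullet> st w v)) *\<^sub>R R (st w v) x"
  have "R (st w v) ?y = x" by (rule R_inverse[OF x(1) st_nz[OF fr assms(2,3)]])
  moreover have "?y \<in> E" by (intro subspace_mul E R_in x)
  ultimately show ?thesis using x by (intro bexI[of _ ?y]) (auto simp: section_of_def)
qed

text \<open>The derivative of \<open>st w\<close> takes values \<open>q\<close> orthogonal to \<open>w\<close>, so \<open>R w\<close> and \<open>R q\<close> anticommute; with
\<open>st_deriv_complex\<close> this is what complex differentiability of the section requires.\<close>

lemma section_hol:
  assumes y: "hol_at (\<lambda>x. - R w x) v y" "near v (\<lambda>x. y x \<in> E)" and v: "v \<noteq> - w"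
  shows "hol_at (cscale \<i>) v (section_of y)"
proof -
  have vS: "v \<in> S2" using y(2) by (rule near_S2)
  obtain D where D: "(y has_derivative D) (at v within S2)" "\<And>t. t \<bullet> v = 0 \<Longrightarrow> D (cross3 v t) = - R w (D t)"
    using y(1) by (auto simp: hol_at_def)
  let ?q = "st_deriv w v"
  let ?m = "st w v"
  note q = st_has_derivative[OF vS fS2(1) v]
  have bb: "bounded_bilinear R" using bil by (simp add: bilinear_conv_bounded_bilinear)
  have bw: "bounded_linear (R w)" using linear_R by (simp add: linear_conv_bounded_linear)
  note d1 = bounded_bilinear.FDERIV[OF bb q D(1)]
  note d2 = bounded_bilinear.FDERIV[OF bb q bounded_linear.has_derivative[OF bw D(1)]]
  define D' where "D' t = (R ?m (D t) + R (?q t) (y v), R ?m (R w (D t)) + R (?q t) (R w (y v)))" for t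
  have "((\<lambda>x. (R (st w x) (y x), R (st w x) (R w (y x)))) has_derivative D') (at v within S2)"
    unfolding D'_def by (rule has_derivative_Pair[OF d1 d2])
  moreover have "D' (cross3 v t) = cscale \<i> (D' t)" if t: "t \<bullet> v = 0" for t
  proof -
    have "?q t \<bullet> w = 0" using st_dot[OF fr vS v] by (simp add: st_deriv_def inner_diff_left)
    then have qw: "w \<bullet> ?q t = 0" "?q t \<bullet> w = 0" by (simp_all add: inner_commute)
    have yE: "y v \<in> E" using near_self[OF y(2)] .
    have "R (cross3 w (?q t)) (y v) = - R (?q t) (R w (y v))" 
         "R (cross3 w (?q t)) (R w (y v)) = R (?q t) (y v)"
    proof -
      have 1: "R (cross3 w (?q t)) x = R w (R (?q t) x)" if "x \<in> E" for x using that qw by (simp add: R_R)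
      show "R (cross3 w (?q t)) (y v) = - R (?q t) (R w (y v))"
        using 1[OF yE] R_anticomm[OF yE qw(1)] by simp
      show "R (cross3 w (?q t)) (R w (y v)) = R (?q t) (y v)"
        using 1[OF R_in[OF yE]] R_anticomm[OF R_in[OF yE] qw(1)] by (simp add: R_R_R)
    qed
    then show ?thesis
      unfolding D'_def D(2)[OF t] st_deriv_complex[OF vS fS2(1) v t]
      by (simp add: cscale_Pair R_simps R_R_R)
  qed
  ultimately have "hol_at (cscale \<i>) v (\<lambda>x. (R (st w x) (y x), R (st w x) (R w (y x))))"
    by (auto simp: hol_at_def)
  moreover have "near v (\<lambda>x. (R (st w x) (y x), R (st w x) (R w (y x))) = section_of y x)"
    by (rule near_mono[OF near_conj[OF y(2) near_coord_domain[OF vS v]]])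
      (simp add: section_of_def st_comm)
  ultimately show ?thesis by (rule hol_at_cong[rotated])
qed

lemma section_in_E01:
  assumes "near u (\<lambda>v. hol_at (\<lambda>x. - R w x) v y \<and> y v \<in> E)" "u \<noteq> - w"
  shows "section_of y \<in> E01_sections P u"
proof -
  have u: "u \<in> S2" using assms(1) by (rule near_S2)
  have 1: "near u (\<lambda>v. near v (\<lambda>x. y x \<in> E))" by (rule near_near, rule near_mono[OF assms(1)]) simp
  have "holomorphic_near (cscale \<i>) u (section_of y)"
    unfolding holomorphic_near_iff
    by (rule near_mono[OF near_conj[OF near_conj[OF assms(1) 1] near_coord_domain[OF u assms(2)]]])
      (auto intro: section_hol)
  moreover have "near u (\<lambda>v. section_of y v \<in> E01_fibre P v)"
    by (rule near_mono[OF assms(1)]) (auto intro: section_fibre)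
  ultimately show ?thesis by (simp add: E01_sections_def)
qed

lemma near_coord_finite:
  assumes "finite F" "u \<in> S2" "u \<noteq> - w"
  shows "near u (\<lambda>v. v = u \<or> (v \<noteq> - w \<and> coord w e v \<notin> F))"
proof -
  have "finite (S2 \<inter> {v. v \<noteq> - w \<and> coord w e v \<in> F})"
  proof -
    have "finite ((coord w e -` F) \<inter> (S2 - {- w}))"
      using finite_vimage_IntI[OF assms(1) coord_inj[OF fr]] .
    then show ?thesis by (rule finite_subset[rotated]) auto
  qed
  from near_conj[OF near_avoid[OF this assms(2)] near_coord_domain[OF assms(2,3)]]
  show ?thesis by (rule near_mono) auto
qed

lemma coord_nonzero_germ:
  assumes "near u (\<lambda>v. hol_at ((*) \<i>) v f)" "u \<noteq> - w" "finite F"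
    and "\<And>v. v \<in> S2 \<Longrightarrow> v \<noteq> - w \<Longrightarrow> f v = 0 \<Longrightarrow> coord w e v \<in> F"
  shows "f \<in> nonzero_germs u"
proof -
  have u: "u \<in> S2" using assms(1) by (rule near_S2)
  have "\<not> near u (\<lambda>v. f v = 0)"
  proof
    assume "near u (\<lambda>v. f v = 0)"
    from near_conj[OF this near_coord_finite[OF assms(3) u assms(2)]]
    have *: "near u (\<lambda>v. v = u)" by (rule near_mono) (use assms(4) in auto)
    show False using near_infinite[OF *, of "{u}"] by blast
  qed
  then show ?thesis using assms(1) by (simp add: nonzero_germs_def holomorphic_near_iff)
qed

lemma prod_list_zero_coord:
  "(\<Prod>l\<leftarrow>ls. 1 + c * l) = 0 \<Longrightarrow> c \<in> (\<lambda>l. - inverse l) ` set ls" for c :: complex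
proof (induction ls)
  case (Cons l ls)
  then show ?case
  proof (cases "1 + c * l = 0")
    case True
    then have "l \<noteq> 0" by auto
    then have "c = - inverse l" using True by (simp add: eq_neg_iff_add_eq_0 field_simps)
    then show ?thesis by simp
  qed auto
qed simp

lemma zero_kernel: "(\<lambda>_. 0) \<in> kernel_stalk P u" "(\<lambda>_. 0) \<in> cokernel_stalk P u" if "u \<in> S2"
proof -
  have z: "holomorphic_near (cscale \<i>) u (\<lambda>_. 0 :: 'a \<times> 'a)"
    unfolding holomorphic_near_iff using that by (intro near_triv hol_at_const linear_cscale)
  have "(0, 0) \<in> E01_fibre P v" if "v \<in> S2" for v
    using E01_fibre_iff[OF that, of "(0,0)"] that subspace_0[OF E] by (auto simp: R_simps intro!: bexI[of _ 0])
  then have "(\<lambda>_. 0) \<in> E01_sections P u"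
    using z that by (auto simp: E01_sections_def zero_prod_def intro: near_triv)
  moreover have "quot_map_C P 0 = 0" by (simp add: quot_map_C_def quot_map_perp zero_prod_def perp_simps linear_0[OF linear_perp[OF subU]])
  ultimately show "(\<lambda>_. 0) \<in> kernel_stalk P u" using that by (auto simp: kernel_stalk_def intro: near_triv)
  have "0 \<in> quot_space P \<times> quot_space P"
    unfolding Quot_eq using subspace_0[OF subspace_Quot] .
  then show "(\<lambda>_. 0) \<in> cokernel_stalk P u" using z that by (auto simp: cokernel_stalk_def intro: near_triv)
qed

lemma near_cscale_zero:
  fixes s :: "real^3 \<Rightarrow> 'a \<times> 'a"
  assumes "near u (\<lambda>v. cscale (g v) (s v) = 0)" "near u (\<lambda>v. s v \<noteq> 0)"
  shows "near u (\<lambda>v. g v = 0)"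
proof (rule near_mono[OF near_conj[OF assms]])
  fix v assume a: "cscale (g v) (s v) = 0 \<and> s v \<noteq> 0"
  have "complex_structure (UNIV :: ('a \<times> 'a) set) (cscale \<i>)"
    by (intro complex_structure.intro) (auto intro: linear_cscale)
  from complex_structure.csc_eq_0[OF this, of "s v" "g v"] show "g v = 0"
    using a by (simp flip: cscale_eq_csc)
qed

end

text \<open>The base point \<open>w\<close> is chosen such that \<open>L0\<close> is invertible with inverse \<open>G\<close>.  Then \<open>L v = (1 + c N) L0\<close> for
\<open>N = L1 G\<close>, and \<open>solve_up_to_torsion\<close> shows that the cokernel is torsion; the kernel vanishes except
possibly at \<open>u\<close>, where the factor \<open>c - c(u)\<close> takes care of it.\<close>

theorem torsion_pairI:
  fixes P :: "'a::euclidean_space qpair"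
  assumes P: "is_pair P" and fin: "finite (quat_module.complex_points (act P) (Sub P))"
    "finite {v \<in> S2. \<not> quat_module.spans_at (act P) (Sub P) (Car P) v}"
  shows "torsion_pair P"
  unfolding torsion_pair_def
proof (intro ballI)
  fix u :: "real^3" and m assume u: "u \<in> S2" and m: "m \<in> sheaf_stalk P u"
  let ?cp = "quat_module.complex_points (act P) (Sub P)"
  have q: "quat_module (Car P) (act P)" using P by (intro qspace_module) (simp add: is_pair_def)
  have "infinite (S2 - (?cp \<union> {v \<in> S2. \<not> quat_module.spans_at (act P) (Sub P) (Car P) v} \<union> {- u}))"
    using infinite_S2 fin by (intro Diff_infinite_finite) auto
  then obtain w where w: "w \<in> S2" "w \<notin> ?cp" "quat_module.spans_at (act P) (Sub P) (Car P) w" "w \<noteq> - u"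
    using infinite_imp_nonempty by blast
  then obtain e where "frame w e" using frame_exists by blast
  then interpret pair_pencil P w e using P by unfold_locales
  have uw: "u \<noteq> - w" using w(4) by auto
  obtain G where G: "linear G" "range G \<subseteq> E" "\<And>x. x \<in> E \<Longrightarrow> G (L0 x) = x" "\<And>z. G (cscale \<i> z) = - R w (G z)"
    by (rule complex_left_inverse[OF cE.complex_structure_axioms linear_L0 linear_cscale cscale_ii L0_complex L0_inj[OF w(2)]]) (assumption, rule that)
  have L0G: "L0 (G z) = z" if "z \<in> Quot \<times> Quot" for z using L0_surj[OF w(3) that] G(3) by auto
  define N where "N z = L1 (G z)" for z
  have glob: "N (cscale \<i> z) = cscale \<i> (N z)" for z by (simp add: N_def G(4) L1_complex_global)
  interpret Q: complex_endo "Quot \<times> Quot" "cscale \<i>" N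
  proof (intro complex_endo.intro cQ complex_endo_axioms.intro)
    show "linear N" unfolding N_def using linear_compose[OF G(1) linear_L1] by (simp add: o_def)
    show "N z \<in> Quot \<times> Quot" for z unfolding N_def using G(2) by (intro L1_in) auto
  qed (rule glob)
  obtain ls where ls: "\<And>z. z \<in> Quot \<times> Quot \<Longrightarrow> shift_prod (cscale \<i>) N ls z = 0" using Q.annihilating_list by blast
  obtain s \<omega> where m_eq: "m = (s, \<omega>)" "s \<in> kernel_stalk P u" "\<omega> \<in> cokernel_stalk P u"
    using m by (auto simp: sheaf_stalk_def)
  let ?c = "coord w e"
  have hc: "near u (\<lambda>v. hol_at ((*) \<i>) v ?c)" using holomorphic_near_coord[OF fr u uw] by (simp add: holomorphic_near_iff)
  have "near u (\<lambda>v. hol_at (cscale \<i>) v \<omega> \<and> \<omega> v \<in> Quot \<times> Quot \<and> shift_prod (cscale \<i>) N ls (\<omega> v) = 0)"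
  proof -
    have "near u (\<lambda>v. hol_at (cscale \<i>) v \<omega>)" "near u (\<lambda>v. \<omega> v \<in> Quot \<times> Quot)"
      using m_eq(3) unfolding cokernel_stalk_def holomorphic_near_iff Quot_eq by blast+
    from near_conj[OF this] show ?thesis by (rule near_mono) (simp add: ls)
  qed
  from Q.solve_up_to_torsion[OF glob hc this] obtain y where
    y: "near u (\<lambda>v. hol_at (cscale \<i>) v y \<and> y v \<in> Quot \<times> Quot \<and>
          cscale (\<Prod>l\<leftarrow>ls. 1 + ?c v * l) (\<omega> v) = y v + cscale (?c v) (N (y v)))"
    unfolding cscale_eq_csc[symmetric] by blast
  define f where "f v = (?c v - ?c u) * (\<Prod>l\<leftarrow>ls. 1 + ?c v * l)" for v
  define y' where "y' v = csc (\<lambda>x. - R w x) (?c v - ?c u) (G (y v))" for v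
  have hcu: "hol_at ((*) \<i>) v (\<lambda>v. ?c v - ?c u)" if "hol_at ((*) \<i>) v ?c" for v
    using hol_at_add[OF linear_ii that hol_at_const[OF linear_ii, of v "- ?c u"]] by simp
  have "near u (\<lambda>v. hol_at ((*) \<i>) v f)"
    unfolding f_def by (rule near_mono[OF hc]) (intro hol_at_mult hcu hol_at_prod_list)
  then have f: "f \<in> nonzero_germs u"
  proof (rule coord_nonzero_germ[OF _ uw])
    show "finite (insert (?c u) ((\<lambda>l. - inverse l) ` set ls))" by simp
    show "?c v \<in> insert (?c u) ((\<lambda>l. - inverse l) ` set ls)" if "f v = 0" for v
      using that prod_list_zero_coord[of "?c v" ls] unfolding f_def by auto
  qed
  have "near u (\<lambda>v. hol_at (\<lambda>x. - R w x) v y' \<and> y' v \<in> E)"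
  proof (rule near_mono[OF near_conj[OF y hc]])
    fix v assume a: "(hol_at (cscale \<i>) v y \<and> y v \<in> Quot \<times> Quot \<and>
          cscale (\<Prod>l\<leftarrow>ls. 1 + ?c v * l) (\<omega> v) = y v + cscale (?c v) (N (y v))) \<and> hol_at ((*) \<i>) v ?c"
    have GE: "G (y v) \<in> E" using G(2) by auto
    have "hol_at (\<lambda>x. - R w x) v (\<lambda>v. G (y v))"
      using a by (intro hol_at_linear[where N = G and I = "cscale \<i>", OF G(1,4)]) auto
    then show "hol_at (\<lambda>x. - R w x) v y' \<and> y' v \<in> E"
      unfolding y'_def using a hcu GE by (intro conjI cE.hol_at_csc cE.csc_in) auto
  qed
  then have sec: "section_of y' \<in> E01_sections P u" using uw by (rule section_in_E01)
  have "near u (\<lambda>v. cscale (f v) (\<omega> v) = quot_map_C P (section_of y' v))"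
  proof (rule near_mono[OF near_conj[OF y near_coord_domain[OF u uw]]])
    fix v assume v: "v \<in> S2" and a: "(hol_at (cscale \<i>) v y \<and> y v \<in> Quot \<times> Quot \<and>
          cscale (\<Prod>l\<leftarrow>ls. 1 + ?c v * l) (\<omega> v) = y v + cscale (?c v) (N (y v))) \<and> v \<noteq> - w"
    have GE: "G (y v) \<in> E" using G(2) by auto
    have "L v (G (y v)) = y v + cscale (?c v) (N (y v))"
      using a v GE L_eq L0G by (simp add: N_def)
    then have "L v (y' v) = cscale (?c v - ?c u) (cscale (\<Prod>l\<leftarrow>ls. 1 + ?c v * l) (\<omega> v))"
      using a v GE L_complex by (simp add: y'_def)
    also have "\<dots> = cscale (f v) (\<omega> v)" by (simp add: f_def cscale_def algebra_simps)
    finally show "cscale (f v) (\<omega> v) = quot_map_C P (section_of y' v)" by (simp add: quot_section)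
  qed
  then have co: "(\<lambda>v. cscale (f v) (\<omega> v)) \<in> cokernel_zero P u"
    using sec by (auto simp: cokernel_zero_def)
  have "near u (\<lambda>v. cscale (f v) (s v) = 0)"
  proof -
    have "near u (\<lambda>v. s v \<in> E01_fibre P v)" "near u (\<lambda>v. quot_map_C P (s v) = 0)"
      using m_eq(2) by (auto simp: kernel_stalk_def E01_sections_def)
    from near_conj[OF near_conj[OF this] near_avoid[OF fin(1) u]] show ?thesis
    proof (rule near_mono)
      fix v assume v: "v \<in> S2" and a: "(s v \<in> E01_fibre P v \<and> quot_map_C P (s v) = 0) \<and> (v = u \<or> v \<notin> ?cp)"
      then obtain x where x: "x \<in> E" "s v = (x, R v x)" using E01_fibre_iff by blast
      show "cscale (f v) (s v) = 0"
      proof (cases "v = u")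
        case True
        then show ?thesis by (simp add: f_def cscale_def prod_eq_iff)
      next
        case False
        have "x \<in> U" "R v x \<in> U"
          using a x perp_eq_0_iff[OF subU] by (auto simp: quot_map_C_def quot_map_perp prod_eq_iff)
        then have "x = 0" using a False v by (auto simp: complex_points_def)
        then show ?thesis using x by (simp add: R_simps cscale_def prod_eq_iff)
      qed
    qed
  qed
  then have "germ_smult f m \<in> sheaf_zero P u"
    using co by (simp add: sheaf_zero_def germ_smult_def m_eq kernel_zero_def)
  then show "\<exists>f\<in>nonzero_germs u. germ_smult f m \<in> sheaf_zero P u" using f by blast
qed

section \<open>Torsion and the pointwise behaviour of a pair\<close>

lemma perp_commutes_isometry:
  fixes S :: "'a::euclidean_space set" 
  assumes S: "subspace S" and I: "linear I" "\<And>x y. I x \<bullet> I y = x \<bullet> y" "\<And>x. I (I x) = - x" "\<And>x. x \<in> S \<Longrightarrow> I x \<in> S"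
  shows "perp S (I x) = I (perp S x)"
proof (rule perp_unique[OF S])
  have "I (perp S x) \<bullet> y = 0" if "y \<in> S" for y
  proof -
    have "I (perp S x) \<bullet> y = I (I (perp S x)) \<bullet> I y" by (simp only: I(2))
    also have "\<dots> = - (perp S x \<bullet> I y)" by (simp only: I(3) inner_minus_left)
    also have "\<dots> = 0" using perp(1)[OF S, of x] I(4)[OF that]
      by (simp add: orthogonal_comp_def orthogonal_def inner_commute)
    finally show ?thesis .
  qed
  then show "I (perp S x) \<in> S\<^sup>\<bottom>" by (simp add: orthogonal_comp_def orthogonal_def inner_commute)
  show "I x - I (perp S x) \<in> S"
    using I(4)[OF perp(2)[OF S, of x]] by (simp add: linear_diff[OF I(1)])
qed

context pair_pencil
begin

definition K where "K v = {x \<in> U. R v x \<in> U}"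

lemma K_subspace: "subspace (K v)"
  unfolding K_def subspace_def using subU
  by (auto simp: R_simps intro: subspace_add subspace_mul subspace_0)

text \<open>A complex linear pseudo-inverse \<open>\<Lambda>\<close> of \<open>L0\<close>: its image \<open>S\<close> is a complex complement of the kernel, and \<open>\<Lambda>\<close>
vanishes on the orthogonal complement of the image of \<open>L0\<close>.\<close>

definition partial_inverse :: "'a set \<Rightarrow> ('a \<times> 'a \<Rightarrow> 'a) \<Rightarrow> bool" where
  "partial_inverse S \<Lambda> \<longleftrightarrow> linear \<Lambda> \<and> (\<forall>z. \<Lambda> z \<in> S) \<and> complex_structure S (\<lambda>x. - R w x) \<and> S \<subseteq> E \<and>
     (\<forall>x\<in>S. \<Lambda> (L0 x) = x) \<and> (\<forall>z. \<Lambda> (cscale \<i> z) = - R w (\<Lambda> z)) \<and>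
     (\<forall>y\<in>E. y - \<Lambda> (L0 y) \<in> K w) \<and> (\<forall>z\<in>(L0 ` E)\<^sup>\<bottom>. \<Lambda> z = 0)"

lemma partial_inverse_exists: "\<exists>S \<Lambda>. partial_inverse S \<Lambda>"
proof -
  let ?I = "L0 ` E"
  have subI: "subspace ?I" by (rule linear_subspace_image[OF linear_L0 E])
  have iI: "cscale \<i> z \<in> ?I" if "z \<in> ?I" for z
  proof -
    obtain y where "y \<in> E" "z = L0 y" using \<open>z \<in> ?I\<close> by blast
    then show ?thesis using L0_complex[of y] cE.j_in by (metis imageI)
  qed
  obtain G0 where "range G0 \<subseteq> E \<and> linear G0 \<and> (\<forall>z\<in>?I. L0 (G0 z) = z)"
    using linear_exists_right_inverse_on[OF linear_L0 E] by blast
  then have G0: "range G0 \<subseteq> E" "linear G0" "\<And>z. z \<in> ?I \<Longrightarrow> L0 (G0 z) = z" by blast+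
  have G0E: "G0 z \<in> E" for z using G0(1) by auto
  define q where "q z = z - perp ?I z" for z
  have lin_q: "linear q" unfolding q_def by (intro linear_compose_sub linear_ident linear_perp subI)
  have qI: "q z \<in> ?I" for z unfolding q_def by (rule perp(2)[OF subI])
  have qid: "q z = z" if "z \<in> ?I" for z using perp_eq_0_iff[OF subI, THEN iffD2, OF that] by (simp add: q_def)
  have q0: "q z = 0" if "z \<in> ?I\<^sup>\<bottom>" for z using perp_id[OF subI that] by (simp add: q_def)
  have qi: "q (cscale \<i> z) = cscale \<i> (q z)" for z
  proof -
    have "cscale \<i> x \<bullet> cscale \<i> y = x \<bullet> y" for x y :: "'a \<times> 'a" by (simp add: cscale_def inner_prod_def)
    then have "perp ?I (cscale \<i> z) = cscale \<i> (perp ?I z)"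
      by (intro perp_commutes_isometry subI linear_cscale iI) auto
    then show ?thesis by (simp add: q_def linear_diff[OF linear_cscale])
  qed
  define G where "G z = (1/2) *\<^sub>R (G0 z + R w (G0 (cscale \<i> z)))" for z
  have lin_G: "linear G"
    by (rule linearI)
      (simp_all add: G_def linear_add[OF linear_cscale] linear_scale[OF linear_cscale]
         linear_add[OF G0(2)] linear_scale[OF G0(2)] R_simps algebra_simps)
  have GE: "G z \<in> E" for z unfolding G_def using G0E by (intro subspace_mul subspace_add E R_in)
  have Gi: "G (cscale \<i> z) = - R w (G z)" for z
    using G0E fS2 by (simp add: G_def linear_neg[OF G0(2)] R_simps R_unit algebra_simps)
  have LG: "L0 (G z) = z" if "z \<in> ?I" for z
  proof -
    have "L0 (- R w (G0 (cscale \<i> z))) = - z" using L0_complex[OF G0E] G0(3)[OF iI[OF that]] by simp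
    then have "L0 (R w (G0 (cscale \<i> z))) = z" by (simp add: linear_neg[OF linear_L0])
    then show ?thesis using G0(3)[OF that]
      by (simp add: G_def linear_add[OF linear_L0] linear_scale[OF linear_L0] flip: scaleR_2)
  qed
  define S where "S = G ` ?I"
  define \<Lambda> where "\<Lambda> z = G (q z)" for z
  have "complex_structure S (\<lambda>x. - R w x)"
  proof (rule complex_structure.intro)
    show "subspace S" unfolding S_def by (rule linear_subspace_image[OF lin_G subI])
    show "linear (\<lambda>x. - R w x)" by (rule cE.lin_j)
    show "- R w x \<in> S" if x: "x \<in> S" for x
    proof -
      obtain z where z: "z \<in> ?I" "x = G z" using x unfolding S_def by blast
      then have "- R w x = G (cscale \<i> z)" by (simp add: Gi)
      then show ?thesis unfolding S_def using iI[OF z(1)] by blast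
    qed
    show "- R w (- R w x) = - x" if "x \<in> S" for x
      using that GE by (intro cE.j_j) (auto simp: S_def)
  qed
  moreover have "\<Lambda> (L0 x) = x" if x: "x \<in> S" for x
  proof -
    obtain z where "z \<in> ?I" "x = G z" using x unfolding S_def by blast
    then show ?thesis using LG[of z] qid[of z] by (simp add: \<Lambda>_def)
  qed
  moreover have "y - \<Lambda> (L0 y) \<in> K w" if y: "y \<in> E" for y
  proof -
    have "L0 (y - \<Lambda> (L0 y)) = 0" using y LG[of "L0 y"] by (simp add: \<Lambda>_def qid linear_diff[OF linear_L0])
    then show ?thesis by (simp only: L0_eq_0_iff K_def) simp
  qed
  moreover have "linear \<Lambda>" unfolding \<Lambda>_def using linear_compose[OF lin_q lin_G] by (simp add: o_def)
  moreover have "\<Lambda> z \<in> S" for z using qI by (auto simp: \<Lambda>_def S_def)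
  moreover have "S \<subseteq> E" using GE by (auto simp: S_def)
  moreover have "\<Lambda> (cscale \<i> z) = - R w (\<Lambda> z)" for z by (simp add: \<Lambda>_def qi Gi)
  moreover have "\<Lambda> z = 0" if "z \<in> ?I\<^sup>\<bottom>" for z using q0[OF that] by (simp add: \<Lambda>_def linear_0[OF lin_G])
  ultimately show ?thesis unfolding partial_inverse_def by blast
qed

lemma linear_L: "linear (L v)"
  by (rule linearI) (simp_all add: L_def R_simps perp_simps)

lemma kernel_subspace: "subspace {y \<in> E. L v y = 0}"
  using E unfolding subspace_def
  by (auto simp: linear_add[OF linear_L] linear_scale[OF linear_L] linear_0[OF linear_L])

lemma dim_K: assumes "v \<in> S2" "v \<noteq> - w" shows "dim {y \<in> E. L v y = 0} = dim (K v)"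
proof -
  have nz: "st w v \<noteq> 0" by (rule st_nz[OF fr assms])
  have "inj_on (R (st w v)) {y \<in> E. L v y = 0}"
  proof (rule inj_onI)
    fix x y assume "x \<in> {y \<in> E. L v y = 0}" "y \<in> {y \<in> E. L v y = 0}" "R (st w v) x = R (st w v) y"
    then have "x - y \<in> E" "R (st w v) (x - y) = 0" by (auto simp: R_simps intro: subspace_diff E)
    then have "x - y = 0" using R_eq_0[OF _ _ nz] by blast
    then show "x = y" by simp
  qed
  moreover have "R (st w v) ` {y \<in> E. L v y = 0} = K v"
  proof
    show "R (st w v) ` {y \<in> E. L v y = 0} \<subseteq> K v"
    proof
      fix x assume "x \<in> R (st w v) ` {y \<in> E. L v y = 0}"
      then obtain y where "L v y = 0" "x = R (st w v) y" by blast
      then show "x \<in> K v" unfolding K_def L_eq_0_iff by simp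
    qed
    show "K v \<subseteq> R (st w v) ` {y \<in> E. L v y = 0}"
    proof
      fix x assume x: "x \<in> K v"
      then have xE: "x \<in> E" using UE by (auto simp: K_def)
      let ?y = "- (1 / (st w v \<bullet> st w v)) *\<^sub>R R (st w v) x"
      have eq: "R (st w v) ?y = x" by (rule R_inverse[OF xE nz])
      have "?y \<in> E" by (intro subspace_mul E R_in xE)
      moreover have "L v ?y = 0" using eq x unfolding L_eq_0_iff by (simp add: K_def)
      ultimately show "x \<in> R (st w v) ` {y \<in> E. L v y = 0}" using eq by (intro image_eqI[of _ _ ?y]) auto
    qed
  qed
  moreover have "span {y \<in> E. L v y = 0} = {y \<in> E. L v y = 0}" using kernel_subspace by (rule span_eq_iff[THEN iffD2])
  ultimately show ?thesis
    using dim_image_eq[OF linear_R, of "st w v" "{y \<in> E. L v y = 0}"] by metis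
qed

end

text \<open>The base point \<open>w\<close> is one where the kernel of the map to the quotient has smallest dimension.  Near \<open>w\<close> the kernel
then has this dimension, hence \<open>S\<close> is a complement of it, and \<open>\<Lambda> (L v y) = 0\<close> implies \<open>L v y = 0\<close>
(\<open>L_zero\<close>).\<close>

locale minimal_pencil = pair_pencil +
  fixes S :: "'a set" and \<Lambda> :: "'a \<times> 'a \<Rightarrow> 'a"
  assumes minK: "v \<in> S2 \<Longrightarrow> dim (K w) \<le> dim (K v)" and pinv: "partial_inverse S \<Lambda>"
begin

lemma lin_\<Lambda>: "linear \<Lambda>" and \<Lambda>_in: "\<Lambda> z \<in> S" and cS: "complex_structure S (\<lambda>x. - R w x)" and SE: "S \<subseteq> E"
  and \<Lambda>_L0: "x \<in> S \<Longrightarrow> \<Lambda> (L0 x) = x" and \<Lambda>_ii: "\<Lambda> (cscale \<i> z) = - R w (\<Lambda> z)"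
  and \<Lambda>_K: "y \<in> E \<Longrightarrow> y - \<Lambda> (L0 y) \<in> K w" and \<Lambda>_perp: "z \<in> (L0 ` E)\<^sup>\<bottom> \<Longrightarrow> \<Lambda> z = 0"
  using pinv unfolding partial_inverse_def by blast+

definition N where "N x = \<Lambda> (L1 x)"

lemma N_glob: "N (- R w x) = - R w (N x)"
  by (simp add: N_def L1_complex_global \<Lambda>_ii)

sublocale N: complex_endo S "\<lambda>x. - R w x" N
proof (intro complex_endo.intro cS complex_endo_axioms.intro)
  show "linear N" unfolding N_def using linear_compose[OF linear_L1 lin_\<Lambda>] by (simp add: o_def)
qed (auto simp: N_def \<Lambda>_in L1_complex_global \<Lambda>_ii)

lemma \<Lambda>_cscale: "\<Lambda> (cscale c z) = csc (\<lambda>x. - R w x) c (\<Lambda> z)"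
  unfolding cscale_eq_csc[of c] csc_def by (simp add: linear_add[OF lin_\<Lambda>] linear_scale[OF lin_\<Lambda>] linear_diff[OF lin_\<Lambda>] \<Lambda>_ii)

lemma w_not: "w \<noteq> - w"
  using fS2(1) by (auto simp: S2_def eq_neg_iff_add_eq_0 simp flip: scaleR_2)

lemma \<Lambda>_L: assumes "y \<in> E" "v \<in> S2" "v \<noteq> - w"
  shows "\<Lambda> (L v y) = \<Lambda> (L0 y) + csc (\<lambda>x. - R w x) (coord w e v) (N y)"
  using L_eq[OF assms] by (simp add: linear_add[OF lin_\<Lambda>] \<Lambda>_cscale N_def)

definition good where
  "good v \<longleftrightarrow> v \<in> S2 \<and> v \<noteq> - w \<and> (\<forall>x\<in>S. x + csc (\<lambda>x. - R w x) (coord w e v) (N x) = 0 \<longrightarrow> x = 0)"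

lemma near_good: "near w good"
proof -
  let ?F = "{c. \<exists>x\<in>S. x \<noteq> 0 \<and> x + csc (\<lambda>x. - R w x) c (N x) = 0}"
  have "near w (\<lambda>v. (v = w \<or> v \<noteq> - w \<and> coord w e v \<notin> ?F) \<and> v \<noteq> - w)"
    by (intro near_conj near_coord_finite N.finite_singular fS2(1) w_not near_coord_domain)
  moreover have "0 \<notin> ?F" by simp
  ultimately show ?thesis
    unfolding good_def using coord_w[OF fr] by (elim near_mono) auto
qed

lemma L_zero: assumes v: "good v" and y: "y \<in> E" "\<Lambda> (L v y) = 0" shows "L v y = 0"
proof -
  have vS: "v \<in> S2" "v \<noteq> - w" using v by (auto simp: good_def)
  let ?Kv = "{y \<in> E. L v y = 0}"
  have LS: "x = 0" if "x \<in> S" "\<Lambda> (L v x) = 0" for x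
  proof -
    have "x + csc (\<lambda>x. - R w x) (coord w e v) (N x) = 0"
      using that \<Lambda>_L[OF _ vS, of x] SE \<Lambda>_L0 by auto
    then show ?thesis using v that(1) by (auto simp: good_def)
  qed
  note lin = linear_add[OF linear_L] and L0' = linear_0[OF linear_L] and subKv = kernel_subspace[of v]
  have int1: "?Kv \<inter> S \<subseteq> {0}" using LS linear_0[OF lin_\<Lambda>] by auto
  have KwE: "K w \<subseteq> E" using UE by (auto simp: K_def)
  have d1: "dim E \<le> dim (K w) + dim S"
  proof -
    have "E \<subseteq> {a + b |a b. a \<in> K w \<and> b \<in> S}"
    proof
      fix y assume "y \<in> E"
      then have "y = (y - \<Lambda> (L0 y)) + \<Lambda> (L0 y)" "y - \<Lambda> (L0 y) \<in> K w" "\<Lambda> (L0 y) \<in> S" using \<Lambda>_K \<Lambda>_in by auto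
      then show "y \<in> {a + b |a b. a \<in> K w \<and> b \<in> S}" by blast
    qed
    then have "dim E \<le> dim {a + b |a b. a \<in> K w \<and> b \<in> S}" by (rule dim_subset)
    then show ?thesis using dim_sums_Int[OF K_subspace N.S, of w] by linarith
  qed
  have "dim {a + b |a b. a \<in> ?Kv \<and> b \<in> S} + dim (?Kv \<inter> S) = dim ?Kv + dim S"
    by (rule dim_sums_Int[OF subKv N.S])
  moreover have "dim (?Kv \<inter> S) = 0" using int1 by (simp only: dim_eq_0)
  moreover have "dim ?Kv \<ge> dim (K w)" using dim_K[OF vS] minK[OF vS(1)] by simp
  ultimately have "dim E \<le> dim {a + b |a b. a \<in> ?Kv \<and> b \<in> S}" using d1 by linarith
  moreover have "{a + b |a b. a \<in> ?Kv \<and> b \<in> S} \<subseteq> E" using SE E by (auto intro: subspace_add)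
  ultimately have "{a + b |a b. a \<in> ?Kv \<and> b \<in> S} = E"
    by (intro subspace_dim_equal subspace_sums subKv N.S E) auto
  then obtain a b where ab: "y = a + b" "a \<in> ?Kv" "b \<in> S" using y(1) by blast
  then have "L v y = L v b" using lin by simp
  then have "b = 0" using LS[OF ab(3)] y(2) by simp
  then show ?thesis using \<open>L v y = L v b\<close> L0' by simp
qed

lemma near_hol_coord: "near w (\<lambda>v. hol_at ((*) \<i>) v (coord w e))"
  using holomorphic_near_coord[OF fr fS2(1) w_not] by (simp add: holomorphic_near_iff)

text \<open>A nonzero \<open>k\<close> in the kernel at \<open>w\<close> extends to a germ \<open>Y = f k + y\<close> of the kernel sheaf: \<open>y\<close> solves
\<open>(1 + c N) y = - f c N k\<close>, where \<open>f\<close> is provided by \<open>solve_up_to_torsion\<close> and has the value \<open>1\<close> at \<open>w\<close>.  As \<open>Y\<close> has no zeros near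
\<open>w\<close>, it is not torsion.\<close>

lemma K_trivial: assumes "torsion_pair P" shows "K w = {0}"
proof (rule ccontr)
  assume "K w \<noteq> {0}"
  then obtain k where k: "k \<in> K w" "k \<noteq> 0" using subspace_0[OF K_subspace] by blast
  let ?j = "\<lambda>x. - R w x"
  let ?c = "coord w e"
  have kE: "k \<in> E" using k UE by (auto simp: K_def)
  have L0k: "L0 k = 0" using k L0_eq_0_iff by (simp add: K_def)
  obtain ls where ls: "\<And>z. z \<in> S \<Longrightarrow> shift_prod ?j N ls z = 0" using N.annihilating_list by blast
  define \<omega> where "\<omega> v = csc ?j (- ?c v) (N k)" for v
  have NkS: "N k \<in> S" by (simp add: N_def \<Lambda>_in)
  have "near w (\<lambda>v. hol_at ?j v \<omega> \<and> \<omega> v \<in> S \<and> shift_prod ?j N ls (\<omega> v) = 0)"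
  proof (rule near_mono[OF near_hol_coord])
    fix v assume h: "hol_at ((*) \<i>) v ?c"
    have "hol_at ((*) \<i>) v (\<lambda>v. (- 1) * ?c v)" by (intro hol_at_mult h hol_at_const linear_ii)
    then have "hol_at ((*) \<i>) v (\<lambda>v. - ?c v)" by simp
    then have "hol_at ?j v \<omega>" unfolding \<omega>_def by (intro N.hol_at_csc hol_at_const N.lin_j NkS)
    moreover have "\<omega> v \<in> S" using N.csc_in[OF NkS] by (simp add: \<omega>_def)
    ultimately show "hol_at ?j v \<omega> \<and> \<omega> v \<in> S \<and> shift_prod ?j N ls (\<omega> v) = 0" using ls by blast
  qed
  from N.solve_up_to_torsion[OF N_glob near_hol_coord this] obtain y where
    y: "near w (\<lambda>v. hol_at ?j v y \<and> y v \<in> S \<and> csc ?j (\<Prod>l\<leftarrow>ls. 1 + ?c v * l) (\<omega> v) = y v + csc ?j (?c v) (N (y v)))"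
    by blast
  define f where "f v = (\<Prod>l\<leftarrow>ls. 1 + ?c v * l)" for v
  define Y where "Y v = csc ?j (f v) k + y v" for v
  have f0: "near w (\<lambda>v. f v \<noteq> 0)"
  proof -
    have "near w (\<lambda>v. v = w \<or> v \<noteq> - w \<and> ?c v \<notin> (\<lambda>l. - inverse l) ` set ls)"
      by (intro near_coord_finite fS2(1) w_not) simp
    moreover have "f w = 1" by (simp add: f_def coord_w[OF fr] map_replicate_const prod_list_replicate)
    ultimately show ?thesis using prod_list_zero_coord by (elim near_mono) (auto simp: f_def)
  qed
  have holY: "near w (\<lambda>v. hol_at ?j v Y \<and> Y v \<in> E)"
  proof (rule near_mono[OF near_conj[OF y near_hol_coord]])
    fix v assume a: "(hol_at ?j v y \<and> y v \<in> S \<and> csc ?j (\<Prod>l\<leftarrow>ls. 1 + ?c v * l) (\<omega> v) = y v + csc ?j (?c v) (N (y v)))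
       \<and> hol_at ((*) \<i>) v ?c"
    have "hol_at ?j v (\<lambda>v. csc ?j (f v) k)"
      unfolding f_def using a by (intro cE.hol_at_csc hol_at_const cE.lin_j kE hol_at_prod_list) auto
    then have "hol_at ?j v Y" unfolding Y_def using a by (intro hol_at_add cE.lin_j) auto
    moreover have "Y v \<in> E" unfolding Y_def using a SE by (intro subspace_add E cE.csc_in kE) auto
    ultimately show "hol_at ?j v Y \<and> Y v \<in> E" by blast
  qed
  have LY: "near w (\<lambda>v. L v (Y v) = 0)"
  proof (rule near_mono[OF near_conj[OF near_conj[OF y holY] near_good]])
    fix v assume a: "((hol_at ?j v y \<and> y v \<in> S \<and> csc ?j (\<Prod>l\<leftarrow>ls. 1 + ?c v * l) (\<omega> v) = y v + csc ?j (?c v) (N (y v))) \<and>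
        hol_at ?j v Y \<and> Y v \<in> E) \<and> good v"
    then have vS: "v \<in> S2" "v \<noteq> - w" and yS: "y v \<in> S" "y v \<in> E" using SE by (auto simp: good_def)
    have 1: "L v (csc ?j (f v) k) = cscale (f v * ?c v) (L1 k)"
      using L_complex[OF kE vS] L_eq[OF kE vS] L0k by (simp add: cscale_def algebra_simps)
    have "\<Lambda> (L v (Y v)) = csc ?j (f v * ?c v) (N k) + (y v + csc ?j (?c v) (N (y v)))"
    proof -
      have "L v (Y v) = L v (csc ?j (f v) k) + L v (y v)" by (simp add: Y_def L_def R_simps perp_simps)
      then show ?thesis
        using \<Lambda>_L[OF yS(2) vS] \<Lambda>_L0[OF yS(1)] by (simp add: 1 linear_add[OF lin_\<Lambda>] \<Lambda>_cscale N_def)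
    qed
    also have "y v + csc ?j (?c v) (N (y v)) = csc ?j (f v) (\<omega> v)" using a by (simp add: f_def)
    also have "\<dots> = - csc ?j (f v * ?c v) (N k)"
      unfolding \<omega>_def N.csc_mult[OF NkS, symmetric] N.csc_minus[symmetric] by simp
    finally have "\<Lambda> (L v (Y v)) = 0" by simp
    then show "L v (Y v) = 0" using L_zero a by blast
  qed
  have sec: "section_of Y \<in> kernel_stalk P w"
    unfolding kernel_stalk_def using section_in_E01[OF holY w_not] LY by (simp add: quot_section)
  have "(section_of Y, \<lambda>_. 0) \<in> sheaf_stalk P w"
    using sec zero_kernel(2)[OF fS2(1)] by (simp add: sheaf_stalk_def)
  then obtain g where g: "g \<in> nonzero_germs w" "germ_smult g (section_of Y, \<lambda>_. 0) \<in> sheaf_zero P w"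
    using assms fS2(1) unfolding torsion_pair_def by blast
  then have g0: "near w (\<lambda>v. cscale (g v) (section_of Y v) = 0)"
    by (simp add: sheaf_zero_def germ_smult_def kernel_zero_def)
  have "near w (\<lambda>v. section_of Y v \<noteq> 0)"
  proof (rule near_mono[OF near_conj[OF near_conj[OF y holY] near_conj[OF f0 near_coord_domain[OF fS2(1) w_not]]]])
    fix v assume vS: "v \<in> S2" and a: "((hol_at ?j v y \<and> y v \<in> S \<and> csc ?j (\<Prod>l\<leftarrow>ls. 1 + ?c v * l) (\<omega> v) = y v + csc ?j (?c v) (N (y v))) \<and>
        hol_at ?j v Y \<and> Y v \<in> E) \<and> f v \<noteq> 0 \<and> v \<noteq> - w"
    have "Y v \<noteq> 0"
    proof
      assume "Y v = 0"
      then have yv: "y v = csc ?j (- f v) k" by (simp add: Y_def cE.csc_minus eq_neg_iff_add_eq_0 add.commute)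
      moreover have "L0 (csc ?j (- f v) k) = cscale (- f v) (L0 k)"
        unfolding cscale_eq_csc[of "- f v"] L0_complex[OF kE, symmetric] csc_def
        by (simp only: linear_add[OF linear_L0] linear_scale[OF linear_L0])
      ultimately have "L0 (y v) = cscale (- f v) (L0 k)" by simp
      then have "\<Lambda> (L0 (y v)) = 0" by (simp add: L0k cscale_def linear_0[OF lin_\<Lambda>] flip: zero_prod_def)
      then have "y v = 0" using \<Lambda>_L0 a by auto
      then have "csc ?j (- f v) k = 0" using yv by simp
      then show False using cE.csc_eq_0[OF kE] a k by fastforce
    qed
    then show "section_of Y v \<noteq> 0"
      using R_eq_0[OF _ _ st_nz[OF fr vS]] a by (auto simp: section_of_def zero_prod_def)
  qed
  then have "near w (\<lambda>v. g v = 0)" by (rule near_cscale_zero[OF g0])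
  then show False using g(1) by (simp add: nonzero_germs_def)
qed

text \<open>A vector \<open>z0\<close> of the quotient orthogonal to the image of \<open>L0\<close> gives a constant germ of the cokernel.  If
\<open>g z0 = L v y\<close> then \<open>\<Lambda> (L v y) = 0\<close>, so \<open>g z0 = 0\<close>; thus the germ is torsion only if \<open>z0 = 0\<close>.\<close>

lemma spans_w: assumes "torsion_pair P" shows "spans_at U E w"
proof -
  let ?I = "L0 ` E"
  have subI: "subspace ?I" by (rule linear_subspace_image[OF linear_L0 E])
  have IQ: "?I \<subseteq> Quot \<times> Quot" using L0_in by blast
  have "Quot \<times> Quot \<subseteq> ?I"
  proof
    fix z assume z: "z \<in> Quot \<times> Quot"
    define z0 where "z0 = perp ?I z"
    have z0Q: "z0 \<in> Quot \<times> Quot" unfolding z0_def by (rule perp_in[OF subI subspace_Quot IQ z])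
    have z0: "\<Lambda> z0 = 0" unfolding z0_def by (rule \<Lambda>_perp[OF perp(1)[OF subI]])
    have "z0 = 0"
    proof (rule ccontr)
      assume "z0 \<noteq> 0"
      have "holomorphic_near (cscale \<i>) w (\<lambda>_. z0)"
        unfolding holomorphic_near_iff by (intro near_triv fS2(1) hol_at_const linear_cscale)
      then have "(\<lambda>_. z0) \<in> cokernel_stalk P w"
        using z0Q by (auto simp: cokernel_stalk_def Quot_eq intro: near_triv fS2(1))
      then have "(\<lambda>_. 0, \<lambda>_. z0) \<in> sheaf_stalk P w"
        using zero_kernel(1)[OF fS2(1)] by (simp add: sheaf_stalk_def)
      then obtain g where g: "g \<in> nonzero_germs w" "germ_smult g (\<lambda>_. 0, \<lambda>_. z0) \<in> sheaf_zero P w"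
        using assms fS2(1) unfolding torsion_pair_def by blast
      then obtain s where s: "s \<in> E01_sections P w" "near w (\<lambda>v. cscale (g v) z0 = quot_map_C P (s v))"
        by (auto simp: sheaf_zero_def germ_smult_def cokernel_zero_def)
      have sf: "near w (\<lambda>v. s v \<in> E01_fibre P v)" using s(1) by (simp add: E01_sections_def)
      have "near w (\<lambda>v. cscale (g v) z0 = 0)"
      proof (rule near_mono[OF near_conj[OF near_conj[OF s(2) sf] near_good]])
        fix v assume a: "(cscale (g v) z0 = quot_map_C P (s v) \<and> s v \<in> E01_fibre P v) \<and> good v"
        then have vS: "v \<in> S2" "v \<noteq> - w" by (auto simp: good_def)
        obtain y where y: "y \<in> E" "s v = section_of (\<lambda>_. y) v" using fibre_section[OF _ vS] a by blast
        then have eq: "cscale (g v) z0 = L v y" using a by (simp add: quot_section)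
        then have "\<Lambda> (L v y) = 0" by (simp add: \<Lambda>_cscale z0 flip: eq)
        then show "cscale (g v) z0 = 0" using eq L_zero y(1) a by simp
      qed
      then have "near w (\<lambda>v. g v = 0)"
        using near_cscale_zero[of w g "\<lambda>_. z0"] \<open>z0 \<noteq> 0\<close> fS2(1) by (auto intro: near_triv)
      then show False using g(1) by (simp add: nonzero_germs_def)
    qed
    then show "z \<in> ?I" using perp_eq_0_iff[OF subI] by (simp add: z0_def)
  qed
  show ?thesis
    unfolding spans_at_def
  proof
    fix x assume x: "x \<in> E"
    have "0 \<in> Quot" using subspace_0[OF subspace_Quot] by (simp add: zero_prod_def)
    then have "(perp U x, 0) \<in> Quot \<times> Quot" using perp_Quot[OF x] by simp
    then obtain y where y: "y \<in> E" "L0 y = (perp U x, 0)" using \<open>Quot \<times> Quot \<subseteq> ?I\<close> by (metis imageE subsetD)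
    then have "perp U (x - R w ((1/2) *\<^sub>R y)) = 0" "perp U y = 0" by (auto simp: L0_def R_simps perp_simps)
    then have "x - R w ((1/2) *\<^sub>R y) \<in> U" "(1/2) *\<^sub>R y \<in> U" using perp_eq_0_iff[OF subU] by (auto intro: subspace_mul subU)
    moreover have "x = (x - R w ((1/2) *\<^sub>R y)) + R w ((1/2) *\<^sub>R y)" by simp
    ultimately show "\<exists>a\<in>U. \<exists>b\<in>U. x = a + R w b" by blast
  qed
qed

end

theorem torsion_pairD:
  fixes P :: "'a::euclidean_space qpair"
  assumes P: "is_pair P" and t: "torsion_pair P"
  shows "\<exists>w\<in>S2. w \<notin> quat_module.complex_points (act P) (Sub P) \<and> quat_module.spans_at (act P) (Sub P) (Car P) w"
proof -
  let ?K = "\<lambda>v. {x \<in> Sub P. act P v x \<in> Sub P}"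
  obtain w where w: "w \<in> S2" "\<And>v. v \<in> S2 \<Longrightarrow> dim (?K w) \<le> dim (?K v)"
    using ex_has_least_nat[of "\<lambda>v. v \<in> S2" _ "\<lambda>v. dim (?K v)"] infinite_imp_nonempty[OF infinite_S2] by blast
  obtain e where "frame w e" using frame_exists w by blast
  then interpret pair_pencil P w e using P by unfold_locales
  obtain S \<Lambda> where S: "partial_inverse S \<Lambda>" using partial_inverse_exists by blast
  interpret minimal_pencil P w e S \<Lambda> using w S by unfold_locales (auto simp: K_def)
  have "w \<notin> complex_points U" using K_trivial[OF t] by (auto simp: complex_points_def K_def)
  then show ?thesis using spans_w[OF t] w by blast
qed

text \<open>Let \<open>x\<close> and \<open>R w x\<close> be in \<open>U\<close>.  In the coordinate \<open>c\<close> at \<open>w\<close> the section of \<open>E01\<close> given by \<open>x\<close> has the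
image \<open>c (L1 x)\<close>, so the constant germ \<open>L1 x\<close> of the cokernel is annihilated by \<open>c\<close>.  In a torsion free pair it
is therefore the image of a section \<open>s\<close>, and the difference of the section of \<open>x\<close> and of \<open>c s\<close> is in the
kernel.  The morphism \<open>h\<close> sends this difference to \<open>V\<close>, where the kernel is zero except at finitely many points; in
the limit towards \<open>w\<close>, where \<open>c s\<close> vanishes, one obtains \<open>h x = 0\<close>.\<close>

theorem torsion_free_no_jump:
  fixes P :: "'a::euclidean_space qpair"
  assumes P: "is_pair P" and t: "torsion_free_pair P"
    and h: "linear h" "\<And>x. x \<in> Car P \<Longrightarrow> h x \<in> Car P" "\<And>x t. x \<in> Car P \<Longrightarrow> h (act P t x) = act P t (h x)"
    and V: "h ` Sub P \<subseteq> V" "finite (quat_module.complex_points (act P) V)"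
    and w: "w \<in> S2" and x: "x \<in> Sub P" "act P w x \<in> Sub P"
  shows "h x = 0"
proof -
  obtain e where "frame w e" using frame_exists w by blast
  then interpret pair_pencil P w e using P by unfold_locales
  let ?c = "coord w e"
  have ww: "w \<noteq> - w" using fS2(1) by (auto simp: S2_def eq_neg_iff_add_eq_0 simp flip: scaleR_2)
  have xE: "x \<in> E" using x UE by auto
  have L0x: "L0 x = 0" using x L0_eq_0_iff by simp
  have Lx: "L v x = cscale (?c v) (L1 x)" if "v \<in> S2" "v \<noteq> - w" for v
    using L_eq[OF xE that] L0x by simp
  have hc: "near w (\<lambda>v. hol_at ((*) \<i>) v ?c)" using holomorphic_near_coord[OF fr fS2(1) ww] by (simp add: holomorphic_near_iff)
  then have c: "?c \<in> nonzero_germs w"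
    by (rule coord_nonzero_germ[OF _ ww, of _ "{0}"]) auto
  have dom: "near w (\<lambda>v. v \<noteq> - w)" by (rule near_coord_domain[OF fS2(1) ww])
  have "holomorphic_near (cscale \<i>) w (\<lambda>_. L1 x)"
    unfolding holomorphic_near_iff by (intro near_triv fS2(1) hol_at_const linear_cscale)
  then have "(\<lambda>_. L1 x) \<in> cokernel_stalk P w"
    using L1_in[OF xE] by (auto simp: cokernel_stalk_def Quot_eq intro: near_triv fS2(1))
  then have st: "(\<lambda>_. 0, \<lambda>_. L1 x) \<in> sheaf_stalk P w"
    using zero_kernel(1)[OF fS2(1)] by (simp add: sheaf_stalk_def)
  have "near w (\<lambda>v. hol_at (\<lambda>x. - R w x) v (\<lambda>_. x) \<and> x \<in> E)"
    using xE by (intro near_triv fS2(1) conjI hol_at_const cE.lin_j)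
  then have "section_of (\<lambda>_. x) \<in> E01_sections P w" by (rule section_in_E01) (rule ww)
  moreover have "near w (\<lambda>v. cscale (?c v) (L1 x) = quot_map_C P (section_of (\<lambda>_. x) v))"
    by (rule near_mono[OF dom]) (simp add: quot_section Lx)
  ultimately have "(\<lambda>v. cscale (?c v) (L1 x)) \<in> cokernel_zero P w" by (auto simp: cokernel_zero_def)
  moreover have "cscale c (0 :: 'a \<times> 'a) = 0" for c by (simp add: cscale_def prod_eq_iff)
  ultimately have "germ_smult ?c (\<lambda>_. 0, \<lambda>_. L1 x) \<in> sheaf_zero P w"
    using fS2(1) by (auto simp: sheaf_zero_def germ_smult_def kernel_zero_def intro: near_triv)
  then have "(\<lambda>_. 0, \<lambda>_. L1 x) \<in> sheaf_zero P w" using t c st fS2(1) unfolding torsion_free_pair_def by blast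
  then obtain s where s: "s \<in> E01_sections P w" "near w (\<lambda>v. L1 x = quot_map_C P (s v))"
    by (auto simp: sheaf_zero_def cokernel_zero_def)
  have sf: "near w (\<lambda>v. s v \<in> E01_fibre P v)" and sh: "near w (\<lambda>v. hol_at (cscale \<i>) v s)"
    using s(1) by (auto simp: E01_sections_def holomorphic_near_iff)
  define d where "d v = R (st w v) (h x) - (Re (?c v) *\<^sub>R h (fst (s v)) - Im (?c v) *\<^sub>R R v (h (fst (s v))))" for v
  have d0: "near w (\<lambda>v. v = w \<or> d v = 0)"
  proof (rule near_mono[OF near_conj[OF near_conj[OF s(2) sf] near_conj[OF dom near_avoid[OF V(2) fS2(1)]]]])
    fix v assume v: "v \<in> S2" and a: "(L1 x = quot_map_C P (s v) \<and> s v \<in> E01_fibre P v) \<and> v \<noteq> - w \<and> (v = w \<or> v \<notin> complex_points V)"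
    obtain s1 where s1: "s1 \<in> E" "s v = (s1, R v s1)" using a E01_fibre_iff[OF v] by blast
    define z where "z = R (st w v) x - (Re (?c v) *\<^sub>R s1 - Im (?c v) *\<^sub>R R v s1)"
    have "L v x = cscale (?c v) (quot_map_C P (s v))" using Lx[OF v] a by simp
    then have "perp U (R (st w v) x) = Re (?c v) *\<^sub>R perp U s1 - Im (?c v) *\<^sub>R perp U (R v s1)"
      "perp U (R v (R (st w v) x)) = Re (?c v) *\<^sub>R perp U (R v s1) + Im (?c v) *\<^sub>R perp U s1"
      by (auto simp: s1 L_def quot_map_C_def quot_map_perp cscale_Pair)
    then have "perp U z = 0" "perp U (R v z) = 0"
      using s1(1) R_unit[OF _ v] by (simp_all add: z_def perp_simps R_simps)
    then have zU: "z \<in> U" "R v z \<in> U" using perp_eq_0_iff[OF subU] by auto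
    then have "h z \<in> V" "h (R v z) \<in> V" using V(1) by auto
    moreover have "h (R v z) = R v (h z)" using h(3) zU UE by auto
    moreover have "h z = d v"
      using h(3) s1 xE by (simp add: z_def d_def linear_diff[OF h(1)] linear_scale[OF h(1)])
    ultimately show "v = w \<or> d v = 0" using a v by (auto simp: complex_points_def)
  qed
  have ev: "\<forall>\<^sub>F v in at w within S2. d v = 0"
    using d0 unfolding near_iff eventually_at_filter by (auto elim: eventually_mono)
  have bb: "bounded_bilinear R" using bil by (simp add: bilinear_conv_bounded_bilinear)
  have bh: "bounded_linear h" using h(1) by (simp add: linear_conv_bounded_linear)
  have conts: "(s \<longlongrightarrow> s w) (at w within S2)" 
  proof -
    obtain D where "(s has_derivative D) (at w within S2)" using near_self[OF sh] by (auto simp: hol_at_def)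
    then show ?thesis using has_derivative_continuous continuous_within by blast
  qed
  have contc: "(?c \<longlongrightarrow> ?c w) (at w within S2)" 
  proof -
    obtain D where "(?c has_derivative D) (at w within S2)" using near_self[OF hc] by (auto simp: hol_at_def)
    then show ?thesis using has_derivative_continuous continuous_within by blast
  qed
  have contm: "(st w \<longlongrightarrow> st w w) (at w within S2)"
    using has_derivative_continuous[OF st_has_derivative[OF fS2(1) fS2(1) ww]] by (simp add: continuous_within)
  have "(d \<longlongrightarrow> d w) (at w within S2)"
    unfolding d_def
    by (intro tendsto_diff tendsto_scaleR bounded_bilinear.tendsto[OF bb] bounded_linear.tendsto[OF bh]
        tendsto_fst conts contm tendsto_Re tendsto_Im contc tendsto_const tendsto_ident_at)
  moreover have "(d \<longlongrightarrow> 0) (at w within S2)" using tendsto_eventually[OF ev] .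
  moreover have "at w within S2 \<noteq> bot" using S2_islimpt[OF fS2(1)] by (simp add: trivial_limit_within)
  ultimately have "d w = 0" using tendsto_unique by blast
  then have "R (st w w) (h x) = 0" by (simp add: d_def coord_w[OF fr])
  then show ?thesis using R_eq_0[OF h(2)[OF xE] _ st_nz[OF fr fS2(1) ww]] by blast
qed

section \<open>Traces of nilpotent operators\<close>

definition trace_of :: "('a::euclidean_space \<Rightarrow> 'a) \<Rightarrow> real" where
  "trace_of f = (\<Sum>i\<in>Basis. f i \<bullet> i)"

lemma trace_comm:
  fixes f g :: "'a::euclidean_space \<Rightarrow> 'a"
  assumes "linear f" "linear g" shows "trace_of (\<lambda>x. f (g x)) = trace_of (\<lambda>x. g (f x))"
proof -
  have expand: "h (k i) \<bullet> i = (\<Sum>d\<in>Basis. (k i \<bullet> d) * (h d \<bullet> i))" if "linear h" for h k :: "'a \<Rightarrow> 'a" and i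
  proof -
    have "h (k i) = h (\<Sum>d\<in>Basis. (k i \<bullet> d) *\<^sub>R d)" by (simp add: euclidean_representation)
    also have "\<dots> = (\<Sum>d\<in>Basis. (k i \<bullet> d) *\<^sub>R h d)" by (simp add: linear_sum[OF that] linear_scale[OF that])
    finally show ?thesis by (simp add: inner_sum_left)
  qed
  have "trace_of (\<lambda>x. f (g x)) = (\<Sum>i\<in>Basis. \<Sum>d\<in>Basis. (g i \<bullet> d) * (f d \<bullet> i))"
    by (simp add: trace_of_def expand[OF assms(1)])
  also have "\<dots> = (\<Sum>d\<in>Basis. \<Sum>i\<in>Basis. (f d \<bullet> i) * (g i \<bullet> d))"
    by (subst sum.swap) (simp add: mult.commute)
  also have "\<dots> = trace_of (\<lambda>x. g (f x))" by (simp add: trace_of_def expand[OF assms(2)])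
  finally show ?thesis .
qed

text \<open>Let \<open>q\<close> be the orthogonal projection to the image of \<open>f\<close>.  Then \<open>trace f = trace (q f) = trace (f q)\<close>, and
\<open>f q\<close> has a smaller order of nilpotency.\<close>

lemma trace_nilpotent:
  assumes "linear f" "\<And>x. (f ^^ k) x = 0" shows "trace_of f = 0"
  using assms
proof (induction k arbitrary: f)
  case 0
  then have "x = 0" for x :: 'a by simp
  then show ?case unfolding trace_of_def by (intro sum.neutral) (metis inner_zero_right)
next
  case (Suc k)
  show ?case
  proof (cases "k = 0")
    case True
    then show ?thesis using Suc.prems(2) by (simp add: trace_of_def)
  next
    case False
    then obtain m where m: "k = Suc m" by (cases k) auto
    have sub: "subspace (range f)" using linear_subspace_image[OF Suc.prems(1) subspace_UNIV] .
    define q where "q x = x - perp (range f) x" for x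
    have lin_q: "linear q" unfolding q_def by (intro linear_compose_sub linear_ident linear_perp sub)
    have qf: "q (f x) = f x" for x using perp_eq_0_iff[OF sub, of "f x"] by (simp add: q_def)
    have rq: "q x \<in> range f" for x unfolding q_def by (rule perp(2)[OF sub])
    define g where "g x = f (q x)" for x
    have "trace_of f = trace_of (\<lambda>x. q (f x))" by (simp add: qf)
    also have "\<dots> = trace_of g" unfolding g_def[abs_def] by (rule trace_comm[OF lin_q Suc.prems(1)])
    also have "\<dots> = 0"
    proof (rule Suc.IH)
      show "linear g" unfolding g_def using linear_compose[OF lin_q Suc.prems(1)] by (simp add: o_def)
      have *: "(g ^^ Suc n) x = (f ^^ Suc n) (q x)" for n x
        by (induction n) (simp_all add: g_def qf)
      show "(g ^^ k) x = 0" for x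
      proof -
        obtain z where z: "q x = f z" using rq by blast
        have "(g ^^ k) x = (f ^^ Suc k) z" unfolding m * z by (simp add: funpow_swap1)
        then show ?thesis using Suc.prems(2) by simp
      qed
    qed
    finally show ?thesis .
  qed
qed

section \<open>The Banach algebra of endomorphisms\<close>

text \<open>A copy of the bounded operators with composition as multiplication, in order to have the exponential
series and its functional equation.\<close>

typedef (overloaded) 'a endo = "UNIV :: ('a::euclidean_space \<Rightarrow>\<^sub>L 'a) set"
  by simp

setup_lifting type_definition_endo

instantiation endo :: (euclidean_space) real_normed_algebra_1
begin

lift_definition zero_endo :: "'a endo" is 0 .
lift_definition one_endo :: "'a endo" is id_blinfun .
lift_definition plus_endo :: "'a endo \<Rightarrow> 'a endo \<Rightarrow> 'a endo" is "(+)" .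
lift_definition minus_endo :: "'a endo \<Rightarrow> 'a endo \<Rightarrow> 'a endo" is "(-)" .
lift_definition uminus_endo :: "'a endo \<Rightarrow> 'a endo" is uminus .
lift_definition times_endo :: "'a endo \<Rightarrow> 'a endo \<Rightarrow> 'a endo" is "(o\<^sub>L)" .
lift_definition scaleR_endo :: "real \<Rightarrow> 'a endo \<Rightarrow> 'a endo" is scaleR .
lift_definition norm_endo :: "'a endo \<Rightarrow> real" is norm .
definition sgn_endo :: "'a endo \<Rightarrow> 'a endo" where "sgn_endo x = inverse (norm x) *\<^sub>R x"
definition dist_endo :: "'a endo \<Rightarrow> 'a endo \<Rightarrow> real" where "dist_endo x y = norm (x - y)"
definition uniformity_endo :: "('a endo \<times> 'a endo) filter" where
  "uniformity_endo = (INF e\<in>{0<..}. principal {(x, y). dist x y < e})"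
definition open_endo :: "'a endo set \<Rightarrow> bool" where
  "open_endo U = (\<forall>x\<in>U. eventually (\<lambda>(x', y). x' = x \<longrightarrow> y \<in> U) uniformity)"

instance
proof
  fix a b c :: "'a endo" and r s :: real
  show "a + b + c = a + (b + c)" by transfer simp
  show "a + b = b + a" by transfer simp
  show "0 + a = a" by transfer simp
  show "- a + a = 0" by transfer simp
  show "a - b = a + - b" by transfer simp
  show "r *\<^sub>R (a + b) = r *\<^sub>R a + r *\<^sub>R b" by transfer (simp add: scaleR_right_distrib)
  show "(r + s) *\<^sub>R a = r *\<^sub>R a + s *\<^sub>R a" by transfer (simp add: scaleR_left_distrib)
  show "r *\<^sub>R s *\<^sub>R a = (r * s) *\<^sub>R a" by transfer simp
  show "1 *\<^sub>R a = a" by transfer simp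
  show "a * b * c = a * (b * c)" by transfer (rule blinfun_eqI, simp)
  show "(a + b) * c = a * c + b * c" by transfer (rule blinfun_eqI, simp add: blinfun.bilinear_simps)
  show "a * (b + c) = a * b + a * c" by transfer (rule blinfun_eqI, simp add: blinfun.bilinear_simps)
  show "r *\<^sub>R a * b = r *\<^sub>R (a * b)" by transfer (rule blinfun_eqI, simp add: blinfun.bilinear_simps)
  show "a * r *\<^sub>R b = r *\<^sub>R (a * b)" by transfer (rule blinfun_eqI, simp add: blinfun.bilinear_simps)
  show "1 * a = a" by transfer (rule blinfun_eqI, simp)
  show "a * 1 = a" by transfer (rule blinfun_eqI, simp)
  show "(0 :: 'a endo) \<noteq> 1"
  proof (transfer, rule notI)
    assume "(0 :: 'a \<Rightarrow>\<^sub>L 'a) = id_blinfun"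
    then have "(0 :: 'a) = x" for x :: 'a by (metis id_blinfun.rep_eq id_apply zero_blinfun.rep_eq)
    then show False using nonzero_Basis SOME_Basis by metis
  qed
  show "dist a b = norm (a - b)" by (rule dist_endo_def)
  show "sgn a = inverse (norm a) *\<^sub>R a" by (rule sgn_endo_def)
  show "(uniformity :: ('a endo \<times> 'a endo) filter) = (INF e\<in>{0<..}. principal {(x, y). dist x y < e})"
    by (rule uniformity_endo_def)
  show "open U = (\<forall>x\<in>U. eventually (\<lambda>(x', y). x' = x \<longrightarrow> y \<in> U) uniformity)" for U :: "'a endo set"
    by (rule open_endo_def)
  show "(norm a = 0) = (a = 0)" by transfer simp
  show "norm (a + b) \<le> norm a + norm b" by transfer (rule norm_triangle_ineq)
  show "norm (r *\<^sub>R a) = \<bar>r\<bar> * norm a" by transfer simp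
  show "norm (a * b) \<le> norm a * norm b" by transfer (rule norm_blinfun_compose)
  show "norm (1 :: 'a endo) = 1" by transfer simp
qed

end

instance endo :: (euclidean_space) banach
proof
  fix X :: "nat \<Rightarrow> 'a endo" assume X: "Cauchy X"
  have d: "dist (Rep_endo a) (Rep_endo b) = dist a b" for a b :: "'a endo"
    by (simp add: dist_norm norm_endo.rep_eq minus_endo.rep_eq)
  have "Cauchy (\<lambda>n. Rep_endo (X n))" using X by (simp add: Cauchy_def d)
  then obtain l where "(\<lambda>n. Rep_endo (X n)) \<longlonglongrightarrow> l" using Cauchy_convergent convergent_def by blast
  then have "X \<longlonglongrightarrow> Abs_endo l"
    by (simp add: tendsto_iff d[symmetric] Abs_endo_inverse)
  then show "convergent X" by (auto simp: convergent_def)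
qed

definition app :: "'a endo \<Rightarrow> 'a \<Rightarrow> 'a::euclidean_space" where
  "app a = blinfun_apply (Rep_endo a)"

lemma app_simps: "app (a + b) x = app a x + app b x" "app (a * b) x = app a (app b x)" "app 1 x = x"
  "app (r *\<^sub>R a) x = r *\<^sub>R app a x" "app (- a) x = - app a x" "app 0 x = 0"
  by (simp_all add: app_def plus_endo.rep_eq times_endo.rep_eq one_endo.rep_eq scaleR_endo.rep_eq
      uminus_endo.rep_eq zero_endo.rep_eq blinfun.bilinear_simps)

lemma linear_app: "linear (app a)"
  unfolding app_def by (simp add: blinfun.bounded_linear_right bounded_linear.linear)

lemma endo_eqI: "(\<And>x. app a x = app b x) \<Longrightarrow> a = b"
  unfolding app_def by (metis Rep_endo_inject blinfun_eqI)

lemma endo_of_linear: assumes "linear f" shows "\<exists>a. \<forall>x. app a x = f x"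
  using assms by (intro exI[of _ "Abs_endo (Blinfun f)"])
    (simp add: app_def Abs_endo_inverse bounded_linear_Blinfun_apply linear_conv_bounded_linear)

lemma bounded_linear_app: "bounded_linear (\<lambda>a. app a x)"
proof (rule bounded_linear_intro)
  show "norm (app a x) \<le> norm a * norm x" for a
    by (simp add: app_def norm_endo.rep_eq norm_blinfun)
qed (simp_all add: app_simps)

lemma exp_app_sums: "(\<lambda>n. app (a ^ n) x /\<^sub>R fact n) sums app (exp a) x"
  using bounded_linear.sums[OF bounded_linear_app exp_converges[of a], of x] by (simp add: app_simps)

lemma sums_in_subspace:
  fixes W :: "'a::euclidean_space set"
  assumes "subspace W" "\<And>n. f n \<in> W" "f sums s" shows "s \<in> W"
proof -
  have "closed W" by (rule closed_subspace[OF assms(1)])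
  moreover have "(\<Sum>i<n. f i) \<in> W" for n by (intro subspace_sum assms)
  ultimately show ?thesis using assms(3) unfolding sums_def by (rule closed_sequentially)
qed

lemma exp_preserves:
  assumes "subspace W" "\<And>x. x \<in> W \<Longrightarrow> app a x \<in> W" "x \<in> W" shows "app (exp a) x \<in> W"
proof (rule sums_in_subspace[OF assms(1) _ exp_app_sums])
  have "app (a ^ n) x \<in> W" for n
    by (induction n) (simp_all add: app_simps assms)
  then show "app (a ^ n) x /\<^sub>R fact n \<in> W" for n by (intro subspace_mul assms)
qed

lemma exp_preserves_eq:
  assumes "subspace W" "\<And>x. x \<in> W \<Longrightarrow> app a x \<in> W" shows "app (exp a) ` W = W"
proof
  show "app (exp a) ` W \<subseteq> W" using exp_preserves[OF assms] by blast
  show "W \<subseteq> app (exp a) ` W"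
  proof
    fix x assume "x \<in> W"
    then have "app (exp (- a)) x \<in> W"
      using assms by (intro exp_preserves) (auto simp: app_simps intro: subspace_neg)
    moreover have "app (exp a) (app (exp (- a)) x) = x"
      using exp_minus_inverse[of a] by (metis app_simps(2,3))
    ultimately show "x \<in> app (exp a) ` W" by (metis imageI)
  qed
qed

lemma exp_inj: "inj (app (exp a))"
proof (rule injI)
  fix x y assume "app (exp a) x = app (exp a) y"
  moreover have "app (exp (- a)) (app (exp a) z) = z" for z
    using exp_minus_inverse[of "- a"] by (metis app_simps(2,3) minus_minus)
  ultimately show "x = y" by metis
qed

lemma exp_commutes:
  assumes "linear h" "\<And>x. app a (h x) = h (app a x)" shows "app (exp a) (h x) = h (app (exp a) x)"
proof -
  have "app (a ^ n) (h x) = h (app (a ^ n) x)" for n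
    by (induction n) (simp_all add: app_simps assms(2))
  then have "(\<lambda>n. app (a ^ n) (h x) /\<^sub>R fact n) = (\<lambda>n. h (app (a ^ n) x /\<^sub>R fact n))"
    by (simp add: linear_scale[OF assms(1)])
  moreover have "bounded_linear h" using assms(1) by (simp add: linear_conv_bounded_linear)
  ultimately show ?thesis
    using bounded_linear.sums[of h, OF _ exp_app_sums[of a x]] exp_app_sums[of a "h x"] sums_unique2 by metis
qed

text \<open>Euler's formula on a single vector, which suffices since \<open>a\<close> squares to \<open>- 1\<close> on a subspace only.\<close>

lemma exp_square_minus_one:
  assumes "app a (app a x) = - x"
  shows "app (exp (t *\<^sub>R a)) x = cos t *\<^sub>R x + sin t *\<^sub>R app a x"
proof -
  have pow: "app (a ^ n) x = (if even n then (-1) ^ (n div 2) *\<^sub>R x else (-1) ^ ((n - 1) div 2) *\<^sub>R app a x)" for n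
  proof (induction n)
    case (Suc n)
    show ?case
    proof (cases "even n")
      case True
      then show ?thesis using Suc by (simp add: app_simps linear_scale[OF linear_app])
    next
      case False
      then obtain k where "n = 2 * k + 1" by (elim oddE)
      then show ?thesis using Suc by (simp add: app_simps linear_scale[OF linear_app] assms)
    qed
  qed (simp add: app_simps)
  have "app ((t *\<^sub>R a) ^ n) x /\<^sub>R fact n = (cos_coeff n * t ^ n) *\<^sub>R x + (sin_coeff n * t ^ n) *\<^sub>R app a x" for n
    by (simp add: app_simps pow cos_coeff_def sin_coeff_def divide_inverse mult_ac)
  moreover have "(\<lambda>n. (cos_coeff n * t ^ n) *\<^sub>R x + (sin_coeff n * t ^ n) *\<^sub>R app a x) sums
      (cos t *\<^sub>R x + sin t *\<^sub>R app a x)"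
    using cos_converges[of t] sin_converges[of t] by (intro sums_add sums_scaleR_left) auto
  ultimately show ?thesis using exp_app_sums[of "t *\<^sub>R a" x] sums_unique2 by (metis (no_types, lifting) sums_cong)
qed

section \<open>Lifting rotations\<close>

lemma surj_endo_inj:
  fixes F :: "'a::euclidean_space set"
  assumes f: "linear f" and F: "subspace F" "f ` F = F" and x: "x \<in> F" "f x = 0" shows "x = 0"
proof -
  obtain g where "range g \<subseteq> F \<and> linear g \<and> (\<forall>v\<in>f ` F. f (g v) = v)"
    using linear_exists_right_inverse_on[OF f F(1)] by blast
  then have g: "range g \<subseteq> F" "linear g" "\<And>v. v \<in> F \<Longrightarrow> f (g v) = v" using F(2) by auto
  have "inj_on g F" using g(3) by (metis inj_onI)
  moreover have "span F = F" using F(1) by (rule span_eq_iff[THEN iffD2])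
  ultimately have "dim (g ` F) = dim F" using dim_image_eq[OF g(2), of F] by metis
  then have "g ` F = F"
    using g(1) F(1) linear_subspace_image[OF g(2) F(1)] by (intro subspace_dim_equal) auto
  then obtain v where "v \<in> F" "x = g v" using x(1) by blast
  then show "x = 0" using x(2) g(3)[of v] linear_0[OF g(2)] by simp
qed

text \<open>The rotation by the angle \<open>pi\<close> about \<open>u\<close>; for quaternions it is conjugation by \<open>u\<close>.\<close>

definition half_turn :: "real^3 \<Rightarrow> real^3 \<Rightarrow> real^3" where
  "half_turn u x = (2 * (u \<bullet> x)) *\<^sub>R u - x"

locale torsion_free =
  fixes P :: "'a::euclidean_space qpair"
  assumes P: "is_pair P" and tf: "torsion_free_pair P"
begin

abbreviation E where "E \<equiv> Car P"
abbreviation R where "R \<equiv> act P"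
abbreviation U where "U \<equiv> Sub P"

lemma qs: "is_qspace P" and subU: "subspace U" and UE: "U \<subseteq> E"
  using P by (auto simp: is_pair_def)

sublocale quat_module E R
  by (rule qspace_module[OF qs])

lemma R_in_E: "R t x \<in> E"
proof -
  have "x - perp E x \<in> E" using perp(2)[OF E] .
  then have "perp E (x - perp E x) = 0" "R t (x - perp E x) \<in> E" using perp_eq_0_iff[OF E] R_in by auto
  then show ?thesis by (simp add: act_def)
qed

lemma stable_E: "stable_subspace R E"
  using E R_in by (simp add: stable_subspace_def)

text \<open>Otherwise duality gives an operator \<open>h\<close> such that \<open>\<Psi> = h R u + R u h\<close> is an endomorphism of the pair with
nonzero trace.  So \<open>\<Psi>\<close> is not nilpotent; let \<open>F\<close> be its stable image and \<open>V = U \<inter> F\<close>.  The operator \<open>h\<close> maps \<open>F\<close>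
to \<open>V\<close> and vanishes on \<open>V\<close>.  As \<open>\<Psi>\<close> is bijective on \<open>F\<close>, its definition shows that \<open>F = V + R u V\<close> and that \<open>u\<close> is
not a complex point of \<open>V\<close>.  Hence \<open>V\<close> has complex points, and finitely many; by \<open>torsion_free_no_jump\<close> a
power of \<open>\<Psi>\<close> kills a nonzero vector of \<open>F\<close>.\<close>

lemma infinitesimal_lift:
  assumes u: "u \<in> S2"
  shows "\<exists>b. linear b \<and> (\<forall>x\<in>E. b x \<in> E) \<and> (\<forall>t. \<forall>x\<in>E. b (R t x) = R t (b x)) \<and> (\<forall>x\<in>U. R u x + b x \<in> U)"
proof (rule ccontr)
  assume no: "\<not> ?thesis"
  have "\<nexists>b z. linear b \<and> linear z \<and> (\<forall>x\<in>E. b x \<in> E) \<and> (\<forall>t. \<forall>x\<in>E. b (R t x) = R t (b x))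
                 \<and> (\<forall>x\<in>U. z x \<in> U) \<and> (\<forall>x. R u x = b x + z x)"
  proof
    assume "\<exists>b z. linear b \<and> linear z \<and> (\<forall>x\<in>E. b x \<in> E) \<and> (\<forall>t. \<forall>x\<in>E. b (R t x) = R t (b x))
                 \<and> (\<forall>x\<in>U. z x \<in> U) \<and> (\<forall>x. R u x = b x + z x)"
    then obtain b z where b: "linear b" "\<forall>x\<in>E. b x \<in> E" "\<forall>t. \<forall>x\<in>E. b (R t x) = R t (b x)"
        "\<forall>x\<in>U. z x \<in> U" "\<forall>x. R u x = b x + z x" by blast
    have "linear (\<lambda>x. - b x)" by (rule linear_compose_neg[OF b(1)])
    moreover have "\<forall>x\<in>E. - b x \<in> E" "\<forall>t. \<forall>x\<in>E. - b (R t x) = R t (- b x)"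
      using b(2,3) by (auto simp: R_simps intro: subspace_neg E)
    moreover have "\<forall>x\<in>U. R u x + - b x \<in> U" using b(4,5) by simp
    ultimately show False using no by blast
  qed
  then obtain h where h: "linear h" "\<And>x. x \<in> U \<Longrightarrow> h x = 0" "\<And>x. h x \<in> U"
    "\<And>w e y. frame w e \<Longrightarrow> y \<in> E \<Longrightarrow> average w e h y = 0" "(\<Sum>i\<in>Basis. h (R u i) \<bullet> i) \<noteq> 0"
    by (rule duality[OF stable_E order_refl stable_E order_refl subU subU linear_R]) blast
  have hE: "h x \<in> E" for x using h(3) UE by blast
  have hh: "h (h x) = 0" for x using h(2,3) by blast
  obtain e where fr: "frame u e" using frame_exists[OF u] by blast
  define \<Psi> where "\<Psi> x = h (R u x) + R u (h x)" for x
  have lin: "linear \<Psi>"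
    by (intro linearI) (simp_all add: \<Psi>_def R_simps linear_add[OF h(1)] linear_scale[OF h(1)] algebra_simps)
  have \<Psi>R: "\<Psi> (R t x) = R t (\<Psi> x)" if "x \<in> E" for t x
    unfolding \<Psi>_def using anticommutator_quaternionic[OF stable_E order_refl h(1) hE fr h(4)[OF fr] that] .
  have \<Psi>E: "\<Psi> x \<in> E" for x unfolding \<Psi>_def by (intro subspace_add E hE R_in)
  have \<Psi>U: "\<Psi> x \<in> U" if "x \<in> U" for x using h(2)[OF that] h(3) by (simp add: \<Psi>_def R_simps)
  have h\<Psi>: "h (\<Psi> x) = \<Psi> (h x)" for x by (simp add: \<Psi>_def linear_add[OF h(1)] hh R_simps)
  (* trace (R u h) = trace (h R u), and the latter is nonzero by the choice of h *)
  have "trace_of \<Psi> \<noteq> 0"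
  proof -
    have "trace_of \<Psi> = trace_of (\<lambda>x. h (R u x)) + trace_of (\<lambda>x. R u (h x))"
      by (simp add: trace_of_def \<Psi>_def inner_add_left sum.distrib)
    also have "\<dots> = 2 * (\<Sum>i\<in>Basis. h (R u i) \<bullet> i)"
      using trace_comm[OF h(1) linear_R] by (simp add: trace_of_def)
    finally show ?thesis using h(5) by simp
  qed
  define En where "En n = (\<Psi> ^^ n) ` E" for n
  have linp: "linear (\<Psi> ^^ n)" for n
  proof (induction n)
    case (Suc n)
    then show ?case using linear_compose[OF Suc lin] by (simp add: o_def)
  qed (simp add: linear_ident)
  (* the images of the powers decrease; one of smallest dimension is mapped onto itself *)
  obtain n where n: "\<And>m. dim (En n) \<le> dim (En m)"
    using ex_has_least_nat[of "\<lambda>_. True" 0 "\<lambda>n. dim (En n)"] by auto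
  define F where "F = En n"
  have subEn: "subspace (En m)" for m unfolding En_def by (rule linear_subspace_image[OF linp E])
  have EnS: "En (Suc m) = \<Psi> ` En m" for m unfolding En_def by (simp add: image_comp)
  have "En (Suc m) \<subseteq> En m" for m
  proof -
    have "(\<Psi> ^^ Suc m) x = (\<Psi> ^^ m) (\<Psi> x)" for x by (simp add: funpow_swap1)
    then show ?thesis unfolding En_def using \<Psi>E by auto
  qed
  then have \<Psi>F: "\<Psi> ` F = F" using subspace_dim_equal[OF subEn subEn _ n] EnS unfolding F_def by metis
  have subF: "subspace F" using subEn by (simp add: F_def)
  have pE: "(\<Psi> ^^ m) x \<in> E" if "x \<in> E" for m x by (induction m) (auto simp: that \<Psi>E)
  have pR: "(\<Psi> ^^ m) (R t x) = R t ((\<Psi> ^^ m) x)" if "x \<in> E" for m t x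
    by (induction m) (simp_all add: \<Psi>R pE that)
  have pU: "(\<Psi> ^^ m) x \<in> U" if "x \<in> U" for m x by (induction m) (auto simp: that \<Psi>U)
  have ph: "(\<Psi> ^^ m) (h x) = h ((\<Psi> ^^ m) x)" for m x by (induction m) (simp_all add: h\<Psi>)
  have FE: "F \<subseteq> E" unfolding F_def En_def using pE by blast
  have stF: "stable_subspace R F"
  proof -
    have "R t x \<in> F" if x: "x \<in> F" for t x
    proof -
      obtain y where y: "y \<in> E" "x = (\<Psi> ^^ n) y" using x unfolding F_def En_def by blast
      then have "R t x = (\<Psi> ^^ n) (R t y)" using pR by simp
      then show ?thesis unfolding F_def En_def using R_in[OF y(1)] by blast
    qed
    then show ?thesis using subF by (simp add: stable_subspace_def)
  qed
  have hF: "h x \<in> F" if x: "x \<in> F" for x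
  proof -
    obtain y where y: "y \<in> E" "x = (\<Psi> ^^ n) y" using x unfolding F_def En_def by blast
    then have "h x = (\<Psi> ^^ n) (h y)" using ph by simp
    then show ?thesis unfolding F_def En_def using hE by blast
  qed
  have inj: "x = 0" if "x \<in> F" "\<Psi> x = 0" for x by (rule surj_endo_inj[OF lin subF \<Psi>F that])
  have injn: "x = 0" if "x \<in> F" "(\<Psi> ^^ m) x = 0" for m x
    using that
  proof (induction m)
    case (Suc m)
    have "(\<Psi> ^^ m) x \<in> F" using \<Psi>F Suc.prems(1) by (induction m) auto
    then show ?case using Suc inj by auto
  qed simp
  have Fnz: "F \<noteq> {0}"
  proof
    assume "F = {0}"
    then have "(\<Psi> ^^ n) x = 0" if "x \<in> E" for x using that unfolding F_def En_def by blast
    then have "(\<Psi> ^^ Suc n) x = 0" for x using \<Psi>E by (simp add: funpow_swap1)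
    then show False using trace_nilpotent[OF lin] \<open>trace_of \<Psi> \<noteq> 0\<close> by blast
  qed
  interpret F: quat_module F R by (rule stable_quat_module[OF stF FE])
  define V where "V = U \<inter> F"
  have V: "subspace V" "V \<subseteq> F" unfolding V_def using subU subF by (auto intro: subspace_inter)
  have ncp: "u \<notin> complex_points V"
  proof
    assume "u \<in> complex_points V"
    then obtain x where x: "x \<in> V" "x \<noteq> 0" "R u x \<in> V" by (auto simp: complex_points_def)
    then have "\<Psi> x = 0" using h(2) by (simp add: \<Psi>_def V_def R_simps)
    then show False using inj x V(2) by blast
  qed
  have "spans_at V F u"
    unfolding spans_at_def
  proof
    fix y assume "y \<in> F"
    then obtain x where x: "x \<in> F" "y = \<Psi> x" using \<Psi>F by blast
    moreover have "h (R u x) \<in> V" "h x \<in> V" using h(3) hF F.R_in x by (auto simp: V_def)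
    ultimately show "\<exists>a\<in>V. \<exists>b\<in>V. y = a + R u b" unfolding \<Psi>_def by blast
  qed
  then obtain v where v: "v \<in> complex_points V" using F.complex_points_nonempty[OF V u ncp _ Fnz] by blast
  then obtain x where x: "v \<in> S2" "x \<in> V" "x \<noteq> 0" "R v x \<in> V" by (auto simp: complex_points_def)
  have "(\<Psi> ^^ n) x = 0"
  proof (rule torsion_free_no_jump[OF P tf linp pE pR])
    show "(\<Psi> ^^ n) ` U \<subseteq> V" unfolding V_def F_def En_def using pU UE by blast
    show "finite (complex_points V)" by (rule F.finite_complex_points[OF V u ncp])
    show "v \<in> S2" by fact
    show "x \<in> U" "R v x \<in> U" using x by (auto simp: V_def)
  qed
  then show False using injn x V(2) by blast
qed

definition lifts :: "(real^3 \<Rightarrow> real^3) \<Rightarrow> ('a \<Rightarrow> 'a) \<Rightarrow> bool" where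
  "lifts g t \<longleftrightarrow> linear t \<and> inj t \<and> t ` E = E \<and> t ` U = U \<and> (\<forall>v. \<forall>x\<in>E. t (R v x) = R (g v) (t x))"

text \<open>Let \<open>b\<close> be as in \<open>infinitesimal_lift\<close>.  The exponential of \<open>(pi / 2) (R u + b)\<close> preserves \<open>U\<close>.  Since \<open>b\<close>
commutes with the action, it is the product of \<open>exp ((pi / 2) R u) = R u\<close> and a quaternionic linear map;
and \<open>R u\<close> conjugates the action by the half-turn.\<close>

lemma lifts_half_turn: assumes u: "u \<in> S2" shows "\<exists>t. lifts (half_turn u) t"
proof -
  obtain b where b: "linear b" "\<And>x. x \<in> E \<Longrightarrow> b x \<in> E" "\<And>t x. x \<in> E \<Longrightarrow> b (R t x) = R t (b x)"
    "\<And>x. x \<in> U \<Longrightarrow> R u x + b x \<in> U"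
    using infinitesimal_lift[OF u] by blast
  define pr where "pr x = x - perp E x" for x
  have pr: "linear pr" "pr x \<in> E" "x \<in> E \<Longrightarrow> pr x = x" "R t (pr x) = R t x" for x t
  proof -
    show "linear pr" unfolding pr_def by (intro linear_compose_sub linear_ident linear_perp E)
    show prE: "pr x \<in> E" unfolding pr_def by (rule perp(2)[OF E])
    show "x \<in> E \<Longrightarrow> pr x = x" using perp_eq_0_iff[OF E] by (simp add: pr_def)
    have "perp E (pr x) = 0" using prE perp_eq_0_iff[OF E] by simp
    then show "R t (pr x) = R t x" by (simp add: act_def) (simp add: pr_def)
  qed
  obtain B where B: "\<And>x. app B x = b (pr x)"
    using endo_of_linear[of "\<lambda>x. b (pr x)"] linear_compose[OF pr(1) b(1)] by (auto simp: o_def)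
  obtain J where J: "\<And>x. app J x = R u x" using endo_of_linear[OF linear_R] by blast
  have BR: "app B (R t x) = R t (app B x)" for t x
    using b(3)[OF pr(2), of t x] by (simp add: B pr(3)[OF R_in_E] pr(4))
  have JB: "(s *\<^sub>R J) * (s *\<^sub>R B) = (s *\<^sub>R B) * (s *\<^sub>R J)" for s
    by (rule endo_eqI) (simp add: app_simps J BR linear_scale[OF linear_app] R_simps)
  define s where "s = pi / 2"
  define t where "t = app (exp (s *\<^sub>R (J + B)))"
  have pres: "app (s *\<^sub>R (J + B)) x \<in> E" if "x \<in> E" for x
    using that b(2) R_in by (auto simp: app_simps J B pr intro!: subspace_mul subspace_add E)
  have presU: "app (s *\<^sub>R (J + B)) x \<in> U" if x: "x \<in> U" for x
  proof -
    have "pr x = x" using pr(3) x UE by blast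
    then show ?thesis using b(4)[OF x] by (simp add: app_simps J B subspace_mul subU)
  qed
  have tE: "t ` E = E" unfolding t_def by (rule exp_preserves_eq[OF E pres])
  have tU: "t ` U = U" unfolding t_def by (rule exp_preserves_eq[OF subU presU])
  have t_eq: "t x = R u (app (exp (s *\<^sub>R B)) x)" if x: "x \<in> E" for x
  proof -
    let ?y = "app (exp (s *\<^sub>R B)) x"
    have "?y \<in> E" using x b(2) by (intro exp_preserves[OF E]) (auto simp: app_simps B pr intro: subspace_mul E)
    then have "app J (app J ?y) = - ?y" using R_unit[OF _ u] by (simp add: J)
    from exp_square_minus_one[OF this, of s] have "app (exp (s *\<^sub>R J)) ?y = R u ?y" by (simp add: s_def J)
    moreover have "exp (s *\<^sub>R (J + B)) = exp (s *\<^sub>R J) * exp (s *\<^sub>R B)"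
      using exp_add_commuting[OF JB] by (simp add: scaleR_right_distrib)
    ultimately show ?thesis by (simp add: t_def app_simps)
  qed
  have "t (R v x) = R (half_turn u v) (t x)" if x: "x \<in> E" for v x
  proof -
    let ?y = "app (exp (s *\<^sub>R B)) x"
    have yE: "?y \<in> E" using x b(2) by (intro exp_preserves[OF E]) (auto simp: app_simps B pr intro: subspace_mul E)
    have "app (exp (s *\<^sub>R B)) (R v x) = R v ?y"
      by (rule exp_commutes[OF linear_R]) (simp add: app_simps BR R_simps)
    then have "t (R v x) = R u (R v ?y)" using t_eq[OF R_in[OF x]] by simp
    also have "\<dots> = R (half_turn u v) (R u ?y)"
    proof -
      have "half_turn u v \<bullet> u = u \<bullet> v" using u by (simp add: half_turn_def inner_diff_left inner_diff_right S2_iff inner_commute)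
      moreover have "cross3 (half_turn u v) u = cross3 u v"
        using cross_skew[of v u] by (simp add: half_turn_def Cross3.left_diff_distrib cross_mult_left)
      ultimately show ?thesis using yE by (simp add: R_R)
    qed
    finally show ?thesis by (simp add: t_eq[OF x])
  qed
  then have "lifts (half_turn u) t"
    using tE tU exp_inj linear_app unfolding lifts_def t_def by blast
  then show ?thesis by blast
qed

lemma lifts_compose:
  assumes "lifts g t" "lifts g' t'" shows "lifts (\<lambda>v. g (g' v)) (t \<circ> t')"
proof -
  have t: "linear t" "inj t" "t ` E = E" "t ` U = U" "\<And>v x. x \<in> E \<Longrightarrow> t (R v x) = R (g v) (t x)"
    using assms(1) unfolding lifts_def by blast+
  have t': "linear t'" "inj t'" "t' ` E = E" "t' ` U = U" "\<And>v x. x \<in> E \<Longrightarrow> t' (R v x) = R (g' v) (t' x)"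
    using assms(2) unfolding lifts_def by blast+
  have "t' x \<in> E" if "x \<in> E" for x using t'(3) that by blast
  then have "\<forall>v. \<forall>x\<in>E. (t \<circ> t') (R v x) = R (g (g' v)) ((t \<circ> t') x)" using t(5) t'(5) by simp
  moreover have "(t \<circ> t') ` E = E" "(t \<circ> t') ` U = U" by (simp_all only: image_comp[symmetric] t(3,4) t'(3,4))
  ultimately show ?thesis unfolding lifts_def
    using linear_compose[OF t'(1) t(1)] inj_compose[OF t(2) t'(2)] by blast
qed

end

lemma half_turn_props:
  assumes u: "u \<in> S2"
  shows "linear (half_turn u)" "half_turn u (half_turn u x) = x"
    "cross3 (half_turn u x) (half_turn u y) = half_turn u (cross3 x y)"
    "half_turn u x \<bullet> half_turn u y = x \<bullet> y"
proof -
  show "linear (half_turn u)"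
    by (rule linearI) (simp_all add: half_turn_def inner_add_right algebra_simps)
  have uu: "u \<bullet> u = 1" using u by (simp add: S2_iff)
  show "half_turn u (half_turn u x) = x" by (simp add: half_turn_def inner_diff_right uu)
  show "half_turn u x \<bullet> half_turn u y = x \<bullet> y"
    using uu by (simp add: half_turn_def inner_diff_left inner_diff_right inner_commute)
  have "cross3 u (cross3 u (cross3 x y)) = (u \<bullet> cross3 x y) *\<^sub>R u - cross3 x y"
    by (simp add: Lagrange[of u u] uu)
  moreover have "cross3 u (cross3 u (cross3 x y)) = (u \<bullet> y) *\<^sub>R cross3 u x - (u \<bullet> x) *\<^sub>R cross3 u y"
    by (simp add: Lagrange[of u x y] Cross3.right_diff_distrib cross_mult_right)
  ultimately have "(u \<bullet> cross3 x y) *\<^sub>R u = cross3 x y + (u \<bullet> y) *\<^sub>R cross3 u x - (u \<bullet> x) *\<^sub>R cross3 u y"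
    by (simp add: algebra_simps)
  then have "2 *\<^sub>R ((u \<bullet> cross3 x y) *\<^sub>R u) =
      2 *\<^sub>R (cross3 x y + (u \<bullet> y) *\<^sub>R cross3 u x - (u \<bullet> x) *\<^sub>R cross3 u y)" by (rule arg_cong)
  then have id: "(2 * (u \<bullet> cross3 x y)) *\<^sub>R u =
      cross3 x y + cross3 x y + (2 * (u \<bullet> y)) *\<^sub>R cross3 u x - (2 * (u \<bullet> x)) *\<^sub>R cross3 u y"
    by (simp add: scaleR_right_distrib scaleR_right_diff_distrib scaleR_2[of "cross3 x y"])
  have "cross3 (half_turn u x) (half_turn u y) =
      cross3 x y - (2 * (u \<bullet> x)) *\<^sub>R cross3 u y + (2 * (u \<bullet> y)) *\<^sub>R cross3 u x"
    using cross_skew[of x u]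
    by (simp add: half_turn_def Cross3.left_diff_distrib Cross3.right_diff_distrib cross_mult_left cross_mult_right)
  also have "\<dots> = half_turn u (cross3 x y)"
    unfolding half_turn_def id by simp
  finally show "cross3 (half_turn u x) (half_turn u y) = half_turn u (cross3 x y)" .
qed

lemma half_turn_swap:
  assumes "a \<in> S2" "b \<in> S2" "b \<noteq> - a"
  obtains u k where "u \<in> S2" "half_turn u a = b" "u = k *\<^sub>R (a + b)"
proof
  let ?n = "norm (a + b)"
  have nz: "?n \<noteq> 0" using assms(3) by (simp add: eq_neg_iff_add_eq_0 add.commute)
  show "(1 / ?n) *\<^sub>R (a + b) = (1 / ?n) *\<^sub>R (a + b)" by simp
  show "(1 / ?n) *\<^sub>R (a + b) \<in> S2" using nz by (simp add: S2_def)
  have "?n\<^sup>2 = (a + b) \<bullet> (a + b)" by (simp add: power2_norm_eq_inner)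
  also have "\<dots> = 2 * ((a + b) \<bullet> a)"
    using assms(1,2) by (simp add: S2_iff inner_add_left inner_add_right inner_commute)
  finally have "2 * ((a + b) \<bullet> a) / ?n\<^sup>2 = ?n\<^sup>2 / ?n\<^sup>2" by metis
  also have "\<dots> = 1" using nz by simp
  finally have e1: "2 * ((a + b) \<bullet> a) / ?n\<^sup>2 = 1" .
  have e2: "2 * (((1 / ?n) *\<^sub>R (a + b)) \<bullet> a) / ?n = 2 * ((a + b) \<bullet> a) / ?n\<^sup>2"
    unfolding inner_scaleR_left power2_eq_square by simp
  have e3: "(2 * (((1 / ?n) *\<^sub>R (a + b)) \<bullet> a) / ?n) = 1" by (simp only: e1 e2)
  then have "(2 * (((1 / ?n) *\<^sub>R (a + b)) \<bullet> a)) *\<^sub>R ((1 / ?n) *\<^sub>R (a + b)) = a + b"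
    unfolding scaleR_scaleR by (simp only: times_divide_eq_right mult_1_right e3 scaleR_one)
  then show "half_turn ((1 / ?n) *\<^sub>R (a + b)) a = b" unfolding half_turn_def by simp
qed

lemma half_turn_orthogonal: "u \<bullet> x = 0 \<Longrightarrow> half_turn u x = - x"
  and half_turn_self: "u \<in> S2 \<Longrightarrow> half_turn u u = u"
  by (simp_all add: half_turn_def S2_iff scaleR_2)

text \<open>A half-turn \<open>a\<close> exchanges \<open>w\<close> and \<open>g w\<close>.  The rotation \<open>a g\<close> fixes \<open>w\<close>, and is the product of the half-turn about
\<open>e\<close> with the one about an axis orthogonal to \<open>w\<close> that sends \<open>e\<close> to its image.\<close>

lemma rotation_half_turns:
  assumes g: "rotation g"
  obtains a b c where "a \<in> S2" "b \<in> S2" "c \<in> S2" "\<And>v. g v = half_turn a (half_turn b (half_turn c v))"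
proof -
  note r = rotationD[OF g]
  obtain w :: "real^3" where "w \<in> S2" by (metis S2_def norm_axis_1 mem_sphere_0)
  then obtain e where fr: "frame w e" using frame_exists by blast
  let ?f = "cross3 w e"
  note f = frame_S2[OF fr] frame_dots[OF fr]
  have "\<exists>a\<in>S2. half_turn a w = g w"
  proof (cases "g w = - w")
    case True
    then show ?thesis using half_turn_orthogonal[of e w] f by (intro bexI[of _ e]) auto
  next
    case False
    then show ?thesis using half_turn_swap[OF f(1) r(4)[OF f(1)]] by metis
  qed
  then obtain a where a: "a \<in> S2" "half_turn a w = g w" by blast
  note ha = half_turn_props[OF a(1)]
  define g1 where "g1 v = half_turn a (g v)" for v
  have g1w: "g1 w = w" using a ha(2) by (metis g1_def)
  have g1c: "cross3 (g1 x) (g1 y) = g1 (cross3 x y)" for x y by (simp add: g1_def ha r)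
  have g1d: "g1 x \<bullet> g1 y = x \<bullet> y" for x y by (simp add: g1_def ha r)
  have lin1: "linear g1" unfolding g1_def using linear_compose[OF r(1) ha(1)] by (simp add: o_def)
  have e': "g1 e \<in> S2" "g1 e \<bullet> w = 0" using g1d[of e e] g1d[of e w] g1w f by (auto simp: S2_iff)
  have "\<exists>b\<in>S2. b \<bullet> w = 0 \<and> half_turn b e = g1 e"
  proof (cases "g1 e = - e")
    case True
    then show ?thesis using half_turn_orthogonal[of ?f e] f by (intro bexI[of _ ?f]) auto
  next
    case False
    obtain b k where "b \<in> S2" "half_turn b e = g1 e" "b = k *\<^sub>R (e + g1 e)"
      by (rule half_turn_swap[OF f(2) e'(1) False])
    then show ?thesis using e' f by (intro bexI[of _ b]) (auto simp: inner_add_left)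
  qed
  then obtain b where b: "b \<in> S2" "b \<bullet> w = 0" "half_turn b e = g1 e" by blast
  note hb = half_turn_props[OF b(1)] and he = half_turn_props[OF f(2)]
  define g2 where "g2 v = half_turn b (half_turn e v)" for v
  have lin2: "linear g2" unfolding g2_def using linear_compose[OF he(1) hb(1)] by (simp add: o_def)
  have w2: "g2 w = w"
    using half_turn_orthogonal[of e w] half_turn_orthogonal[OF b(2)] f by (simp add: g2_def linear_neg[OF hb(1)])
  have e2: "g2 e = g1 e" using half_turn_self[OF f(2)] b(3) by (simp add: g2_def)
  have "g2 ?f = g1 ?f"
  proof -
    have "g2 ?f = cross3 (g2 w) (g2 e)" by (simp add: g2_def hb(3) he(3))
    then show ?thesis using g1c[of w e] g1w w2 e2 by simp
  qed
  then have "g1 v = g2 v" for v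
    using w2 e2 g1w by (subst (1 2) frame_expansion[OF fr, of v])
      (simp add: linear_add[OF lin1] linear_add[OF lin2] linear_scale[OF lin1] linear_scale[OF lin2])
  then have "g v = half_turn a (half_turn b (half_turn e v))" for v
    using ha(2)[of "g v"] by (simp add: g1_def g2_def)
  then show ?thesis using that a(1) b(1) f(2) by blast
qed

lemma (in torsion_free) lifts_rotation: assumes "rotation g" shows "\<exists>t. lifts g t"
proof -
  obtain a b c where abc: "a \<in> S2" "b \<in> S2" "c \<in> S2" "\<And>v. g v = half_turn a (half_turn b (half_turn c v))"
    using rotation_half_turns[OF assms] by blast
  obtain ta tb tc where "lifts (half_turn a) ta" "lifts (half_turn b) tb" "lifts (half_turn c) tc"
    using lifts_half_turn abc by meson
  from lifts_compose[OF lifts_compose[OF this(1,2)] this(3)] have "\<exists>t. lifts (\<lambda>v. half_turn a (half_turn b (half_turn c v))) t" by blast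
  moreover have "g = (\<lambda>v. half_turn a (half_turn b (half_turn c v)))" using abc(4) by blast
  ultimately show ?thesis by simp
qed

section \<open>Independence of the isometry\<close>

lemma (in torsion_free) liftsD:
  assumes "lifts g t"
  shows "linear t" "inj t" "t ` E = E" "t ` U = U" "x \<in> E \<Longrightarrow> t (R v x) = R (g v) (t x)"
  using assms unfolding lifts_def by simp_all

lemma rotation_inv: assumes "rotation g" shows "rotation (inv g)" "inv g (g x) = x" "g (inv g x) = x"
proof -
  note r = rotationD[OF assms]
  show i: "inv g (g x) = x" "g (inv g x) = x" for x
    by (rule inv_f_f[OF bij_is_inj[OF r(5)]], rule surj_f_inv_f[OF bij_is_surj[OF r(5)]])
  have o: "orthogonal_transformation (inv g)" using assms unfolding rotation_def by (intro orthogonal_transformation_inv) blast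
  have "cross3 (inv g x) (inv g y) = inv g (cross3 x y)" for x y
  proof -
    have "g (cross3 (inv g x) (inv g y)) = cross3 x y" using r(3)[of "inv g x" "inv g y"] by (simp add: i)
    then show ?thesis using i(1) by metis
  qed
  then show "rotation (inv g)" using o by (simp add: rotation_def)
qed

lemma rotation_compose: "rotation f \<Longrightarrow> rotation g \<Longrightarrow> rotation (\<lambda>x. f (g x))"
  using orthogonal_transformation_compose[of f g] by (simp add: rotation_def o_def)

lemma iso_of_pairsI:
  assumes "linear t" "inj_on t (Car P)" "t ` Car P = Car P'" "t ` Sub P = Sub P'"
    and r: "rotation k" "\<And>v x. x \<in> Car P \<Longrightarrow> t (act P v x) = act P' (k v) (t x)"
  shows "iso_of_pairs P P' t"
  unfolding iso_of_pairs_def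
proof (intro conjI ballI)
  show "\<exists>v\<in>S2. \<forall>x\<in>Car P. t (act P u x) = act P' v (t x)" if "u \<in> S2" for u
    using rotationD(4)[OF r(1) that] r(2) by blast
  show "\<exists>u\<in>S2. \<forall>x\<in>Car P. t (act P u x) = act P' v (t x)" if "v \<in> S2" for v
    using rotation_S2_surj[OF r(1) that] r(2) by blast
qed (fact assms)+

text \<open>Automorphisms of the torsion free factor that lift the rotation by which the two isometries differ,
together with the identity of the other factor, give the isomorphism.\<close>

theorem product_independent:
  assumes P: "is_pair P" and P': "is_pair P'" and tf: "torsion_free_pair P \<or> torsion_free_pair P'"
    and T: "op_isometry T1" "op_isometry T2"
  shows "isomorphic_pairs (prod_pair T1 P P') (prod_pair T2 P P')"
proof -
  obtain g1 where g1: "rotation g1" "\<And>u. u \<in> S2 \<Longrightarrow> T1 u = g1 u" using op_isometry_rotation[OF T(1)] by blast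
  obtain g2 where g2: "rotation g2" "\<And>u. u \<in> S2 \<Longrightarrow> T2 u = g2 u" using op_isometry_rotation[OF T(2)] by blast
  note p1 = prod_pair[OF P P' g1] and p2 = prod_pair[OF P P' g2]
  have "\<exists>t. iso_of_pairs (prod_pair T1 P P') (prod_pair T2 P P') t"
    using tf
  proof
    assume "torsion_free_pair P"
    then interpret torsion_free P using P by unfold_locales
    let ?a = "\<lambda>v. inv g2 (g1 v)"
    have a: "rotation ?a" by (rule rotation_compose[OF rotation_inv(1)[OF g2(1)] g1(1)])
    obtain t where "lifts ?a t" using lifts_rotation[OF a] by blast
    note t = liftsD[OF this]
    have tE: "t x \<in> Car P" if "x \<in> Car P" for x using t(3) that by blast
    have "iso_of_pairs (prod_pair T1 P P') (prod_pair T2 P P') (map_prod t (\<lambda>y. y))"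
    proof (rule iso_of_pairsI[OF _ _ _ _ a])
      show "linear (map_prod t (\<lambda>y. y))" using t(1) by (auto simp: linear_iff)
      show "inj_on (map_prod t (\<lambda>y. y)) (Car (prod_pair T1 P P'))"
        using t(2) by (auto simp: inj_on_def)
      show "map_prod t (\<lambda>y. y) ` Car (prod_pair T1 P P') = Car (prod_pair T2 P P')"
        "map_prod t (\<lambda>y. y) ` Sub (prod_pair T1 P P') = Sub (prod_pair T2 P P')"
        by (simp_all add: map_prod_image t)
      show "map_prod t (\<lambda>y. y) (act (prod_pair T1 P P') v x) = act (prod_pair T2 P P') (?a v) (map_prod t (\<lambda>y. y) x)"
        if "x \<in> Car (prod_pair T1 P P')" for v x
        using that tE t(5) rotation_inv(3)[OF g2(1)] by (auto simp: p1(2) p2(2))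
    qed
    then show ?thesis by blast
  next
    assume "torsion_free_pair P'"
    then interpret torsion_free P' using P' by unfold_locales
    let ?a = "\<lambda>v. g2 (inv g1 v)"
    have a: "rotation ?a" by (rule rotation_compose[OF g2(1) rotation_inv(1)[OF g1(1)]])
    obtain t where "lifts ?a t" using lifts_rotation[OF a] by blast
    note t = liftsD[OF this]
    have tE: "t x \<in> Car P'" if "x \<in> Car P'" for x using t(3) that by blast
    have id: "rotation (\<lambda>v. v)" by (simp add: rotation_def orthogonal_transformation_id)
    have "iso_of_pairs (prod_pair T1 P P') (prod_pair T2 P P') (map_prod (\<lambda>x. x) t)"
    proof (rule iso_of_pairsI[OF _ _ _ _ id])
      show "linear (map_prod (\<lambda>x. x) t)" using t(1) by (auto simp: linear_iff)
      show "inj_on (map_prod (\<lambda>x. x) t) (Car (prod_pair T1 P P'))"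
        using t(2) by (auto simp: inj_on_def)
      show "map_prod (\<lambda>x. x) t ` Car (prod_pair T1 P P') = Car (prod_pair T2 P P')"
        "map_prod (\<lambda>x. x) t ` Sub (prod_pair T1 P P') = Sub (prod_pair T2 P P')"
        by (simp_all add: map_prod_image t)
      show "map_prod (\<lambda>x. x) t (act (prod_pair T1 P P') v x) = act (prod_pair T2 P P') v (map_prod (\<lambda>x. x) t x)"
        if "x \<in> Car (prod_pair T1 P P')" for v x
        using that tE t(5) rotation_inv(2)[OF g1(1)] by (auto simp: p1(2) p2(2))
    qed
    then show ?thesis by blast
  qed
  then show ?thesis using isomorphic_pairs_iff[OF p1(1) p2(1)] by blast
qed

section \<open>Subpairs\<close>

text \<open>A submodule as a pair; the ambient type is kept.\<close>

definition sub_pair :: "'a::euclidean_space qpair \<Rightarrow> 'a set \<Rightarrow> 'a qpair" where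
  "sub_pair Q A = \<lparr>Car = A, Rep = Rep Q, Sub = Sub Q \<inter> A\<rparr>"

lemma sub_pair_simps [simp]: "Car (sub_pair Q A) = A" "Rep (sub_pair Q A) = Rep Q" "Sub (sub_pair Q A) = Sub Q \<inter> A"
  by (simp_all add: sub_pair_def)

lemma pair_module:
  assumes "is_pair Q"
  shows "quat_module (Car Q) (act Q)" "is_qspace Q" "subspace (Sub Q)" "Sub Q \<subseteq> Car Q"
  using assms qspace_module by (auto simp: is_pair_def)

lemma sub_pair:
  assumes Q: "is_pair Q" and A: "stable_subspace (act Q) A" "A \<subseteq> Car Q"
  shows "is_pair (sub_pair Q A)" "\<And>x t. x \<in> A \<Longrightarrow> act (sub_pair Q A) t x = act Q t x"
proof -
  note q = pair_module[OF Q]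
  interpret quat_module "Car Q" "act Q" by (rule q(1))
  have sA: "subspace A" using A by (simp add: stable_subspace_def)
  have "hypercomplex A (Rep Q)"
  proof (rule hypercomplexI[OF _ stable_quat_module[OF A]])
    show "linear (Rep Q k)" for k using q(2) unfolding is_qspace_def hypercomplex_def by blast
    show "Rep Q (a, t) x = a *\<^sub>R x + act Q t x" if "x \<in> A" for x a t
      using Rep_act[OF q(2)] that A(2) by blast
  qed
  then have qs: "is_qspace (sub_pair Q A)" using sA by (simp add: is_qspace_def)
  then show "is_pair (sub_pair Q A)" using q(3) sA by (simp add: is_pair_def subspace_inter)
  show "act (sub_pair Q A) t x = act Q t x" if "x \<in> A" for x t
  proof -
    have "x \<in> Car Q" using that A(2) by blast
    then show ?thesis using act_in_Car[OF qs, of x t] act_in_Car[OF q(2), of x t] that by simp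
  qed
qed

lemma spans_at_eq: "quat_module E R \<Longrightarrow> quat_module.spans_at R U F v \<longleftrightarrow> (\<forall>x\<in>F. \<exists>a\<in>U. \<exists>b\<in>U. x = a + R v b)"
  by (rule quat_module.spans_at_def)

lemma complex_points_eq: "quat_module E R \<Longrightarrow> v \<in> quat_module.complex_points R U \<longleftrightarrow> v \<in> S2 \<and> (\<exists>x\<in>U. x \<noteq> 0 \<and> R v x \<in> U)"
  by (simp add: quat_module.complex_points_def)

lemma sub_pair_conditions:
  assumes Q: "is_pair Q" and A: "stable_subspace (act Q) A" "A \<subseteq> Car Q"
  shows "quat_module.spans_at (act (sub_pair Q A)) (Sub Q \<inter> A) A v \<longleftrightarrow> quat_module.spans_at (act Q) (Sub Q \<inter> A) A v"
    "quat_module.complex_points (act (sub_pair Q A)) (Sub Q \<inter> A) = quat_module.complex_points (act Q) (Sub Q \<inter> A)"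
proof -
  note s = sub_pair[OF assms] and m = pair_module(1)[OF sub_pair(1)[OF assms]] and q = pair_module(1)[OF Q]
  show "quat_module.spans_at (act (sub_pair Q A)) (Sub Q \<inter> A) A v \<longleftrightarrow> quat_module.spans_at (act Q) (Sub Q \<inter> A) A v"
    unfolding spans_at_eq[OF m] spans_at_eq[OF q] using s(2) by simp
  show "quat_module.complex_points (act (sub_pair Q A)) (Sub Q \<inter> A) = quat_module.complex_points (act Q) (Sub Q \<inter> A)"
    unfolding set_eq_iff complex_points_eq[OF m] complex_points_eq[OF q] using s(2) by auto
qed

lemma CR_pair_iff: 
  assumes P: "is_pair P"
  shows "CR_pair P \<longleftrightarrow> (\<forall>v\<in>S2. quat_module.spans_at (act P) (Sub P) (Car P) v)"
proof -
  note m = pair_module[OF P]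
  interpret quat_module "Car P" "act P" by (rule m(1))
  have J: "{x + J y |x y. x \<in> Sub P \<and> y \<in> Sub P} = Car P \<longleftrightarrow> spans_at (Sub P) (Car P) v"
    if "J = Rep P (0, v)" for J v
  proof -
    have eq: "x + J y = x + act P v y" if "y \<in> Sub P" for x y
      using that m(4) act_in_Car[OF m(2), of y v] \<open>J = Rep P (0, v)\<close> by auto
    have "{x + J y |x y. x \<in> Sub P \<and> y \<in> Sub P} = {x + act P v y |x y. x \<in> Sub P \<and> y \<in> Sub P}"
      using eq by (intro Collect_cong) metis
    moreover have "{x + act P v y |x y. x \<in> Sub P \<and> y \<in> Sub P} \<subseteq> Car P"
      using m(4) E R_in by (auto intro!: subspace_add)
    ultimately show ?thesis unfolding spans_at_def by blast
  qed
  show ?thesis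
  proof
    assume "CR_pair P"
    then obtain V :: "'a set" and \<iota> where "CR_quaternionic V \<iota> P" "Sub P = \<iota> ` V" unfolding CR_pair_def by blast
    then have "\<forall>J\<in>admissible P. {x + J y |x y. x \<in> Sub P \<and> y \<in> Sub P} = Car P"
      by (simp add: CR_quaternionic_def)
    then show "\<forall>v\<in>S2. spans_at (Sub P) (Car P) v" using J unfolding admissible_def by blast
  next
    assume a: "\<forall>v\<in>S2. spans_at (Sub P) (Car P) v"
    have "CR_quaternionic (Sub P) (\<lambda>x. x) P"
      unfolding CR_quaternionic_def image_ident
    proof (intro conjI ballI)
      show "{x + Ja y |x y. x \<in> Sub P \<and> y \<in> Sub P} = Car P" if "Ja \<in> admissible P" for Ja
        using that a J unfolding admissible_def by blast
    qed (use m in \<open>auto intro: linear_ident\<close>)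
    then show "CR_pair P" unfolding CR_pair_def by (intro exI[of _ "Sub P"] exI[of _ "\<lambda>x. x"]) simp
  qed
qed

lemma co_CR_pair_iff: 
  assumes P: "is_pair P"
  shows "co_CR_pair P \<longleftrightarrow> quat_module.complex_points (act P) (Sub P) = {}"
proof -
  note m = pair_module[OF P]
  interpret quat_module "Car P" "act P" by (rule m(1))
  have J: "Sub P \<inter> J ` Sub P = {0} \<longleftrightarrow> v \<notin> complex_points (Sub P)"
    if "J = Rep P (0, v)" "v \<in> S2" for J v
  proof -
    have eq: "J y = act P v y" if "y \<in> Sub P" for y
      using that m(4) act_in_Car[OF m(2), of y v] \<open>J = Rep P (0, v)\<close> by auto
    then have im: "J ` Sub P = act P v ` Sub P" by simp
    have z: "0 \<in> Sub P \<inter> act P v ` Sub P"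
      using subspace_0[OF m(3)] by (auto simp: image_iff R_simps intro!: bexI[of _ 0])
    have nz: "v \<noteq> 0" using that(2) by (auto simp: S2_def)
    show ?thesis
    proof
      assume a: "Sub P \<inter> J ` Sub P = {0}"
      show "v \<notin> complex_points (Sub P)"
      proof
        assume "v \<in> complex_points (Sub P)"
        then obtain x where x: "x \<in> Sub P" "x \<noteq> 0" "act P v x \<in> Sub P" by (auto simp: complex_points_def)
        then have "act P v x = 0" using a im by blast
        then show False using R_eq_0[OF _ _ nz] x m(4) by blast
      qed
    next
      assume "v \<notin> complex_points (Sub P)"
      then have x0: "x = 0" if "x \<in> Sub P" "act P v x \<in> Sub P" for x using that \<open>v \<in> S2\<close> by (auto simp: complex_points_def)
      have "Sub P \<inter> act P v ` Sub P \<subseteq> {0}"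
      proof
        fix y assume "y \<in> Sub P \<inter> act P v ` Sub P"
        then obtain x where "x \<in> Sub P" "y = act P v x" "y \<in> Sub P" by blast
        then show "y \<in> {0}" using x0[of x] by (simp add: R_simps)
      qed
      then show "Sub P \<inter> J ` Sub P = {0}" using z im by blast
    qed
  qed
  show ?thesis
  proof
    assume "co_CR_pair P"
    then obtain V :: "'a set" and r where V: "co_CR_quaternionic V r P" "Sub P = {x \<in> Car P. r x = 0}" unfolding co_CR_pair_def by blast
    have "\<forall>J\<in>admissible P. Sub P \<inter> J ` Sub P = {0}"
      using V(1) unfolding co_CR_quaternionic_def V(2)[symmetric] by blast
    then have "\<forall>v\<in>S2. v \<notin> complex_points (Sub P)" using J unfolding admissible_def by blast
    then show "complex_points (Sub P) = {}" by (auto simp: complex_points_def)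
  next
    assume a: "complex_points (Sub P) = {}"
    have ker: "{x \<in> Car P. perp (Sub P) x = 0} = Sub P" using perp_eq_0_iff[OF m(3)] m(4) by auto
    have "co_CR_quaternionic (perp (Sub P) ` Car P) (perp (Sub P)) P"
      unfolding co_CR_quaternionic_def ker
    proof (intro conjI ballI)
      show "subspace (perp (Sub P) ` Car P)" by (rule linear_subspace_image[OF linear_perp[OF m(3)] E])
      show "is_qspace P" by (rule m(2))
      show "linear (perp (Sub P))" by (rule linear_perp[OF m(3)])
      show "Sub P \<inter> Ja ` Sub P = {0}" if "Ja \<in> admissible P" for Ja
        using that a J unfolding admissible_def by blast
    qed simp
    then show "co_CR_pair P" unfolding co_CR_pair_def
      by (intro exI[of _ "perp (Sub P) ` Car P"] exI[of _ "perp (Sub P)"]) (simp add: ker)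
  qed
qed

section \<open>Existence of the decomposition\<close>

theorem pair_decomposition_exists:
  fixes Q :: "'p::euclidean_space qpair"
  assumes Q: "is_pair Q"
  shows "\<exists>(M :: 'p qpair) (N :: 'p qpair) (C :: 'p qpair) \<phi>. decomposition Q M N C \<phi>"
proof -
  note q = pair_module[OF Q]
  interpret quat_module "Car Q" "act Q" by (rule q(1))
  let ?U = "Sub Q"
  obtain A B C where st: "stable_subspace (act Q) A" "stable_subspace (act Q) B" "stable_subspace (act Q) C"
    and ds: "direct_split (Car Q) (sum_space A B) C" "direct_split (sum_space A B) A B"
    and U: "?U \<subseteq> sum_space (sum_space (?U \<inter> A) (?U \<inter> B)) (?U \<inter> C)"
    and c: "\<And>v. v \<in> S2 \<Longrightarrow> spans_at (?U \<inter> A) A v"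
    "finite (complex_points (?U \<inter> B))" "finite {v \<in> S2. \<not> spans_at (?U \<inter> B) B v}"
    "complex_points (?U \<inter> C) = {}"
    using decomposition_exists[OF q(3,4)] by blast
  have sub: "subspace A" "subspace B" "subspace C" using st by (auto simp: stable_subspace_def)
  have sAB: "subspace (sum_space A B)" by (rule subspace_sum_space[OF sub(1,2)])
  have ABC: "A \<subseteq> Car Q" "B \<subseteq> Car Q" "C \<subseteq> Car Q"
    using ds(1) sum_space_upper[OF sub(1,2)] unfolding direct_split_def by blast+
  let ?M = "sub_pair Q A" and ?N = "sub_pair Q B" and ?C = "sub_pair Q C"
  note sM = sub_pair[OF Q st(1) ABC(1)] and sN = sub_pair[OF Q st(2) ABC(2)] and sC = sub_pair[OF Q st(3) ABC(3)]
  note cM = sub_pair_conditions[OF Q st(1) ABC(1)] and cN = sub_pair_conditions[OF Q st(2) ABC(2)]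
    and cC = sub_pair_conditions[OF Q st(3) ABC(3)]
  have M: "CR_pair ?M" unfolding CR_pair_iff[OF sM(1)] using c(1) cM(1) by simp
  have N: "torsion_pair ?N" by (rule torsion_pairI[OF sN(1)]) (use c(2,3) cN in simp_all)
  have C: "co_CR_pair ?C" unfolding co_CR_pair_iff[OF sC(1)] using c(4) cC(2) by simp
  have rid: "rotation (\<lambda>v. v)" by (simp add: rotation_def orthogonal_transformation_id)
  let ?T = "\<lambda>u :: real^3. u"
  note p1 = prod_pair[OF sM(1) sN(1) rid, of ?T, OF refl]
  note p2 = prod_pair[OF p1(1) sC(1) rid, of ?T, OF refl]
  let ?W = "prod_pair ?T (prod_pair ?T ?M ?N) ?C"
  let ?\<phi> = "\<lambda>p :: ('p \<times> 'p) \<times> 'p. fst (fst p) + snd (fst p) + snd p"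
  have AB0: "A \<inter> B = {0}" "sum_space A B \<inter> C = {0}" using ds by (auto simp: direct_split_def)
  have "iso_of_pairs ?W Q ?\<phi>"
  proof (rule iso_of_pairsI[OF _ _ _ _ rid])
    show lin: "linear ?\<phi>" by (rule linearI) (auto simp: algebra_simps)
    show "inj_on ?\<phi> (Car ?W)"
    proof (rule inj_onI)
      fix p p' assume p: "p \<in> Car ?W" "p' \<in> Car ?W" and eq: "?\<phi> p = ?\<phi> p'"
      obtain x y z x' y' z' where xyz: "p = ((x, y), z)" "p' = ((x', y'), z')" by (metis surj_pair)
      have m: "x \<in> A" "y \<in> B" "z \<in> C" "x' \<in> A" "y' \<in> B" "z' \<in> C" using p xyz by auto
      have "x + y = x' + y'" "z = z'"
        using sum_space_unique[OF sAB sub(3) AB0(2), of "x + y" "x' + y'" z z'] m eq xyz by (auto intro: sum_spaceI)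
      moreover from this have "x = x'" "y = y'" using sum_space_unique[OF sub(1,2) AB0(1), of x x' y y'] m by auto
      ultimately show "p = p'" using xyz by simp
    qed
    show "?\<phi> ` Car ?W = Car Q"
    proof
      show "?\<phi> ` Car ?W \<subseteq> Car Q" using ABC E by (auto intro!: subspace_add)
      show "Car Q \<subseteq> ?\<phi> ` Car ?W"
      proof
        fix x assume "x \<in> Car Q"
        then obtain d z where d: "x = d + z" "d \<in> sum_space A B" "z \<in> C" using ds(1) by (auto simp: direct_split_def sum_space_def[of _ C])
        then obtain a b where "d = a + b" "a \<in> A" "b \<in> B" by (auto simp: sum_space_def)
        then show "x \<in> ?\<phi> ` Car ?W" using d by (intro image_eqI[of _ _ "((a, b), z)"]) auto
      qed
    qed
    show "?\<phi> ` Sub ?W = Sub Q"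
    proof
      show "?\<phi> ` Sub ?W \<subseteq> Sub Q" using q(3) by (auto intro!: subspace_add)
      show "Sub Q \<subseteq> ?\<phi> ` Sub ?W"
      proof
        fix x assume "x \<in> Sub Q"
        then obtain d z where d: "x = d + z" "d \<in> sum_space (?U \<inter> A) (?U \<inter> B)" "z \<in> ?U \<inter> C"
          using U by (auto simp: sum_space_def[of _ "?U \<inter> C"])
        then obtain a b where "d = a + b" "a \<in> ?U \<inter> A" "b \<in> ?U \<inter> B" by (auto simp: sum_space_def)
        then show "x \<in> ?\<phi> ` Sub ?W" using d by (intro image_eqI[of _ _ "((a, b), z)"]) auto
      qed
    qed
    show "?\<phi> (act ?W v p) = act Q v (?\<phi> p)" if p: "p \<in> Car ?W" for v p
    proof -
      obtain x y z where xyz: "p = ((x, y), z)" by (metis surj_pair)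
      then have m: "x \<in> A" "y \<in> B" "z \<in> C" using p by auto
      then have "act ?W v p = ((act Q v x, act Q v y), act Q v z)"
        using p2(2)[of "(x, y)" z v] p1(2)[of x y v] sM(2) sN(2) sC(2) by (simp add: xyz)
      then show ?thesis by (simp add: xyz R_simps)
    qed
  qed
  then have "pair_isomorphism ?W Q ?\<phi>" using pair_isomorphism_iff[OF p2(1) Q] by blast
  then have "decomposition Q ?M ?N ?C ?\<phi>"
    unfolding decomposition_def using sM(1) sN(1) sC(1) M N C op_isometry_id by blast
  then show ?thesis by blast
qed

section \<open>Uniqueness of the decomposition\<close>

lemma (in quat_module) stable_subspaceI:
  assumes A: "subspace A" "\<And>v x. v \<in> S2 \<Longrightarrow> x \<in> A \<Longrightarrow> R v x \<in> A" shows "stable_subspace R A"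
  unfolding stable_subspace_def
proof (intro conjI allI ballI)
  show "R t x \<in> A" if x: "x \<in> A" for t x
  proof (cases "t = 0")
    case True
    then show ?thesis using subspace_0[OF A(1)] by (simp add: R_simps)
  next
    case False
    then have "(1 / norm t) *\<^sub>R t \<in> S2" by (simp add: S2_def)
    then have "R ((1 / norm t) *\<^sub>R t) x \<in> A" by (rule A(2)[OF _ x])
    then have "norm t *\<^sub>R R ((1 / norm t) *\<^sub>R t) x \<in> A" by (rule subspace_mul[OF A(1)])
    then show ?thesis using False by (simp add: R_simps)
  qed
qed (rule A(1))

text \<open>Isomorphisms match the points of the two spheres, so conditions at all points, at some point, and at
no point are transported.\<close>

lemma iso_conditions:
  assumes X: "is_pair X" and Y: "is_pair Y" and t: "iso_of_pairs X Y t"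
  shows "\<forall>v\<in>S2. quat_module.spans_at (act X) (Sub X) (Car X) v \<Longrightarrow> \<forall>v\<in>S2. quat_module.spans_at (act Y) (Sub Y) (Car Y) v"
    and "\<exists>v\<in>S2. quat_module.spans_at (act X) (Sub X) (Car X) v \<and> v \<notin> quat_module.complex_points (act X) (Sub X) \<Longrightarrow>
       \<exists>v\<in>S2. quat_module.spans_at (act Y) (Sub Y) (Car Y) v \<and> v \<notin> quat_module.complex_points (act Y) (Sub Y)"
    and "quat_module.complex_points (act X) (Sub X) = {} \<Longrightarrow> quat_module.complex_points (act Y) (Sub Y) = {}"
proof -
  note mX = pair_module[OF X] and mY = pair_module[OF Y] and t = iso_of_pairsD[OF t]
  interpret X: quat_module "Car X" "act X" by (rule mX(1))
  interpret Y: quat_module "Car Y" "act Y" by (rule mY(1))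
  have spans: "Y.spans_at (Sub Y) (Car Y) v"
    if uv: "\<forall>x\<in>Car X. t (act X u x) = act Y v (t x)" and s: "X.spans_at (Sub X) (Car X) u" for u v
    unfolding Y.spans_at_def
  proof
    fix y assume "y \<in> Car Y"
    then obtain x where x: "x \<in> Car X" "y = t x" using t(3) by blast
    then obtain a b where ab: "a \<in> Sub X" "b \<in> Sub X" "x = a + act X u b" using X.spans_atD[OF s] by blast
    have "b \<in> Car X" using ab mX(4) by blast
    then have "y = t a + act Y v (t b)" using x ab uv by (simp add: linear_add[OF t(1)])
    moreover have "t a \<in> Sub Y" "t b \<in> Sub Y" using ab t(4) by blast+
    ultimately show "\<exists>a\<in>Sub Y. \<exists>b\<in>Sub Y. y = a + act Y v b" by blast
  qed
  have points: "v \<notin> Y.complex_points (Sub Y)"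
    if uv: "\<forall>x\<in>Car X. t (act X u x) = act Y v (t x)" and u: "u \<in> S2" "u \<notin> X.complex_points (Sub X)" for u v
  proof
    assume "v \<in> Y.complex_points (Sub Y)"
    then obtain y where y: "y \<in> Sub Y" "y \<noteq> 0" "act Y v y \<in> Sub Y" by (auto simp: Y.complex_points_def)
    then obtain x where x: "x \<in> Sub X" "y = t x" using t(4) by blast
    then have xC: "x \<in> Car X" using mX(4) by blast
    obtain x' where x': "x' \<in> Sub X" "act Y v y = t x'" using y(3) t(4) by blast
    have "t (act X u x) = t x'" using uv x xC x' by simp
    then have "act X u x = x'" using t(2) X.R_in[OF xC] x'(1) mX(4) by (meson inj_onD subsetD)
    moreover have "x \<noteq> 0" using y(2) x(2) linear_0[OF t(1)] by auto
    ultimately show False using u x x' by (auto simp: X.complex_points_def)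
  qed
  show "\<forall>v\<in>S2. Y.spans_at (Sub Y) (Car Y) v" if "\<forall>v\<in>S2. X.spans_at (Sub X) (Car X) v"
    using that t(6) spans by blast
  show "\<exists>v\<in>S2. Y.spans_at (Sub Y) (Car Y) v \<and> v \<notin> Y.complex_points (Sub Y)"
    if ex: "\<exists>v\<in>S2. X.spans_at (Sub X) (Car X) v \<and> v \<notin> X.complex_points (Sub X)"
  proof -
    obtain u where u: "u \<in> S2" "X.spans_at (Sub X) (Car X) u" "u \<notin> X.complex_points (Sub X)" using ex by blast
    obtain v where "v \<in> S2" "\<forall>x\<in>Car X. t (act X u x) = act Y v (t x)" using t(5)[OF u(1)] by blast
    then show ?thesis using spans points u by blast
  qed
  show "Y.complex_points (Sub Y) = {}" if e: "X.complex_points (Sub X) = {}"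
  proof -
    have "v \<notin> Y.complex_points (Sub Y)" if v: "v \<in> S2" for v
    proof -
      obtain u where "u \<in> S2" "\<forall>x\<in>Car X. t (act X u x) = act Y v (t x)" using t(6)[OF v] by blast
      then show ?thesis using points e by blast
    qed
    then show ?thesis by (auto simp: Y.complex_points_def)
  qed
qed

text \<open>The image in \<open>Q\<close> of a factor \<open>X\<close> of a product \<open>W\<close> that is isomorphic to \<open>Q\<close>.  The rotation \<open>k\<close> accounts for the
isometry used in forming the product.\<close>

lemma summand_transport:
  assumes Q: "is_pair Q" and X: "is_pair X" and \<phi>: "iso_of_pairs W Q \<phi>"
    and j: "linear j" "inj_on j (Car X)" "j ` Car X \<subseteq> Car W" "Sub W \<inter> j ` Car X = j ` Sub X" and SW: "Sub W \<subseteq> Car W"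
    and k: "rotation k" "\<And>u x. x \<in> Car X \<Longrightarrow> act W u (j x) = j (act X (k u) x)"
    and A: "A = \<phi> ` j ` Car X"
  shows "stable_subspace (act Q) A" "A \<subseteq> Car Q" "Sub Q \<inter> A = \<phi> ` j ` Sub X"
    "iso_of_pairs X (sub_pair Q A) (\<lambda>x. \<phi> (j x))"
proof -
  note q = pair_module[OF Q] and x = pair_module[OF X] and p = iso_of_pairsD[OF \<phi>]
  interpret Q: quat_module "Car Q" "act Q" by (rule q(1))
  interpret X: quat_module "Car X" "act X" by (rule x(1))
  have lin: "linear (\<lambda>x. \<phi> (j x))" using linear_compose[OF j(1) p(1)] by (simp add: o_def)
  have subA: "subspace A"
    unfolding A using linear_subspace_image[OF lin X.E] by (simp add: image_image)
  show AQ: "A \<subseteq> Car Q" unfolding A p(3)[symmetric] using j(3) by blast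
  have jW: "j x \<in> Car W" if "x \<in> Car X" for x using j(3) that by blast
  have jA: "\<phi> (j x) \<in> A" if "x \<in> Car X" for x using that unfolding A by blast
  show st: "stable_subspace (act Q) A"
  proof (rule Q.stable_subspaceI[OF subA])
    fix v a assume v: "v \<in> S2" and "a \<in> A"
    then obtain x where x: "x \<in> Car X" "a = \<phi> (j x)" unfolding A by blast
    obtain u where "\<forall>p\<in>Car W. \<phi> (act W u p) = act Q v (\<phi> p)" using p(6)[OF v] by blast
    then have "act Q v a = \<phi> (act W u (j x))" using x jW by simp
    also have "\<dots> = \<phi> (j (act X (k u) x))" using k(2)[OF x(1)] by simp
    finally show "act Q v a \<in> A" using jA[OF X.R_in[OF x(1)]] by simp
  qed
  show S: "Sub Q \<inter> A = \<phi> ` j ` Sub X"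
  proof -
    have "Sub Q \<inter> A = \<phi> ` (Sub W \<inter> j ` Car X)"
      unfolding A p(4)[symmetric] using inj_on_image_Int[OF p(2) SW j(3)] by simp
    then show ?thesis using j(4) by simp
  qed
  note sp = sub_pair(2)[OF Q st AQ]
  show "iso_of_pairs X (sub_pair Q A) (\<lambda>x. \<phi> (j x))"
    unfolding iso_of_pairs_def
  proof (intro conjI ballI)
    show "linear (\<lambda>x. \<phi> (j x))" by (rule lin)
    show "inj_on (\<lambda>x. \<phi> (j x)) (Car X)"
      using comp_inj_on[OF j(2) inj_on_subset[OF p(2) j(3)]] by (simp add: o_def)
    show "(\<lambda>x. \<phi> (j x)) ` Car X = Car (sub_pair Q A)" by (simp add: A image_image)
    show "(\<lambda>x. \<phi> (j x)) ` Sub X = Sub (sub_pair Q A)" by (simp add: S image_image)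
    have eq: "\<phi> (j (act X (k u) x)) = act (sub_pair Q A) v (\<phi> (j x))"
      if "\<forall>p\<in>Car W. \<phi> (act W u p) = act Q v (\<phi> p)" "x \<in> Car X" for u v x
      using that jW sp[OF jA[OF that(2)]] k(2)[OF that(2), of u] by metis
    show "\<exists>v\<in>S2. \<forall>x\<in>Car X. \<phi> (j (act X u x)) = act (sub_pair Q A) v (\<phi> (j x))" if u: "u \<in> S2" for u
    proof -
      obtain u0 where u0: "u0 \<in> S2" "k u0 = u" using rotation_S2_surj[OF k(1) u] by blast
      obtain v where "v \<in> S2" "\<forall>p\<in>Car W. \<phi> (act W u0 p) = act Q v (\<phi> p)" using p(5)[OF u0(1)] by blast
      then show ?thesis using eq[of u0 v] u0(2) by blast
    qed
    show "\<exists>u\<in>S2. \<forall>x\<in>Car X. \<phi> (j (act X u x)) = act (sub_pair Q A) v (\<phi> (j x))" if v: "v \<in> S2" for v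
    proof -
      obtain u where "u \<in> S2" "\<forall>p\<in>Car W. \<phi> (act W u p) = act Q v (\<phi> p)" using p(6)[OF v] by blast
      then show ?thesis using eq[of u v] rotationD(4)[OF k(1)] by blast
    qed
  qed
qed

lemma decomposition_split:
  assumes Q: "is_pair Q" and d: "decomposition Q M N C \<phi>"
  shows "\<exists>A B D. quat_module.split3 (Car Q) (act Q) (Sub Q) A B D \<and>
     isomorphic_pairs M (sub_pair Q A) \<and> isomorphic_pairs N (sub_pair Q B) \<and> isomorphic_pairs C (sub_pair Q D) \<and>
     filtration Q M N \<phi> = [({0}, {0}), (Sub Q \<inter> A, A), (Sub Q \<inter> sum_space A B, sum_space A B), (Sub Q, Car Q)]"
proof -
  note q = pair_module[OF Q]
  interpret quat_module "Car Q" "act Q" by (rule q(1))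
  obtain T T' where MNC: "is_pair M" "CR_pair M" "is_pair N" "torsion_pair N" "is_pair C" "co_CR_pair C"
    and T: "op_isometry T" "op_isometry T'"
    and pi: "pair_isomorphism (prod_pair T' (prod_pair T M N) C) Q \<phi>"
    using d unfolding decomposition_def by blast
  obtain g where g: "rotation g" "\<And>u. u \<in> S2 \<Longrightarrow> T u = g u" using op_isometry_rotation[OF T(1)] by blast
  obtain g' where g': "rotation g'" "\<And>u. u \<in> S2 \<Longrightarrow> T' u = g' u" using op_isometry_rotation[OF T(2)] by blast
  note p1 = prod_pair[OF MNC(1,3) g]
  note p2 = prod_pair[OF p1(1) MNC(5) g']
  let ?W = "prod_pair T' (prod_pair T M N) C"
  have iso: "iso_of_pairs ?W Q \<phi>" using pi pair_isomorphism_iff[OF p2(1) Q] by blast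
  note p = iso_of_pairsD[OF iso]
  note m = pair_module[OF MNC(1)] and n = pair_module[OF MNC(3)] and c = pair_module[OF MNC(5)]
  interpret M: quat_module "Car M" "act M" by (rule m(1))
  interpret N: quat_module "Car N" "act N" by (rule n(1))
  interpret C: quat_module "Car C" "act C" by (rule c(1))
  have z: "0 \<in> Car M" "0 \<in> Car N" "0 \<in> Car C" "0 \<in> Sub M" "0 \<in> Sub N" "0 \<in> Sub C"
    using subspace_0 M.E N.E C.E m(3) n(3) c(3) by auto
  have actW: "act ?W u ((x, y), v) = ((act M u x, act N (g u) y), act C (g' u) v)"
    if "x \<in> Car M" "y \<in> Car N" "v \<in> Car C" for u x y v
    using p2(2)[of "(x, y)" v u] p1(2)[of x y u] that by simp
  have SW: "Sub ?W \<subseteq> Car ?W" using m(4) n(4) c(4) by auto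
  have rid: "rotation (\<lambda>v. v)" by (simp add: rotation_def orthogonal_transformation_id)
  define jM where "jM = (\<lambda>x. ((x, 0), 0) :: ('b \<times> 'c) \<times> 'd)"
  define jN where "jN = (\<lambda>x. ((0, x), 0) :: ('b \<times> 'c) \<times> 'd)"
  define jC where "jC = (\<lambda>x. ((0, 0), x) :: ('b \<times> 'c) \<times> 'd)"
  define A where "A = \<phi> ` jM ` Car M"
  define B where "B = \<phi> ` jN ` Car N"
  define D where "D = \<phi> ` jC ` Car C"
  have jlin: "linear jM" "linear jN" "linear jC" by (auto simp: jM_def jN_def jC_def intro!: linearI)
  have jinj: "inj_on jM X" "inj_on jN Y" "inj_on jC Z" for X Y Z by (auto simp: jM_def jN_def jC_def inj_on_def)
  have jcar: "jM ` Car M \<subseteq> Car ?W" "jN ` Car N \<subseteq> Car ?W" "jC ` Car C \<subseteq> Car ?W"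
    using z by (auto simp: jM_def jN_def jC_def)
  have jsub: "Sub ?W \<inter> jM ` Car M = jM ` Sub M" "Sub ?W \<inter> jN ` Car N = jN ` Sub N" "Sub ?W \<inter> jC ` Car C = jC ` Sub C"
    using z m(4) n(4) c(4) by (auto simp: jM_def jN_def jC_def)
  have actj: "x \<in> Car M \<Longrightarrow> act ?W u (jM x) = jM (act M u x)" "y \<in> Car N \<Longrightarrow> act ?W u (jN y) = jN (act N (g u) y)"
      "v \<in> Car C \<Longrightarrow> act ?W u (jC v) = jC (act C (g' u) v)" for x y v u
    using z by (simp_all add: jM_def jN_def jC_def actW M.R_simps N.R_simps C.R_simps)
  note tM = summand_transport[OF Q MNC(1) iso jlin(1) jinj(1) jcar(1) jsub(1) SW rid actj(1) A_def]
  note tN = summand_transport[OF Q MNC(3) iso jlin(2) jinj(2) jcar(2) jsub(2) SW g(1) actj(2) B_def]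
  note tC = summand_transport[OF Q MNC(5) iso jlin(3) jinj(3) jcar(3) jsub(3) SW g'(1) actj(3) D_def]
  note sM = sub_pair[OF Q tM(1,2)] and sN = sub_pair[OF Q tN(1,2)] and sC = sub_pair[OF Q tC(1,2)]
  note cM = sub_pair_conditions[OF Q tM(1,2)] and cN = sub_pair_conditions[OF Q tN(1,2)]
    and cC = sub_pair_conditions[OF Q tC(1,2)]
  have sub: "subspace A" "subspace B" "subspace D" using tM(1) tN(1) tC(1) by (simp_all add: stable_subspace_def)
  have CR: "\<forall>v\<in>S2. spans_at (Sub Q \<inter> A) A v"
    using iso_conditions(1)[OF MNC(1) sM(1) tM(4)] MNC(2) CR_pair_iff[OF MNC(1)] cM(1) by simp
  have tor: "\<exists>v\<in>S2. spans_at (Sub Q \<inter> B) B v \<and> v \<notin> complex_points (Sub Q \<inter> B)"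
  proof -
    have "\<exists>v\<in>S2. N.spans_at (Sub N) (Car N) v \<and> v \<notin> N.complex_points (Sub N)"
      using torsion_pairD[OF MNC(3,4)] by blast
    from iso_conditions(2)[OF MNC(3) sN(1) tN(4) this] show ?thesis using cN by simp
  qed
  have co: "complex_points (Sub Q \<inter> D) = {}"
    using iso_conditions(3)[OF MNC(5) sC(1) tC(4)] MNC(6) co_CR_pair_iff[OF MNC(5)] cC(2) by simp
  have \<phi>: "\<phi> ((x, y), v) = \<phi> (jM x) + \<phi> (jN y) + \<phi> (jC v)" for x y v
  proof -
    have "((x, y), v) = jM x + jN y + jC v" by (simp add: jM_def jN_def jC_def)
    then show ?thesis by (simp only: linear_add[OF p(1)])
  qed
  have AB: "sum_space A B = \<phi> ` ((Car M \<times> Car N) \<times> {0})"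
  proof -
    have "\<phi> (jM x) + \<phi> (jN y) = \<phi> ((x, y), 0)" for x y
      using \<phi>[of x y 0] linear_0[OF p(1)] by (simp add: jC_def zero_prod_def)
    then show ?thesis unfolding sum_space_def A_def B_def by (auto simp: image_iff) metis+
  qed
  have inter: "\<phi> ` X \<inter> \<phi> ` Y = \<phi> ` (X \<inter> Y)" if "X \<subseteq> Car ?W" "Y \<subseteq> Car ?W" for X Y
    using inj_on_image_Int[OF p(2) that] by simp
  have ABW: "(Car M \<times> Car N) \<times> {0} \<subseteq> Car ?W" using z by auto
  have \<phi>0: "\<phi> ` {0} = {0}" using linear_0[OF p(1)] by simp
  have ds1: "direct_split (Car Q) (sum_space A B) D"
    unfolding direct_split_def
  proof (intro conjI)
    show "sum_space A B \<subseteq> Car Q" unfolding AB p(3)[symmetric] using ABW by blast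
    show "D \<subseteq> Car Q" by (rule tC(2))
    have "((Car M \<times> Car N) \<times> {0}) \<inter> jC ` Car C = {0}" using z by (auto simp: jC_def zero_prod_def)
    then show "sum_space A B \<inter> D = {0}" unfolding AB D_def using inter[OF ABW jcar(3)] \<phi>0 by simp
    show "Car Q \<subseteq> sum_space (sum_space A B) D"
    proof
      fix x assume "x \<in> Car Q"
      then have "x \<in> \<phi> ` ((Car M \<times> Car N) \<times> Car C)" using p(3) by simp
      then obtain a b v where "x = \<phi> ((a, b), v)" "a \<in> Car M" "b \<in> Car N" "v \<in> Car C" by blast
      then show "x \<in> sum_space (sum_space A B) D"
        unfolding \<phi> A_def B_def D_def by (auto intro!: sum_spaceI)
    qed
  qed
  have ds2: "direct_split (sum_space A B) A B"
    unfolding direct_split_def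
  proof (intro conjI)
    show "A \<subseteq> sum_space A B" "B \<subseteq> sum_space A B" by (rule sum_space_upper[OF sub(1,2)])+
    have "jM ` Car M \<inter> jN ` Car N = {0}" using z by (auto simp: jM_def jN_def zero_prod_def)
    then show "A \<inter> B = {0}" unfolding A_def B_def using inter[OF jcar(1,2)] \<phi>0 by simp
  qed simp
  have U: "Sub Q \<subseteq> sum_space (sum_space (Sub Q \<inter> A) (Sub Q \<inter> B)) (Sub Q \<inter> D)"
  proof
    fix x assume "x \<in> Sub Q"
    then have "x \<in> \<phi> ` ((Sub M \<times> Sub N) \<times> Sub C)" using p(4) by simp
    then obtain a b v where x: "x = \<phi> ((a, b), v)" "a \<in> Sub M" "b \<in> Sub N" "v \<in> Sub C" by blast
    have "\<phi> (jM a) \<in> Sub Q \<inter> A" "\<phi> (jN b) \<in> Sub Q \<inter> B" "\<phi> (jC v) \<in> Sub Q \<inter> D"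
      using x tM(3) tN(3) tC(3) by blast+
    then show "x \<in> sum_space (sum_space (Sub Q \<inter> A) (Sub Q \<inter> B)) (Sub Q \<inter> D)"
      unfolding x(1) \<phi> by (intro sum_spaceI)
  qed
  have "split3 (Sub Q) A B D"
    unfolding split3_def using tM(1) tN(1) tC(1) ds1 ds2 U CR tor co by blast
  moreover have "isomorphic_pairs M (sub_pair Q A)" "isomorphic_pairs N (sub_pair Q B)" "isomorphic_pairs C (sub_pair Q D)"
    using isomorphic_pairs_iff MNC sM(1) sN(1) sC(1) tM(4) tN(4) tC(4) by blast+
  moreover have "filtration Q M N \<phi> = [({0}, {0}), (Sub Q \<inter> A, A), (Sub Q \<inter> sum_space A B, sum_space A B), (Sub Q, Car Q)]"
  proof -
    have i1: "(X \<times> {0}) \<times> {0} = jM ` X" for X by (auto simp: jM_def)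
    have "Sub Q \<inter> sum_space A B = \<phi> ` (Sub ?W \<inter> (Car M \<times> Car N) \<times> {0})"
      unfolding AB p(4)[symmetric] by (rule inter[OF SW ABW])
    also have "Sub ?W \<inter> (Car M \<times> Car N) \<times> {0} = (Sub M \<times> Sub N) \<times> {0}"
      using z m(4) n(4) by auto
    finally have e1: "\<phi> ` ((Sub M \<times> Sub N) \<times> {0}) = Sub Q \<inter> sum_space A B" by (rule sym)
    have e2: "\<phi> ` jM ` Car M = A" by (simp only: A_def)
    show ?thesis by (simp only: filtration_def i1 e1 e2 tM(3)[symmetric] AB[symmetric])
  qed
  ultimately show ?thesis by blast
qed

text \<open>The projection to \<open>C\<close> along \<open>A\<close> identifies two complements of \<open>A\<close>, including their real subspaces.\<close>

lemma complement_isomorphic: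
  assumes Q: "is_pair Q" and A: "stable_subspace (act Q) A" and B: "stable_subspace (act Q) B" "B \<subseteq> Car Q"
    and C: "stable_subspace (act Q) C" "C \<subseteq> Car Q"
    and AB: "A \<inter> B = {0}" and AC: "A \<inter> C = {0}" and eq: "sum_space A B = sum_space A C"
    and UB: "Sub Q \<inter> sum_space A B \<subseteq> sum_space (Sub Q \<inter> A) (Sub Q \<inter> B)"
    and UC: "Sub Q \<inter> sum_space A C \<subseteq> sum_space (Sub Q \<inter> A) (Sub Q \<inter> C)"
  shows "isomorphic_pairs (sub_pair Q B) (sub_pair Q C)"
proof -
  interpret quat_module "Car Q" "act Q" by (rule pair_module(1)[OF Q])
  obtain p where p: "linear p" "inj_on p B" "p ` B = C" "p ` (Sub Q \<inter> B) = Sub Q \<inter> C"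
    "\<And>t x. x \<in> B \<Longrightarrow> p (act Q t x) = act Q t (p x)"
    by (rule complement_iso[OF A B(1) C(1) AB AC eq UB UC]) blast
  note sB = sub_pair[OF Q B] and sC = sub_pair[OF Q C]
  have rid: "rotation (\<lambda>v. v)" by (simp add: rotation_def orthogonal_transformation_id)
  have pC: "p x \<in> C" if "x \<in> B" for x using p(3) that by blast
  have "iso_of_pairs (sub_pair Q B) (sub_pair Q C) p"
    by (rule iso_of_pairsI[OF _ _ _ _ rid]) (use p sB(2) sC(2) pC in simp_all)
  then show ?thesis using isomorphic_pairs_iff[OF sB(1) sC(1)] by blast
qed

lemma isomorphic_pairs_trans:
  assumes "is_pair P" "is_pair Q" "is_pair R" "isomorphic_pairs P Q" "isomorphic_pairs Q R"
  shows "isomorphic_pairs P R"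
proof -
  obtain f g where "iso_of_pairs P Q f" "iso_of_pairs Q R g" using assms isomorphic_pairs_iff by metis
  from iso_of_pairs_trans[OF this] show ?thesis using isomorphic_pairs_iff assms by blast
qed

theorem pair_decomposition_unique:
  assumes Q: "is_pair Q" and d1: "decomposition Q M1 N1 C1 \<phi>1" and d2: "decomposition Q M2 N2 C2 \<phi>2"
  shows "isomorphic_pairs M1 M2 \<and> isomorphic_pairs N1 N2 \<and> isomorphic_pairs C1 C2 \<and>
    filtration Q M1 N1 \<phi>1 = filtration Q M2 N2 \<phi>2"
proof -
  note q = pair_module[OF Q]
  interpret quat_module "Car Q" "act Q" by (rule q(1))
  have pairs: "is_pair M1" "is_pair N1" "is_pair C1" "is_pair M2" "is_pair N2" "is_pair C2"
    using d1 d2 unfolding decomposition_def by blast+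
  obtain A1 B1 D1 where s1: "split3 (Sub Q) A1 B1 D1"
    and i1: "isomorphic_pairs M1 (sub_pair Q A1)" "isomorphic_pairs N1 (sub_pair Q B1)" "isomorphic_pairs C1 (sub_pair Q D1)"
    and f1: "filtration Q M1 N1 \<phi>1 = [({0}, {0}), (Sub Q \<inter> A1, A1), (Sub Q \<inter> sum_space A1 B1, sum_space A1 B1), (Sub Q, Car Q)]"
    using decomposition_split[OF Q d1] by blast
  obtain A2 B2 D2 where s2: "split3 (Sub Q) A2 B2 D2"
    and i2: "isomorphic_pairs M2 (sub_pair Q A2)" "isomorphic_pairs N2 (sub_pair Q B2)" "isomorphic_pairs C2 (sub_pair Q D2)"
    and f2: "filtration Q M2 N2 \<phi>2 = [({0}, {0}), (Sub Q \<inter> A2, A2), (Sub Q \<inter> sum_space A2 B2, sum_space A2 B2), (Sub Q, Car Q)]"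
    using decomposition_split[OF Q d2] by blast
  have A: "A1 = A2" and AB: "sum_space A1 B1 = sum_space A2 B2"
    using split3_le[OF q(3,4) s1 s2] split3_le[OF q(3,4) s2 s1] by blast+
  note D1 = split3D[OF q(3,4) s1] and D2 = split3D[OF q(3,4) s2]
  have st: "stable_subspace (act Q) A1" "stable_subspace (act Q) B1" "stable_subspace (act Q) D1"
     "stable_subspace (act Q) A2" "stable_subspace (act Q) B2" "stable_subspace (act Q) D2"
    using s1 s2 unfolding split3_def by blast+
  have sp: "is_pair (sub_pair Q A1)" "is_pair (sub_pair Q B1)" "is_pair (sub_pair Q D1)"
      "is_pair (sub_pair Q B2)" "is_pair (sub_pair Q D2)"
    using sub_pair(1)[OF Q] st D1(5-7) D2(5-7) by blast+
  have B: "isomorphic_pairs (sub_pair Q B1) (sub_pair Q B2)"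
    by (rule complement_isomorphic[OF Q st(1,2) D1(6) st(5) D2(6) D1(3)])
      (use D1 D2 A AB in simp_all)
  have D: "isomorphic_pairs (sub_pair Q D1) (sub_pair Q D2)"
  proof (rule complement_isomorphic[OF Q D1(1) st(3) D1(7) st(6) D2(7) D1(2)])
    show "sum_space A1 B1 \<inter> D2 = {0}" using D2(2) AB by simp
    show "sum_space (sum_space A1 B1) D1 = sum_space (sum_space A1 B1) D2" using D1(4) D2(4) AB by simp
    show "Sub Q \<inter> sum_space (sum_space A1 B1) D1 \<subseteq> sum_space (Sub Q \<inter> sum_space A1 B1) (Sub Q \<inter> D1)"
      using D1(8) by blast
    show "Sub Q \<inter> sum_space (sum_space A1 B1) D2 \<subseteq> sum_space (Sub Q \<inter> sum_space A1 B1) (Sub Q \<inter> D2)"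
      unfolding AB using D2(8) by blast
  qed
  have "isomorphic_pairs M1 M2"
    by (rule isomorphic_pairs_trans[OF pairs(1) sp(1) pairs(4) i1(1)]) (use isomorphic_pairs_sym i2(1) A in blast)
  moreover have "isomorphic_pairs N1 N2"
    using isomorphic_pairs_trans[OF pairs(2) sp(2,4) i1(2) B] isomorphic_pairs_sym[OF i2(2)]
    by (intro isomorphic_pairs_trans[OF pairs(2) sp(4) pairs(5)])
  moreover have "isomorphic_pairs C1 C2"
    using isomorphic_pairs_trans[OF pairs(3) sp(3,5) i1(3) D] isomorphic_pairs_sym[OF i2(3)]
    by (intro isomorphic_pairs_trans[OF pairs(3) sp(5) pairs(6)])
  moreover have "filtration Q M1 N1 \<phi>1 = filtration Q M2 N2 \<phi>2" using f1 f2 A AB by simp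
  ultimately show ?thesis by blast
qed

section \<open>Products and decompositions of pairs\<close>

theorem corollary4p2:
  fixes P :: "'a::euclidean_space qpair" and P' :: "'b::euclidean_space qpair"
    and Q :: "'p::euclidean_space qpair"
  shows
    "(is_pair P \<and> is_pair P' \<and> (torsion_free_pair P \<or> torsion_free_pair P') \<longrightarrow>
        (\<forall>T\<^sub>1 T\<^sub>2. op_isometry T\<^sub>1 \<and> op_isometry T\<^sub>2 \<longrightarrow>
           isomorphic_pairs (prod_pair T\<^sub>1 P P') (prod_pair T\<^sub>2 P P')))
   \<and> (is_pair Q \<longrightarrow>
        (\<exists>(M :: 'p qpair) (N :: 'p qpair) (C :: 'p qpair) \<phi>. decomposition Q M N C \<phi>) \<and>
        (\<forall>(M\<^sub>1 :: 'c::euclidean_space qpair) (N\<^sub>1 :: 'd::euclidean_space qpair)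
           (C\<^sub>1 :: 'e::euclidean_space qpair) \<phi>\<^sub>1
           (M\<^sub>2 :: 'f::euclidean_space qpair) (N\<^sub>2 :: 'g::euclidean_space qpair)
           (C\<^sub>2 :: 'h::euclidean_space qpair) \<phi>\<^sub>2.
           decomposition Q M\<^sub>1 N\<^sub>1 C\<^sub>1 \<phi>\<^sub>1 \<and> decomposition Q M\<^sub>2 N\<^sub>2 C\<^sub>2 \<phi>\<^sub>2 \<longrightarrow>
             isomorphic_pairs M\<^sub>1 M\<^sub>2 \<and> isomorphic_pairs N\<^sub>1 N\<^sub>2 \<and> isomorphic_pairs C\<^sub>1 C\<^sub>2 \<and>
             filtration Q M\<^sub>1 N\<^sub>1 \<phi>\<^sub>1 = filtration Q M\<^sub>2 N\<^sub>2 \<phi>\<^sub>2))"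
  using product_independent pair_decomposition_exists pair_decomposition_unique by blast

end
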